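(* There exist positive numerical constants $c$ and $c'$ such that for any positive integer $k$, any integers $p\ge q\ge1$, any real $p\times q$ matrix $\mathbf A$ and any sub-Gaussian noise distribution with mean $0$ and variance $1$, $$\mathbb E\big[\,|(U_k)_+^{1/(2k)}-\|\mathbf A\|_{2k}|\,\big]\le (c\,\|E\|_{\psi_2}k)^{c'k}\,(pq)^{1/4}.$$
   Context: $\mathbf Y=\mathbf A+\mathbf E$, where $\mathbf A$ is a deterministic real $p\times q$ matrix and the entries of the $p\times q$ random matrix $\mathbf E$ are independent copies of a sub-Gaussian random variable $E$ with $\mathbb E[E]=0$ and $\mathrm{Var}(E)=1$; $\|E\|_{\psi_2}$ is its sub-Gaussian norm, $\|E\|_{\psi_2}=\inf\{t>0:\mathbb E[e^{E^2/t^2}]\le2\}$. $\sigma_1(\mathbf A)\ge\dots\ge\sigma_q(\mathbf A)\ge0$ are the singular values and $\|\mathbf A\|_{2k}=(\sum_{i=1}^q\sigma_i^{2k}(\mathbf A))^{1/(2k)}$. $x_+=\max(x,0)$. Hermite polynomials: with $\phi(y)=e^{-y^2/2}(2\pi)^{-1/2}$, $H_r$ is the degree-$r$ polynomial defined by $\frac{d^r}{dy^r}\phi(y)=(-1)^rH_r(y)\phi(y)$ ($H_0=1$). For sequences $i=(i_1,\dots,i_k)\in\{1,\dots,p\}^k$ and $j=(j_1,\dots,j_k)\in\{1,\dots,q\}^k$, with the convention $j_{k+1}=j_1$, $N_{rs}(i,j)$ denotes the number of occurrences of the pair $(r,s)$ among the $2k$ pairs $(i_t,j_t)$ and $(i_t,j_{t+1})$,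 $t=1,\dots,k$. Then $$U_k=\sum_{i_1,\dots,i_k=1}^p\ \sum_{j_1,\dots,j_k=1}^q\ \prod_{r=1}^p\prod_{s=1}^qH_{N_{rs}(i,j)}(\mathbf Y_{rs}).$$ *)

theory Defs
  imports "HOL-Probability.Probability" "Jordan_Normal_Form.Char_Poly"
begin

(* Both definitions take the expectation as a Lebesgue integral with values in [0,\<infinity>]: the
   Bochner integral of a non-integrable function is 0, so it would satisfy the bound vacuously. *)

definition subgaussian :: "'a measure \<Rightarrow> ('a \<Rightarrow> real) \<Rightarrow> bool" where
  "subgaussian M X \<longleftrightarrow> X \<in> borel_measurable M \<and>
     (\<exists>t>0. (\<integral>\<^sup>+\<omega>. ennreal (exp ((X \<omega>)\<^sup>2 / t\<^sup>2)) \<partial>M) \<le> 2)"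

definition psi2_norm :: "'a measure \<Rightarrow> ('a \<Rightarrow> real) \<Rightarrow> real" where
  "psi2_norm M X = Inf {t. 0 < t \<and> (\<integral>\<^sup>+\<omega>. ennreal (exp ((X \<omega>)\<^sup>2 / t\<^sup>2)) \<partial>M) \<le> 2}"

(* In decreasing order and with multiplicity: the square roots of the eigenvalues of A^T A.
   The list has length dim_col A; its entry with index i - 1 is sigma_i(A). *)
definition singular_values :: "real mat \<Rightarrow> real list" where
  "singular_values A =
     rev (map sqrt (sorted_list_of_multiset (proots (char_poly (transpose_mat A * A)))))"

definition schatten_norm :: "nat \<Rightarrow> real mat \<Rightarrow> real" where
  "schatten_norm m A = (\<Sum>i<dim_col A. (singular_values A ! i) ^ m) powr (1 / real m)"

definition hermite :: "nat \<Rightarrow> real \<Rightarrow> real" where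
  "hermite r y = (-1) ^ r * (deriv ^^ r) std_normal_density y / std_normal_density y"

(* Indices start at 0, so the cyclic successor of t is Suc t mod k. A pair that occurs in both
   families counts twice. *)
definition pair_count :: "nat \<Rightarrow> (nat \<Rightarrow> nat) \<Rightarrow> (nat \<Rightarrow> nat) \<Rightarrow> nat \<Rightarrow> nat \<Rightarrow> nat" where
  "pair_count k i j r s =
     card {t. t < k \<and> i t = r \<and> j t = s} + card {t. t < k \<and> i t = r \<and> j (Suc t mod k) = s}"

definition U_stat :: "nat \<Rightarrow> real mat \<Rightarrow> real" where
  "U_stat k Y =
     (\<Sum>i \<in> {..<k} \<rightarrow>\<^sub>E {..<dim_row Y}. \<Sum>j \<in> {..<k} \<rightarrow>\<^sub>E {..<dim_col Y}.
        \<Prod>r<dim_row Y. \<Prod>s<dim_col Y. hermite (pair_count k i j r s) (Y $$ (r, s)))"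

(* The joint law of p * q independent entries with common law \<mu>; a sample \<omega> is read as the matrix
   mat p q \<omega>. *)
definition iid_entries :: "nat \<Rightarrow> nat \<Rightarrow> real measure \<Rightarrow> (nat \<times> nat \<Rightarrow> real) measure" where
  "iid_entries p q \<mu> = PiM ({..<p} \<times> {..<q}) (\<lambda>_. \<mu>)"

(* Expectations under iid_entries are those of any family of independent copies, on any
   probability space. *)
lemma (in prob_space) expectation_iid_entries:
  fixes f :: "real mat \<Rightarrow> real" and E :: "nat \<times> nat \<Rightarrow> 'a \<Rightarrow> real"
  assumes pq: "0 < p" "0 < q"
    and indep: "indep_vars (\<lambda>_. borel) E ({..<p} \<times> {..<q})"
    and law: "\<And>e. e \<in> {..<p} \<times> {..<q} \<Longrightarrow> distr M borel (E e) = \<mu>"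
    and f: "(\<lambda>\<omega>. f (mat p q \<omega>)) \<in> borel_measurable (iid_entries p q \<mu>)"
  shows "integrable (iid_entries p q \<mu>) (\<lambda>\<omega>. f (mat p q \<omega>)) \<longleftrightarrow>
           integrable M (\<lambda>x. f (mat p q (\<lambda>e. E e x)))"
    and "prob_space.expectation (iid_entries p q \<mu>) (\<lambda>\<omega>. f (mat p q \<omega>)) =
           expectation (\<lambda>x. f (mat p q (\<lambda>e. E e x)))"
proof -
  let ?I = "{..<p} \<times> {..<q}"
  let ?X = "\<lambda>x. \<lambda>e\<in>?I. E e x"
  have ne: "?I \<noteq> {}" using pq by auto
  have rv: "random_variable borel (E e)" if "e \<in> ?I" for e
    using indep that unfolding indep_vars_def by blast
  have X: "?X \<in> measurable M (PiM ?I (\<lambda>_. borel))"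
    by (rule measurable_restrict) (rule rv)
  have "distr M (PiM ?I (\<lambda>_. borel)) ?X = PiM ?I (\<lambda>e. distr M borel (E e))"
    by (rule iffD1[OF indep_vars_iff_distr_eq_PiM'[OF ne rv] indep])
  also have "\<dots> = iid_entries p q \<mu>"
    unfolding iid_entries_def by (rule PiM_cong[OF refl law])
  finally have D: "iid_entries p q \<mu> = distr M (PiM ?I (\<lambda>_. borel)) ?X" by (rule sym)
  have f': "(\<lambda>\<omega>. f (mat p q \<omega>)) \<in> borel_measurable (PiM ?I (\<lambda>_. borel))"
    using f unfolding D measurable_distr_eq1 .
  have m: "mat p q (?X x) = mat p q (\<lambda>e. E e x)" for x
    by (rule cong_mat) (simp_all only: restrict_apply mem_Times_iff fst_conv snd_conv lessThan_iff if_True simp_thms)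
  show "integrable (iid_entries p q \<mu>) (\<lambda>\<omega>. f (mat p q \<omega>)) \<longleftrightarrow>
           integrable M (\<lambda>x. f (mat p q (\<lambda>e. E e x)))"
    unfolding D using integrable_distr_eq[OF X f'] unfolding m .
  show "prob_space.expectation (iid_entries p q \<mu>) (\<lambda>\<omega>. f (mat p q \<omega>)) =
           expectation (\<lambda>x. f (mat p q (\<lambda>e. E e x)))"
    unfolding D using integral_distr[OF X f'] unfolding m .
qed

end

theory Submission
  imports Defs "Jordan_Normal_Form.Schur_Decomposition"
begin

text \<open>Index the summands of \<open>U_k\<close> by the closed walks of length \<open>2 k\<close> that alternate between columns
and rows. If every step of a walk read the corresponding entry of \<open>A\<close>, the sum over all walks would
be the trace of \<open>(A\<^sup>T A)^k\<close>, which is \<open>\<sigma>^(2 k)\<close> for the Schatten norm \<open>\<sigma>\<close> of order \<open>2 k\<close>. Because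
\<open>H_n(a + e) = \<Sum> (n choose l) a^(n - l) H_l(e)\<close>, the statistic of \<open>A + E\<close> splits over the sets \<open>B\<close> of
steps that read the noise instead of \<open>A\<close> (\<open>U_stat_chaos_expansion\<close>). The empty set contributes
\<open>\<sigma>^(2 k)\<close>, and the heart of the proof is that the part \<open>W_B\<close> of any other set satisfies
\<open>E W_B\<^sup>2 \<le> C (\<sigma>^(2 k - b) m^b)\<^sup>2\<close> with \<open>b = card B\<close> and \<open>m = (p q)^(1/4)\<close>
(\<open>chaos_part_second_moment_le\<close>).

The square of \<open>W_B\<close> is a sum over pairs of walks. Between two consecutive marked steps a walk reads
\<open>A\<close> only, and summing out the positions in between leaves an entry of an alternating product of \<open>A\<close>
and its transpose, a kernel of operator norm at most \<open>\<sigma>\<close> to the number of factors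
(\<open>sum_walks_marked\<close>, \<open>entry_step_bounded\<close>). What remains is a sum over the labels of the \<open>4 b\<close> ends
of the marked steps, called halves below. The expectation in front of the kernels depends only on
which labels coincide. Since \<open>E H_1(E) = E H_2(E) = 0\<close>, it vanishes unless every class of
halves with equal labels has at least two members, and at least four if no kernel joins it to
another class (\<open>pattern_moment_two\<close>, \<open>pattern_moment_four\<close>). No further
orthogonality is used, which is why the noise need not be Gaussian.

For a fixed pattern of coincidences the classes carry pairwise distinct labels. Averaging over all
colourings of the labels by the classes replaces distinctness by a restriction of each class to a
set of labels of its own (\<open>injective_sum_bound\<close>). The resulting sum over the labels of a graph,
whose edges are the kernels, is bounded as follows: split the vertices into a maximal independent
set and its complement, read the tensor product of the crossing kernels as one operator between the
labellings of the two sides, and apply the Cauchy--Schwarz inequality. A vertex with an edge to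
another vertex costs the square root of its number of labels, any other vertex the full number
(\<open>graph_sum_bound\<close>). Together with the sizes of the classes, every half costs at most the fourth
root of its number of labels (\<open>pattern_sum_bound\<close>). A marked step has one half among the rows and
one among the columns, so its cost is \<open>m\<close>.

There are at most \<open>(4 b)^(4 b)\<close> patterns and \<open>4^k\<close> sets \<open>B\<close>, and sub-Gaussian moments bound the
expectations by powers of \<open>\<psi> k\<close>; this is the source of the factor \<open>(c \<psi> k)^(c' k)\<close>. The elementary
inequality \<open>root_error_le\<close> turns the bound on \<open>E \<bar>U_k - \<sigma>^(2 k)\<bar>\<close> into one on the roots.\<close>

section \<open>Kernels of bounded operator norm\<close>

text \<open>A bound on the operator norm between the Euclidean spaces of functions on \<open>X\<close> and on \<open>Y\<close>. The
inequality sees only \<open>c\<^sup>2\<close>; with \<open>0 \<le> c\<close> the bounds of several kernels can be multiplied.\<close>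
definition kernel_bounded :: "'a set \<Rightarrow> 'b set \<Rightarrow> ('a \<Rightarrow> 'b \<Rightarrow> real) \<Rightarrow> real \<Rightarrow> bool" where
  "kernel_bounded X Y K c \<longleftrightarrow> 0 \<le> c \<and>
     (\<forall>f. (\<Sum>y\<in>Y. (\<Sum>x\<in>X. K x y * f x)\<^sup>2) \<le> c\<^sup>2 * (\<Sum>x\<in>X. (f x)\<^sup>2))"

lemma kernel_boundedD:
  assumes "kernel_bounded X Y K c"
  shows "0 \<le> c" "(\<Sum>y\<in>Y. (\<Sum>x\<in>X. K x y * f x)\<^sup>2) \<le> c\<^sup>2 * (\<Sum>x\<in>X. (f x)\<^sup>2)"
  using assms unfolding kernel_bounded_def by blast+

lemma abs_sum_mult_le:
  fixes f g :: "'a \<Rightarrow> real"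
  shows "\<bar>\<Sum>x\<in>X. f x * g x\<bar> \<le> sqrt (\<Sum>x\<in>X. (f x)\<^sup>2) * sqrt (\<Sum>x\<in>X. (g x)\<^sup>2)"
proof -
  have "sqrt ((\<Sum>x\<in>X. f x * g x)\<^sup>2) \<le> sqrt ((\<Sum>x\<in>X. (f x)\<^sup>2) * (\<Sum>x\<in>X. (g x)\<^sup>2))"
    by (rule real_sqrt_le_mono) (rule Cauchy_Schwarz_ineq_sum)
  then show ?thesis by (simp add: real_sqrt_mult)
qed

lemma kernel_bounded_cong:
  assumes "\<And>x y. x \<in> X \<Longrightarrow> y \<in> Y \<Longrightarrow> K x y = K' x y"
  shows "kernel_bounded X Y K c \<longleftrightarrow> kernel_bounded X Y K' c"
  unfolding kernel_bounded_def using assms by simp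

lemma kernel_bounded_bilinear:
  assumes "kernel_bounded X Y K c"
  shows "\<bar>\<Sum>x\<in>X. \<Sum>y\<in>Y. f x * K x y * g y\<bar>
           \<le> c * sqrt (\<Sum>x\<in>X. (f x)\<^sup>2) * sqrt (\<Sum>y\<in>Y. (g y)\<^sup>2)"
proof -
  have "(\<Sum>x\<in>X. \<Sum>y\<in>Y. f x * K x y * g y) = (\<Sum>y\<in>Y. (\<Sum>x\<in>X. K x y * f x) * g y)"
    unfolding sum_distrib_right by (subst sum.swap) (simp add: mult_ac)
  then have "\<bar>\<Sum>x\<in>X. \<Sum>y\<in>Y. f x * K x y * g y\<bar>
      \<le> sqrt (\<Sum>y\<in>Y. (\<Sum>x\<in>X. K x y * f x)\<^sup>2) * sqrt (\<Sum>y\<in>Y. (g y)\<^sup>2)"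
    using abs_sum_mult_le by metis
  also have "sqrt (\<Sum>y\<in>Y. (\<Sum>x\<in>X. K x y * f x)\<^sup>2) \<le> sqrt (c\<^sup>2 * (\<Sum>x\<in>X. (f x)\<^sup>2))"
    by (rule real_sqrt_le_mono) (rule kernel_boundedD(2)[OF assms])
  also have "\<dots> = c * sqrt (\<Sum>x\<in>X. (f x)\<^sup>2)"
    using kernel_boundedD(1)[OF assms] by (simp add: real_sqrt_mult)
  finally show ?thesis by (simp add: mult_right_mono sum_nonneg)
qed

text \<open>Apply the bilinear form of the kernel to the transposed image of \<open>g\<close> and to \<open>g\<close> itself, and cancel
one factor of the norm of that image.\<close>
lemma kernel_bounded_transpose:
  assumes "kernel_bounded X Y K c"
  shows "kernel_bounded Y X (\<lambda>y x. K x y) c"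
  unfolding kernel_bounded_def
proof (intro conjI allI kernel_boundedD(1)[OF assms])
  fix g :: "'b \<Rightarrow> real"
  define h where "h x = (\<Sum>y\<in>Y. K x y * g y)" for x
  have c: "0 \<le> c" by (rule kernel_boundedD(1)[OF assms])
  define s where "s = (\<Sum>x\<in>X. (h x)\<^sup>2)"
  define r where "r = (\<Sum>y\<in>Y. (g y)\<^sup>2)"
  have nn: "0 \<le> s" "0 \<le> r" by (simp_all add: s_def r_def sum_nonneg)
  have "s = (\<Sum>x\<in>X. \<Sum>y\<in>Y. h x * K x y * g y)"
    unfolding s_def power2_eq_square
    by (rule sum.cong[OF refl]) (subst (2) h_def, simp add: sum_distrib_left mult_ac)
  also have "\<dots> \<le> c * sqrt s * sqrt r"
    using kernel_bounded_bilinear[OF assms, of h g] unfolding s_def r_def by linarith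
  finally have le: "sqrt s * sqrt s \<le> (c * sqrt r) * sqrt s" using nn by (simp add: mult_ac)
  have "sqrt s \<le> c * sqrt r"
  proof (cases "s = 0")
    case True
    then show ?thesis using c nn by simp
  next
    case False
    then show ?thesis using mult_right_le_imp_le[OF le] nn by simp
  qed
  then have "(sqrt s)\<^sup>2 \<le> (c * sqrt r)\<^sup>2" using nn by (intro power_mono) auto
  then show "(\<Sum>x\<in>X. (\<Sum>y\<in>Y. K x y * g y)\<^sup>2) \<le> c\<^sup>2 * (\<Sum>y\<in>Y. (g y)\<^sup>2)"
    using nn by (simp add: s_def r_def h_def power_mult_distrib)
qed

text \<open>Along injections the new kernel is a submatrix of the old one: extend a function by zero outside
the image.\<close>
lemma kernel_bounded_reindex:
  assumes "kernel_bounded X' Y' K c" and fin: "finite X'" "finite Y'"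
    and f: "inj_on f X" "f ` X \<subseteq> X'" and g: "inj_on g Y" "g ` Y \<subseteq> Y'"
  shows "kernel_bounded X Y (\<lambda>x y. K (f x) (g y)) c"
  unfolding kernel_bounded_def
proof (intro conjI allI kernel_boundedD(1)[OF assms(1)])
  fix h :: "'c \<Rightarrow> real"
  define h' where "h' x' = (if x' \<in> f ` X then h (inv_into X f x') else 0)" for x'
  have push: "(\<Sum>x'\<in>X'. G x' (h' x')) = (\<Sum>x\<in>X. G (f x) (h x))"
    if "\<And>x'. G x' 0 = 0" for G :: "'a \<Rightarrow> real \<Rightarrow> real"
  proof -
    have "(\<Sum>x'\<in>X'. G x' (h' x')) = (\<Sum>x'\<in>f ` X. G x' (h' x'))"
      by (rule sum.mono_neutral_right) (use fin f that in \<open>auto simp: h'_def\<close>)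
    also have "\<dots> = (\<Sum>x\<in>X. G (f x) (h x))"
      by (subst sum.reindex[OF f(1)]) (rule sum.cong, auto simp: h'_def f(1))
    finally show ?thesis .
  qed
  have "(\<Sum>y\<in>Y. (\<Sum>x\<in>X. K (f x) (g y) * h x)\<^sup>2) = (\<Sum>y\<in>Y. (\<Sum>x'\<in>X'. K x' (g y) * h' x')\<^sup>2)"
    by (intro sum.cong refl) (subst push[of "\<lambda>x' v. K x' _ * v"], auto)
  also have "\<dots> = (\<Sum>y'\<in>g ` Y. (\<Sum>x'\<in>X'. K x' y' * h' x')\<^sup>2)"
    by (simp add: sum.reindex[OF g(1)])
  also have "\<dots> \<le> (\<Sum>y'\<in>Y'. (\<Sum>x'\<in>X'. K x' y' * h' x')\<^sup>2)"
    by (rule sum_mono2) (use fin g in auto)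
  also have "\<dots> \<le> c\<^sup>2 * (\<Sum>x'\<in>X'. (h' x')\<^sup>2)" by (rule kernel_boundedD(2)[OF assms(1)])
  also have "(\<Sum>x'\<in>X'. (h' x')\<^sup>2) = (\<Sum>x\<in>X. (h x)\<^sup>2)" by (rule push[of "\<lambda>x' v. v\<^sup>2"]) simp
  finally show "(\<Sum>y\<in>Y. (\<Sum>x\<in>X. K (f x) (g y) * h x)\<^sup>2) \<le> c\<^sup>2 * (\<Sum>x\<in>X. (h x)\<^sup>2)" .
qed

lemma kernel_bounded_subset:
  assumes "kernel_bounded X' Y' K c" "finite X'" "finite Y'" "X \<subseteq> X'" "Y \<subseteq> Y'"
  shows "kernel_bounded X Y K c"
  using kernel_bounded_reindex[OF assms(1-3), of "\<lambda>x. x" X "\<lambda>y. y" Y] assms(4,5) by simp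

lemma kernel_bounded_entry:
  assumes "kernel_bounded X Y K c" "finite X" "finite Y" "x \<in> X" "y \<in> Y"
  shows "\<bar>K x y\<bar> \<le> c"
proof -
  have "kernel_bounded {x} {y} K c" by (rule kernel_bounded_subset[OF assms(1-3)]) (use assms in auto)
  from kernel_bounded_bilinear[OF this, of "\<lambda>_. 1" "\<lambda>_. 1"] show ?thesis by simp
qed

lemma kernel_bounded_compose:
  assumes "kernel_bounded X Y K c" "kernel_bounded Y Z K' c'"
  shows "kernel_bounded X Z (\<lambda>x z. \<Sum>y\<in>Y. K x y * K' y z) (c * c')"
  unfolding kernel_bounded_def
proof (intro conjI allI)
  show "0 \<le> c * c'" using assms by (simp add: kernel_bounded_def)
  fix f :: "'a \<Rightarrow> real"
  have "(\<Sum>x\<in>X. (\<Sum>y\<in>Y. K x y * K' y z) * f x) = (\<Sum>y\<in>Y. K' y z * (\<Sum>x\<in>X. K x y * f x))" for z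
    unfolding sum_distrib_left sum_distrib_right by (subst sum.swap) (simp add: mult_ac)
  then have "(\<Sum>z\<in>Z. (\<Sum>x\<in>X. (\<Sum>y\<in>Y. K x y * K' y z) * f x)\<^sup>2)
      \<le> c'\<^sup>2 * (\<Sum>y\<in>Y. (\<Sum>x\<in>X. K x y * f x)\<^sup>2)"
    by (simp add: kernel_boundedD(2)[OF assms(2)])
  also have "\<dots> \<le> c'\<^sup>2 * (c\<^sup>2 * (\<Sum>x\<in>X. (f x)\<^sup>2))"
    by (intro mult_left_mono kernel_boundedD(2)[OF assms(1)]) simp
  finally show "(\<Sum>z\<in>Z. (\<Sum>x\<in>X. (\<Sum>y\<in>Y. K x y * K' y z) * f x)\<^sup>2) \<le> (c * c')\<^sup>2 * (\<Sum>x\<in>X. (f x)\<^sup>2)"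
    by (simp add: power_mult_distrib mult_ac)
qed

lemma kernel_bounded_id:
  assumes "finite X"
  shows "kernel_bounded X X (\<lambda>x y. of_bool (x = y)) 1"
  unfolding kernel_bounded_def
proof (intro conjI allI)
  fix f :: "'a \<Rightarrow> real"
  have "(\<Sum>x\<in>X. of_bool (x = y) * f x) = f y" if "y \<in> X" for y
    using assms that by (simp add: of_bool_def if_distrib[of "\<lambda>t. t * _"] sum.delta' cong: if_cong)
  then show "(\<Sum>y\<in>X. (\<Sum>x\<in>X. of_bool (x = y) * f x)\<^sup>2) \<le> 1\<^sup>2 * (\<Sum>x\<in>X. (f x)\<^sup>2)"
    by simp
qed simp

lemma sum_PiE_Un:
  assumes "S \<inter> T = {}"
  shows "sum F (PiE (S \<union> T) L) =
    (\<Sum>x\<in>PiE S L. \<Sum>y\<in>PiE T L. F (\<lambda>v. if v \<in> S then x v else y v))"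
proof -
  have "bij_betw (\<lambda>(x, y). \<lambda>v. if v \<in> S then x v else y v) (PiE S L \<times> PiE T L) (PiE (S \<union> T) L)"
  proof (rule bij_betw_byWitness[where f' = "\<lambda>z. (restrict z S, restrict z T)"])
    show "\<forall>a\<in>PiE S L \<times> PiE T L. (\<lambda>z. (restrict z S, restrict z T))
        ((\<lambda>(x, y). \<lambda>v. if v \<in> S then x v else y v) a) = a"
      using assms by (auto simp: fun_eq_iff PiE_iff extensional_def)
    show "\<forall>a'\<in>PiE (S \<union> T) L. (\<lambda>(x, y). \<lambda>v. if v \<in> S then x v else y v) (restrict a' S, restrict a' T) = a'"
      using assms by (auto simp: fun_eq_iff PiE_iff extensional_def)
    show "(\<lambda>(x, y). \<lambda>v. if v \<in> S then x v else y v) ` (PiE S L \<times> PiE T L) \<subseteq> PiE (S \<union> T) L"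
      using assms by (auto simp: PiE_iff extensional_def split: if_splits)
    show "(\<lambda>z. (restrict z S, restrict z T)) ` PiE (S \<union> T) L \<subseteq> PiE S L \<times> PiE T L"
      by (auto simp: PiE_iff)
  qed
  from sum.reindex_bij_betw[OF this, of F]
  show ?thesis by (simp add: sum.cartesian_product case_prod_unfold)
qed

lemma sum_PiE_insert:
  assumes "i \<notin> S"
  shows "sum F (PiE (insert i S) L) = (\<Sum>a\<in>L i. \<Sum>x\<in>PiE S L. F (x(i := a)))"
proof -
  have inj: "inj_on (\<lambda>(y, g). g(i := y)) (L i \<times> PiE S L)"
    by (rule inj_combinator[OF assms])
  show ?thesis
    unfolding PiE_insert_eq
    by (subst sum.reindex[OF inj]) (simp add: sum.cartesian_product case_prod_unfold)
qed

text \<open>One tensor factor at a time: apply the bound of the new factor for each value of the remaining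
coordinates, and then the bound of the remaining factors for each value of the new coordinate.\<close>
lemma kernel_bounded_tensor:
  assumes "finite C" "\<And>i. i \<in> C \<Longrightarrow> kernel_bounded (X i) (Y i) (K i) (c i)"
  shows "kernel_bounded (PiE C X) (PiE C Y) (\<lambda>x y. \<Prod>i\<in>C. K i (x i) (y i)) (prod c C)"
  using assms
proof (induction C)
  case empty
  show ?case by (simp add: kernel_bounded_def)
next
  case (insert i C)
  have IH: "kernel_bounded (PiE C X) (PiE C Y) (\<lambda>x y. \<Prod>i\<in>C. K i (x i) (y i)) (prod c C)"
    by (rule insert.IH) (use insert in auto)
  have Ki: "kernel_bounded (X i) (Y i) (K i) (c i)" using insert by simp
  have upd: "(\<Prod>j\<in>insert i C. K j ((x(i := a)) j) ((y(i := b)) j)) = K i a b * (\<Prod>j\<in>C. K j (x j) (y j))"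
    for x y a b
    using insert(1,2) by (auto intro!: prod.cong)
  let ?k = "\<lambda>x y. \<Prod>j\<in>C. K j (x j) (y j)"
  show ?case
    unfolding kernel_bounded_def
  proof (intro conjI allI)
    show "0 \<le> (\<Prod>i\<in>insert i C. c i)"
      using insert by (intro prod_nonneg) (auto simp: kernel_bounded_def)
    fix f :: "('a \<Rightarrow> 'b) \<Rightarrow> real"
    define G where "G a y = (\<Sum>x\<in>PiE C X. ?k x y * f (x(i := a)))" for a y
    have "(\<Sum>y\<in>PiE (insert i C) Y. (\<Sum>x\<in>PiE (insert i C) X. (\<Prod>j\<in>insert i C. K j (x j) (y j)) * f x)\<^sup>2)
      = (\<Sum>b\<in>Y i. \<Sum>y\<in>PiE C Y. (\<Sum>a\<in>X i. \<Sum>x\<in>PiE C X. (K i a b * ?k x y) * f (x(i := a)))\<^sup>2)"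
      unfolding sum_PiE_insert[OF insert(2)] upd ..
    also have "\<dots> = (\<Sum>y\<in>PiE C Y. \<Sum>b\<in>Y i. (\<Sum>a\<in>X i. K i a b * G a y)\<^sup>2)"
      unfolding G_def sum_distrib_left by (subst sum.swap) (simp add: mult_ac)
    also have "\<dots> \<le> (\<Sum>y\<in>PiE C Y. (c i)\<^sup>2 * (\<Sum>a\<in>X i. (G a y)\<^sup>2))"
      by (intro sum_mono kernel_boundedD(2)[OF Ki])
    also have "\<dots> = (c i)\<^sup>2 * (\<Sum>a\<in>X i. \<Sum>y\<in>PiE C Y. (G a y)\<^sup>2)"
      unfolding sum_distrib_left by (rule sum.swap)
    also have "\<dots> \<le> (c i)\<^sup>2 * (\<Sum>a\<in>X i. (prod c C)\<^sup>2 * (\<Sum>x\<in>PiE C X. (f (x(i := a)))\<^sup>2))"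
      unfolding G_def by (intro mult_left_mono sum_mono kernel_boundedD(2)[OF IH]) simp
    also have "\<dots> = (\<Prod>i\<in>insert i C. c i)\<^sup>2 * (\<Sum>x\<in>PiE (insert i C) X. (f x)\<^sup>2)"
      unfolding sum_PiE_insert[OF insert(2)] using insert(1,2)
      by (simp add: sum_distrib_left power_mult_distrib mult_ac)
    finally show "(\<Sum>y\<in>PiE (insert i C) Y. (\<Sum>x\<in>PiE (insert i C) X. (\<Prod>j\<in>insert i C. K j (x j) (y j)) * f x)\<^sup>2)
      \<le> (\<Prod>i\<in>insert i C. c i)\<^sup>2 * (\<Sum>x\<in>PiE (insert i C) X. (f x)\<^sup>2)" .
  qed
qed

text \<open>Several factors may read the same coordinate of \<open>x\<close> or of \<open>y\<close>. As long as each of \<open>x\<close> and \<open>y\<close> can be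
recovered from the values that are read, the kernel is a submatrix of the full tensor product.\<close>
lemma kernel_bounded_incidence:
  assumes C: "finite C" "\<And>i. i \<in> C \<Longrightarrow> kernel_bounded (A i) (B i) (K i) (c i)"
    and fin: "\<And>i. i \<in> C \<Longrightarrow> finite (A i)" "\<And>i. i \<in> C \<Longrightarrow> finite (B i)"
    and r: "\<And>x i. x \<in> X \<Longrightarrow> i \<in> C \<Longrightarrow> r x i \<in> A i"
      "\<And>x x'. x \<in> X \<Longrightarrow> x' \<in> X \<Longrightarrow> (\<And>i. i \<in> C \<Longrightarrow> r x i = r x' i) \<Longrightarrow> x = x'"
    and s: "\<And>y i. y \<in> Y \<Longrightarrow> i \<in> C \<Longrightarrow> s y i \<in> B i"
      "\<And>y y'. y \<in> Y \<Longrightarrow> y' \<in> Y \<Longrightarrow> (\<And>i. i \<in> C \<Longrightarrow> s y i = s y' i) \<Longrightarrow> y = y'"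
  shows "kernel_bounded X Y (\<lambda>x y. \<Prod>i\<in>C. K i (r x i) (s y i)) (prod c C)"
proof -
  have "kernel_bounded X Y (\<lambda>x y. \<Prod>i\<in>C. K i (restrict (r x) C i) (restrict (s y) C i)) (prod c C)"
  proof (rule kernel_bounded_reindex[OF kernel_bounded_tensor[OF C]])
    show "inj_on (\<lambda>x. restrict (r x) C) X"
      by (rule inj_onI, rule r(2)) (auto dest: fun_cong simp: restrict_def, metis)
    show "inj_on (\<lambda>y. restrict (s y) C) Y"
      by (rule inj_onI, rule s(2)) (auto dest: fun_cong simp: restrict_def, metis)
  qed (use C fin r s in \<open>auto intro!: finite_PiE\<close>)
  then show ?thesis by (simp cong: prod.cong)
qed

section \<open>Sums over the labellings of a graph\<close>

lemma abs_prod_le_prod: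
  fixes f c :: "'a \<Rightarrow> real"
  assumes "\<And>i. i \<in> I \<Longrightarrow> \<bar>f i\<bar> \<le> c i"
  shows "\<bar>\<Prod>i\<in>I. f i\<bar> \<le> (prod c I)"
  unfolding abs_prod by (rule prod_mono) (use assms in auto)

lemma sqrt_prod: "sqrt (\<Prod>i\<in>I. f i) = (\<Prod>i\<in>I. sqrt (f i))"
  by (induction I rule: infinite_finite_induct) (auto simp: real_sqrt_mult)

lemma sqrt_sum_squares_le:
  fixes f :: "'a \<Rightarrow> real"
  assumes "\<And>x. x \<in> X \<Longrightarrow> \<bar>f x\<bar> \<le> b" "0 \<le> b"
  shows "sqrt (\<Sum>x\<in>X. (f x)\<^sup>2) \<le> b * sqrt (card X)"
proof -
  have "(\<Sum>x\<in>X. (f x)\<^sup>2) \<le> (\<Sum>x\<in>X. b\<^sup>2)"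
    by (rule sum_mono) (metis abs_ge_zero assms(1) power2_abs power_mono)
  then have "sqrt (\<Sum>x\<in>X. (f x)\<^sup>2) \<le> sqrt (b\<^sup>2 * card X)"
    by (intro real_sqrt_le_mono) (simp add: mult.commute)
  then show ?thesis using assms(2) by (simp add: real_sqrt_mult)
qed

text \<open>This is how a graph is cut in two such that every vertex with a neighbour has one on the other side:
no two vertices of \<open>S\<close> are adjacent, and by maximality every vertex outside \<open>S\<close> is adjacent to one in
\<open>S\<close>.\<close>
lemma maximal_independent_set:
  assumes "finite V"
  obtains S where "S \<subseteq> V" "\<And>x y. x \<in> S \<Longrightarrow> y \<in> S \<Longrightarrow> x \<noteq> y \<Longrightarrow> \<not> adj x y"
    "\<And>v. v \<in> V \<Longrightarrow> v \<notin> S \<Longrightarrow> \<exists>x\<in>S. adj v x \<or> adj x v"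
proof -
  define P where "P S \<longleftrightarrow> S \<subseteq> V \<and> (\<forall>x\<in>S. \<forall>y\<in>S. x \<noteq> y \<longrightarrow> \<not> adj x y)" for S
  have "finite {S. P S}" by (rule finite_subset[of _ "Pow V"]) (auto simp: P_def assms)
  moreover have "P {}" by (simp add: P_def)
  ultimately obtain S where S: "P S" and max: "\<And>S'. P S' \<Longrightarrow> S \<subseteq> S' \<Longrightarrow> S = S'"
    using finite_has_maximal[of "{S. P S}"] by blast
  have "\<exists>x\<in>S. adj v x \<or> adj x v" if v: "v \<in> V" "v \<notin> S" for v
  proof (rule ccontr)
    assume "\<not> ?thesis"
    then have "P (insert v S)" using S v by (auto simp: P_def)
    from max[OF this] v show False by blast
  qed
  then show thesis using that[of S] S by (auto simp: P_def)
qed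

text \<open>Cut the vertices into a maximal independent set \<open>S\<close> and its complement \<open>T\<close>. The edges that cross
the cut touch every vertex, so their product is one kernel between the labellings of \<open>S\<close> and of \<open>T\<close>
whose norm is at most the product of the bounds. All other edges lie on one side and have bounded
entries; they are absorbed into the two vectors to which the kernel is applied.\<close>
lemma graph_sum_bound_no_isolated:
  fixes K :: "'i \<Rightarrow> 'l \<Rightarrow> 'l \<Rightarrow> real"
  assumes fin: "finite V" "finite I" "\<And>v. v \<in> V \<Longrightarrow> finite (L v)"
    and uw: "\<And>i. i \<in> I \<Longrightarrow> u i \<in> V" "\<And>i. i \<in> I \<Longrightarrow> w i \<in> V"
    and K: "\<And>i. i \<in> I \<Longrightarrow> kernel_bounded (L (u i)) (L (w i)) (K i) (c i)"
    and cover: "\<And>v. v \<in> V \<Longrightarrow> \<exists>i\<in>I. u i \<noteq> w i \<and> (v = u i \<or> v = w i)"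
  shows "\<bar>\<Sum>x\<in>PiE V L. \<Prod>i\<in>I. K i (x (u i)) (x (w i))\<bar>
           \<le> (prod c I) * (\<Prod>v\<in>V. sqrt (card (L v)))"
proof -
  obtain S where S: "S \<subseteq> V"
    "\<And>x y. x \<in> S \<Longrightarrow> y \<in> S \<Longrightarrow> x \<noteq> y \<Longrightarrow> \<not> (\<exists>i\<in>I. x = u i \<and> y = w i)"
    "\<And>v. v \<in> V \<Longrightarrow> v \<notin> S \<Longrightarrow> \<exists>x\<in>S. (\<exists>i\<in>I. v = u i \<and> x = w i) \<or> (\<exists>i\<in>I. x = u i \<and> v = w i)"
    by (rule maximal_independent_set[OF fin(1), of "\<lambda>x y. \<exists>i\<in>I. x = u i \<and> y = w i"]) (rule that)
  define T where "T = V - S"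
  have VST: "V = S \<union> T" "S \<inter> T = {}" using S(1) by (auto simp: T_def)
  have finST: "finite S" "finite T" using fin(1) VST by (auto intro: finite_subset)
  define CS where "CS = {i\<in>I. u i \<in> S \<and> w i \<in> S}"
  define CT where "CT = {i\<in>I. u i \<notin> S \<and> w i \<notin> S}"
  define C where "C = {i\<in>I. (u i \<in> S) \<noteq> (w i \<in> S)}"
  have split: "prod f I = prod f CS * prod f C * prod f CT" for f :: "'i \<Rightarrow> real"
  proof -
    have "I = CS \<union> C \<union> CT" by (auto simp: CS_def CT_def C_def)
    then have "prod f I = prod f (CS \<union> C \<union> CT)" by simp
    also have "\<dots> = prod f (CS \<union> C) * prod f CT"
      by (rule prod.union_disjoint) (use fin in \<open>auto simp: CS_def CT_def C_def\<close>)
    also have "prod f (CS \<union> C) = prod f CS * prod f C"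
      by (rule prod.union_disjoint) (use fin in \<open>auto simp: CS_def CT_def C_def\<close>)
    finally show ?thesis .
  qed
  \<comment> \<open>Orient every crossing edge from \<open>S\<close> to \<open>T\<close>, transposing its kernel if necessary.\<close>
  define a where "a i = (if u i \<in> S then u i else w i)" for i
  define b where "b i = (if u i \<in> S then w i else u i)" for i
  define K' where "K' i l m = (if u i \<in> S then K i l m else K i m l)" for i l m
  have abC: "a i \<in> S" "b i \<in> T" if "i \<in> C" for i
    using that uw[of i] by (auto simp: C_def a_def b_def T_def)
  have K': "kernel_bounded (L (a i)) (L (b i)) (K' i) (c i)" if "i \<in> C" for i
    using that K[of i] kernel_bounded_transpose[OF K[of i]]
    by (auto simp: C_def a_def b_def K'_def[abs_def])
  have covS: "\<exists>i\<in>C. a i = v" if "v \<in> S" for v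
  proof -
    have "v \<in> V" using that S(1) by blast
    from cover[OF this] obtain i where i: "i \<in> I" "u i \<noteq> w i" "v = u i \<or> v = w i" by blast
    then have "i \<in> C" using S(2)[of "u i" "w i"] that by (auto simp: C_def)
    moreover have "a i = v" using i that \<open>i \<in> C\<close> by (auto simp: a_def C_def)
    ultimately show ?thesis by blast
  qed
  have covT: "\<exists>i\<in>C. b i = v" if "v \<in> T" for v
  proof -
    have v: "v \<in> V" "v \<notin> S" using that by (auto simp: T_def)
    from S(3)[OF v] obtain x i where "x \<in> S" "i \<in> I" "v = u i \<and> x = w i \<or> x = u i \<and> v = w i" by blast
    with v have "i \<in> C \<and> b i = v" by (auto simp: C_def b_def)
    then show ?thesis by blast
  qed
  define f where "f x = (\<Prod>i\<in>CS. K i (x (u i)) (x (w i)))" for x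
  define g where "g y = (\<Prod>i\<in>CT. K i (y (u i)) (y (w i)))" for y
  define k where "k x y = (\<Prod>i\<in>C. K' i (x (a i)) (y (b i)))" for x y
  have c0: "0 \<le> c i" if "i \<in> I" for i using K[OF that] by (rule kernel_boundedD)
  have "(\<Sum>x\<in>PiE V L. \<Prod>i\<in>I. K i (x (u i)) (x (w i))) = (\<Sum>x\<in>PiE S L. \<Sum>y\<in>PiE T L. f x * k x y * g y)"
  proof -
    have "(\<Prod>i\<in>I. K i (if u i \<in> S then x (u i) else y (u i)) (if w i \<in> S then x (w i) else y (w i)))
       = f x * k x y * g y" for x y
      unfolding split f_def g_def k_def
      by (intro arg_cong2[of _ _ _ _ "(*)"] prod.cong refl)
        (auto simp: CS_def CT_def C_def K'_def a_def b_def)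
    then show ?thesis unfolding VST(1) sum_PiE_Un[OF VST(2)] by simp
  qed
  moreover have "kernel_bounded (PiE S L) (PiE T L) k (prod c C)"
    unfolding k_def
  proof (rule kernel_bounded_incidence[OF _ K'])
    show "finite C" using fin by (simp add: C_def)
    fix i assume "i \<in> C"
    then show "finite (L (a i))" "finite (L (b i))" using abC[of i] VST fin by auto
  next
    fix x x' assume "x \<in> PiE S L" "x' \<in> PiE S L" and eq: "\<And>i. i \<in> C \<Longrightarrow> x (a i) = x' (a i)"
    then show "x = x'" by (intro PiE_ext) (use covS in blast)+
  next
    fix x x' assume "x \<in> PiE T L" "x' \<in> PiE T L" and eq: "\<And>i. i \<in> C \<Longrightarrow> x (b i) = x' (b i)"
    then show "x = x'" by (intro PiE_ext) (use covT in blast)+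
  qed (use abC in \<open>auto dest: PiE_mem\<close>)
  ultimately have "\<bar>\<Sum>x\<in>PiE V L. \<Prod>i\<in>I. K i (x (u i)) (x (w i))\<bar>
      \<le> (prod c C) * sqrt (\<Sum>x\<in>PiE S L. (f x)\<^sup>2) * sqrt (\<Sum>y\<in>PiE T L. (g y)\<^sup>2)"
    by (simp only: kernel_bounded_bilinear)
  also have "\<dots> \<le> (prod c C) * ((prod c CS) * sqrt (card (PiE S L))) * ((prod c CT) * sqrt (card (PiE T L)))"
  proof (intro mult_mono mult_nonneg_nonneg prod_nonneg real_sqrt_ge_zero sum_nonneg sqrt_sum_squares_le)
    fix x assume x: "x \<in> PiE S L"
    show "\<bar>f x\<bar> \<le> (prod c CS)"
      unfolding f_def
    proof (rule abs_prod_le_prod)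
      fix i assume i: "i \<in> CS"
      then show "\<bar>K i (x (u i)) (x (w i))\<bar> \<le> c i"
        using x S(1) fin by (intro kernel_bounded_entry[OF K]) (auto simp: CS_def dest: PiE_mem)
    qed
  next
    fix x assume x: "x \<in> PiE T L"
    show "\<bar>g x\<bar> \<le> (prod c CT)"
      unfolding g_def
    proof (rule abs_prod_le_prod)
      fix i assume i: "i \<in> CT"
      then show "\<bar>K i (x (u i)) (x (w i))\<bar> \<le> c i"
        using x uw[of i] fin by (intro kernel_bounded_entry[OF K]) (auto simp: CT_def T_def dest: PiE_mem)
    qed
  qed (auto simp: C_def CS_def CT_def c0)
  also have "\<dots> = (prod c I) * (\<Prod>v\<in>V. sqrt (card (L v)))"
  proof -
    have "(\<Prod>v\<in>V. sqrt (card (L v))) = sqrt (card (PiE S L)) * sqrt (card (PiE T L))"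
      unfolding VST(1) prod.union_disjoint[OF finST VST(2)] using finST
      by (simp add: card_PiE sqrt_prod)
    then show ?thesis unfolding split by simp
  qed
  finally show ?thesis .
qed

text \<open>A vertex without an edge to another vertex carries loops only, and its labels are summed with the
trivial bound on the entries. The sum over the other vertices separates from these.\<close>
lemma graph_sum_bound:
  fixes K :: "'i \<Rightarrow> 'l \<Rightarrow> 'l \<Rightarrow> real"
  assumes fin: "finite V" "finite I" "\<And>v. v \<in> V \<Longrightarrow> finite (L v)"
    and uw: "\<And>i. i \<in> I \<Longrightarrow> u i \<in> V" "\<And>i. i \<in> I \<Longrightarrow> w i \<in> V"
    and K: "\<And>i. i \<in> I \<Longrightarrow> kernel_bounded (L (u i)) (L (w i)) (K i) (c i)"
  shows "\<bar>\<Sum>x\<in>PiE V L. \<Prod>i\<in>I. K i (x (u i)) (x (w i))\<bar>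
           \<le> (prod c I) *
             (\<Prod>v\<in>V. if \<exists>i\<in>I. u i \<noteq> w i \<and> (v = u i \<or> v = w i) then sqrt (card (L v)) else card (L v))"
proof -
  let ?N = "\<lambda>v. \<exists>i\<in>I. u i \<noteq> w i \<and> (v = u i \<or> v = w i)"
  define S where "S = {v\<in>V. \<not> ?N v}"
  define T where "T = {v\<in>V. ?N v}"
  have VST: "V = S \<union> T" "S \<inter> T = {}" by (auto simp: S_def T_def)
  have finST: "finite S" "finite T" using fin(1) VST by (auto intro: finite_subset)
  define IS where "IS = {i\<in>I. u i \<in> S}"
  define IT where "IT = {i\<in>I. u i \<in> T}"
  have I: "I = IS \<union> IT" "IS \<inter> IT = {}" "finite IS" "finite IT"
    using uw(1) VST fin(2) by (auto simp: IS_def IT_def)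
  have IS: "u i \<in> S \<and> w i \<in> S" if "i \<in> IS" for i
  proof -
    have "u i = w i" using that by (auto simp: IS_def S_def)
    then show ?thesis using that by (auto simp: IS_def)
  qed
  have IT: "u i \<in> T" "w i \<in> T" if i: "i \<in> IT" for i
  proof -
    show "u i \<in> T" using that by (auto simp: IT_def)
    show "w i \<in> T"
    proof (cases "u i = w i")
      case False
      then show ?thesis using that uw(2)[of i] by (auto simp: IT_def T_def)
    qed (use \<open>u i \<in> T\<close> in auto)
  qed
  have c0: "0 \<le> c i" if "i \<in> I" for i using K[OF that] by (rule kernel_boundedD)
  let ?f = "\<lambda>x. \<Prod>i\<in>IS. K i (x (u i)) (x (w i))"
  let ?g = "\<lambda>x. \<Prod>i\<in>IT. K i (x (u i)) (x (w i))"
  have "(\<Sum>x\<in>PiE V L. \<Prod>i\<in>I. K i (x (u i)) (x (w i))) = (\<Sum>x\<in>PiE S L. \<Sum>y\<in>PiE T L. ?f x * ?g y)"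
    unfolding VST(1) sum_PiE_Un[OF VST(2)] I(1) prod.union_disjoint[OF I(3,4,2)]
    by (intro sum.cong refl arg_cong2[of _ _ _ _ "(*)"] prod.cong) (use IS IT VST(2) in auto)
  also have "\<dots> = (\<Sum>x\<in>PiE S L. ?f x) * (\<Sum>y\<in>PiE T L. ?g y)"
    by (simp add: sum_product)
  also have "\<bar>\<dots>\<bar> = \<bar>\<Sum>x\<in>PiE S L. ?f x\<bar> * \<bar>\<Sum>y\<in>PiE T L. ?g y\<bar>" by (rule abs_mult)
  also have "\<dots> \<le> ((prod c IS) * (\<Prod>v\<in>S. real (card (L v)))) * ((prod c IT) * (\<Prod>v\<in>T. sqrt (card (L v))))"
  proof (rule mult_mono)
    have "\<bar>?f x\<bar> \<le> (prod c IS)" if x: "x \<in> PiE S L" for x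
    proof (rule abs_prod_le_prod)
      fix i assume i: "i \<in> IS"
      then show "\<bar>K i (x (u i)) (x (w i))\<bar> \<le> c i"
        using x IS[OF i] VST fin I(1) by (intro kernel_bounded_entry[OF K]) (auto dest: PiE_mem)
    qed
    then have "\<bar>\<Sum>x\<in>PiE S L. ?f x\<bar> \<le> (\<Sum>x\<in>PiE S L. \<Prod>i\<in>IS. c i)"
      by (intro order.trans[OF sum_abs] sum_mono)
    then show "\<bar>\<Sum>x\<in>PiE S L. ?f x\<bar> \<le> (prod c IS) * (\<Prod>v\<in>S. real (card (L v)))"
      using finST by (simp add: card_PiE mult.commute)
    show "\<bar>\<Sum>y\<in>PiE T L. ?g y\<bar> \<le> (prod c IT) * (\<Prod>v\<in>T. sqrt (card (L v)))"
    proof (rule graph_sum_bound_no_isolated)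
      show "\<exists>i\<in>IT. u i \<noteq> w i \<and> (v = u i \<or> v = w i)" if v: "v \<in> T" for v
      proof -
        obtain i where i: "i \<in> I" "u i \<noteq> w i" "v = u i \<or> v = w i" using v by (auto simp: T_def)
        then have "i \<in> IT" using uw(1)[of i] by (auto simp: IT_def T_def)
        with i show ?thesis by blast
      qed
    qed (use fin K IT I VST in auto)
    show "0 \<le> (prod c IS) * (\<Prod>v\<in>S. real (card (L v)))"
      using c0 I by (intro mult_nonneg_nonneg prod_nonneg) auto
  qed simp
  also have "\<dots> = (prod c I) * (\<Prod>v\<in>V. if ?N v then sqrt (card (L v)) else card (L v))"
  proof -
    have "(\<Prod>v\<in>S. real (card (L v))) = (\<Prod>v\<in>S. if ?N v then sqrt (card (L v)) else card (L v))"
      by (rule prod.cong) (auto simp: S_def)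
    moreover have "(\<Prod>v\<in>T. sqrt (card (L v))) = (\<Prod>v\<in>T. if ?N v then sqrt (card (L v)) else card (L v))"
      by (rule prod.cong) (auto simp: T_def)
    ultimately show ?thesis
      unfolding prod.union_disjoint[OF I(3,4,2), folded I(1)] prod.union_disjoint[OF finST VST(2), folded VST(1)]
      by simp
  qed
  finally show ?thesis .
qed

text \<open>Colour the \<open>m\<close> labels by the \<open>n\<close> vertices and restrict every vertex to the labels of its own colour. An
injective labelling survives for \<open>n^(m - n)\<close> of the \<open>n^m\<close> colourings, any other labelling for none.
Hence the sum over injective labellings is \<open>n^n\<close> times the average of the sums over products of
label sets, each of which obeys the assumed bound. No estimate of absolute values inside the sum is
involved, so cancellation in \<open>F\<close> is preserved.\<close>
lemma injective_sum_bound: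
  fixes F :: "('v \<Rightarrow> 'l) \<Rightarrow> real"
  assumes fin: "finite V" "\<And>v. v \<in> V \<Longrightarrow> finite (L v)"
    and bound: "\<And>L'. (\<And>v. v \<in> V \<Longrightarrow> L' v \<subseteq> L v) \<Longrightarrow> \<bar>\<Sum>x\<in>PiE V L'. F x\<bar> \<le> b"
  shows "\<bar>\<Sum>x\<in>{x\<in>PiE V L. inj_on x V}. F x\<bar> \<le> real (card V) ^ card V * b"
proof -
  define \<Lambda> where "\<Lambda> = (\<Union>v\<in>V. L v)"
  define n where "n = card V"
  define m where "m = card \<Lambda>"
  let ?X = "{x\<in>PiE V L. inj_on x V}"
  have fin\<Lambda>: "finite \<Lambda>" using fin by (auto simp: \<Lambda>_def)
  have finV: "finite (PiE V L)" by (intro finite_PiE fin)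
  have finX: "finite (PiE \<Lambda> (\<lambda>_. V))" by (intro finite_PiE fin fin\<Lambda>)
  have b0: "0 \<le> b" using bound[of L] by (metis abs_ge_zero order.trans subset_refl)
  have img: "x ` V \<subseteq> \<Lambda>" if "x \<in> PiE V L" for x using that by (auto simp: \<Lambda>_def)
  show ?thesis
  proof (cases "?X = {}")
    case True
    show ?thesis unfolding True using b0 by simp
  next
    case False
    then obtain x0 where x0: "x0 \<in> PiE V L" "inj_on x0 V" by blast
    have nm: "n \<le> m" unfolding n_def m_def
      using card_image[OF x0(2)] card_mono[OF fin\<Lambda> img[OF x0(1)]] by simp
    have pos: "0 < real n ^ (m - n)"
    proof (cases "V = {}")
      case True
      then show ?thesis by (simp add: n_def m_def \<Lambda>_def)
    next
      case False
      then show ?thesis using fin by (simp add: n_def card_gt_0_iff)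
    qed
    have count: "card {col\<in>PiE \<Lambda> (\<lambda>_. V). \<forall>v\<in>V. col (x v) = v} = (if inj_on x V then n ^ (m - n) else 0)"
      if x: "x \<in> PiE V L" for x
    proof (cases "inj_on x V")
      case True
      \<comment> \<open>The colours of the labels in use are forced, all others are free.\<close>
      have "{col\<in>PiE \<Lambda> (\<lambda>_. V). \<forall>v\<in>V. col (x v) = v}
          = PiE \<Lambda> (\<lambda>l. if l \<in> x ` V then {the_inv_into V x l} else V)"
      proof (intro equalityI subsetI)
        fix col assume "col \<in> {col\<in>PiE \<Lambda> (\<lambda>_. V). \<forall>v\<in>V. col (x v) = v}"
        then show "col \<in> PiE \<Lambda> (\<lambda>l. if l \<in> x ` V then {the_inv_into V x l} else V)"
          using True by (auto simp: PiE_iff the_inv_into_f_f)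
      next
        fix col assume col: "col \<in> PiE \<Lambda> (\<lambda>l. if l \<in> x ` V then {the_inv_into V x l} else V)"
        have "col (x v) = v" if "v \<in> V" for v
        proof -
          have "x v \<in> \<Lambda>" using img[OF x] that by blast
          from PiE_mem[OF col this] that show ?thesis using True by (auto simp: the_inv_into_f_f)
        qed
        moreover have "col l \<in> V" if "l \<in> \<Lambda>" for l
          using PiE_mem[OF col that] True by (auto split: if_splits simp: the_inv_into_f_f)
        ultimately show "col \<in> {col\<in>PiE \<Lambda> (\<lambda>_. V). \<forall>v\<in>V. col (x v) = v}"
          using col by (auto simp: PiE_iff)
      qed
      also have "card \<dots> = (\<Prod>l\<in>\<Lambda>. if l \<in> x ` V then 1 else n)"
        unfolding card_PiE[OF fin\<Lambda>] by (rule prod.cong) (auto simp: n_def)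
      also have "\<dots> = n ^ card (\<Lambda> - x ` V)"
        using fin\<Lambda> by (simp add: prod.If_cases Diff_eq)
      also have "card (\<Lambda> - x ` V) = m - n"
        using card_Diff_subset[of "x ` V" \<Lambda>] img[OF x] fin card_image[OF True]
        by (simp add: m_def n_def)
      finally show ?thesis using True by simp
    next
      case False
      then have "{col\<in>PiE \<Lambda> (\<lambda>_. V). \<forall>v\<in>V. col (x v) = v} = {}"
        unfolding inj_on_def by (auto, metis)
      then show ?thesis using False by (simp only: card.empty if_False)
    qed
    have box: "PiE V (\<lambda>v. {l\<in>L v. col l = v}) = {x\<in>PiE V L. \<forall>v\<in>V. col (x v) = v}" for col
      by (auto simp: PiE_iff extensional_def)
    have "(\<Sum>col\<in>PiE \<Lambda> (\<lambda>_. V). \<Sum>x\<in>PiE V (\<lambda>v. {l\<in>L v. col l = v}). F x)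
        = (\<Sum>col\<in>PiE \<Lambda> (\<lambda>_. V). \<Sum>x\<in>PiE V L. if \<forall>v\<in>V. col (x v) = v then F x else 0)"
      unfolding box by (intro sum.cong refl sum.inter_filter finV)
    also have "\<dots> = (\<Sum>x\<in>PiE V L. \<Sum>col\<in>{col\<in>PiE \<Lambda> (\<lambda>_. V). \<forall>v\<in>V. col (x v) = v}. F x)"
      by (subst sum.swap) (intro sum.cong refl sum.inter_filter[symmetric] finX)
    also have "\<dots> = (\<Sum>x\<in>PiE V L. if inj_on x V then real n ^ (m - n) * F x else 0)"
      by (rule sum.cong) (auto simp: count simp del: sum_constant_scale)
    also have "\<dots> = real n ^ (m - n) * (\<Sum>x\<in>?X. F x)"
      unfolding sum.inter_filter[OF finV, symmetric] sum_distrib_left ..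
    finally have eq: "real n ^ (m - n) * (\<Sum>x\<in>?X. F x)
        = (\<Sum>col\<in>PiE \<Lambda> (\<lambda>_. V). \<Sum>x\<in>PiE V (\<lambda>v. {l\<in>L v. col l = v}). F x)" by (rule sym)
    have "real n ^ (m - n) * \<bar>\<Sum>x\<in>?X. F x\<bar> = \<bar>real n ^ (m - n) * (\<Sum>x\<in>?X. F x)\<bar>"
      by (simp add: abs_mult)
    also have "\<dots> \<le> (\<Sum>col\<in>PiE \<Lambda> (\<lambda>_. V). b)"
      unfolding eq by (intro order.trans[OF sum_abs] sum_mono bound) auto
    also have "\<dots> = real n ^ m * b"
      using fin\<Lambda> by (simp add: card_PiE n_def m_def)
    also have "real n ^ m = real n ^ (m - n) * real n ^ n"
      using nm by (simp flip: power_add)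
    finally have "real n ^ (m - n) * \<bar>\<Sum>x\<in>?X. F x\<bar> \<le> real n ^ (m - n) * (real n ^ n * b)"
      by (simp add: mult_ac)
    then show ?thesis using pos by (simp add: n_def)
  qed
qed

section \<open>Sums organised by the pattern of equal labels\<close>

text \<open>A choice of one representative in every class of arguments with equal values. It encodes the
pattern of equalities as a map of \<open>H\<close> into itself, of which there are at most
\<open>card H ^ card H\<close>.\<close>
definition class_rep :: "'h set \<Rightarrow> ('h \<Rightarrow> 'l) \<Rightarrow> 'h \<Rightarrow> 'h" where
  "class_rep H g = (\<lambda>h\<in>H. SOME h'. h' \<in> H \<and> g h' = g h)"

lemma class_rep:
  assumes "h \<in> H"
  shows "class_rep H g h \<in> H" "g (class_rep H g h) = g h"
  using someI[of "\<lambda>h'. h' \<in> H \<and> g h' = g h" h] assms by (auto simp: class_rep_def)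

lemma class_rep_eq_iff:
  assumes "h \<in> H" "h' \<in> H"
  shows "class_rep H g h = class_rep H g h' \<longleftrightarrow> g h = g h'"
proof
  assume "class_rep H g h = class_rep H g h'"
  then show "g h = g h'" using class_rep(2)[OF assms(1), of g] class_rep(2)[OF assms(2), of g] by simp
next
  assume "g h = g h'"
  then show "class_rep H g h = class_rep H g h'" using assms by (simp add: class_rep_def)
qed

lemma class_rep_cong:
  assumes "\<And>h h'. h \<in> H \<Longrightarrow> h' \<in> H \<Longrightarrow> g h' = g h \<longleftrightarrow> f h' = f h"
  shows "class_rep H g = class_rep H f"
  unfolding class_rep_def by (rule restrict_ext, rule arg_cong[of _ _ Eps]) (use assms in auto)

text \<open>Group the labellings by their pattern of equal labels. For one pattern \<open>\<Phi>\<close> is constant, and the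
labellings are the injective labellings of the representatives, which are the vertices of a graph
with the kernels as edges. A class joined to another one pays the square root of its number of
labels and has at least two members; any other class pays the full number but has at least four
members. Both amount to at most the fourth root for each member.\<close>
lemma pattern_sum_bound:
  fixes \<Phi> :: "('h \<Rightarrow> 'l) \<Rightarrow> real"
  assumes fin: "finite H" "finite I" "\<And>h. h \<in> H \<Longrightarrow> finite (L h)"
    and ne: "\<And>h. h \<in> H \<Longrightarrow> L h \<noteq> {}"
    and disj: "\<And>h h'. h \<in> H \<Longrightarrow> h' \<in> H \<Longrightarrow> L h = L h' \<or> L h \<inter> L h' = {}"
    and ab: "\<And>i. i \<in> I \<Longrightarrow> a i \<in> H" "\<And>i. i \<in> I \<Longrightarrow> b i \<in> H"
    and K: "\<And>i. i \<in> I \<Longrightarrow> kernel_bounded (L (a i)) (L (b i)) (K i) (c i)"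
    and const: "\<And>g g'. g \<in> PiE H L \<Longrightarrow> g' \<in> PiE H L \<Longrightarrow>
        (\<And>h h'. h \<in> H \<Longrightarrow> h' \<in> H \<Longrightarrow> g h = g h' \<longleftrightarrow> g' h = g' h') \<Longrightarrow> \<Phi> g = \<Phi> g'"
    and D: "\<And>g. g \<in> PiE H L \<Longrightarrow> \<bar>\<Phi> g\<bar> \<le> D"
    and two: "\<And>g h. g \<in> PiE H L \<Longrightarrow> \<Phi> g \<noteq> 0 \<Longrightarrow> h \<in> H \<Longrightarrow> 2 \<le> card {h'\<in>H. g h' = g h}"
    and four: "\<And>g h. g \<in> PiE H L \<Longrightarrow> \<Phi> g \<noteq> 0 \<Longrightarrow> h \<in> H \<Longrightarrow>
        (\<And>i. i \<in> I \<Longrightarrow> g (a i) = g h \<longleftrightarrow> g (b i) = g h) \<Longrightarrow> 4 \<le> card {h'\<in>H. g h' = g h}"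
  shows "\<bar>\<Sum>g\<in>PiE H L. \<Phi> g * (\<Prod>i\<in>I. K i (g (a i)) (g (b i)))\<bar>
    \<le> real (card H) ^ (2 * card H) * D * (prod c I) * (\<Prod>h\<in>H. sqrt (sqrt (card (L h))))"
proof -
  let ?G = "PiE H L"
  let ?r = "class_rep H"
  let ?K = "\<lambda>g. \<Prod>i\<in>I. K i (g (a i)) (g (b i))"
  define B where "B = real (card H) ^ card H * D * (prod c I) * (\<Prod>h\<in>H. sqrt (sqrt (card (L h))))"
  have finG: "finite ?G" by (intro finite_PiE fin)
  have c0: "0 \<le> c i" if "i \<in> I" for i using K[OF that] by (rule kernel_boundedD)
  obtain g1 where g1: "g1 \<in> ?G" using ne by (metis PiE_eq_empty_iff ex_in_conv)
  have D0: "0 \<le> D" using D[OF g1] by linarith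
  have B0: "0 \<le> B" unfolding B_def using c0 D0 by (intro mult_nonneg_nonneg prod_nonneg) auto
  have inner: "\<bar>\<Sum>g\<in>{g\<in>?G. ?r g = ?r g0}. \<Phi> g * ?K g\<bar> \<le> B" if g0: "g0 \<in> ?G" for g0
  proof -
    let ?c = "?r g0"
    define V where "V = ?c ` H"
    have cH: "?c h \<in> H" "g0 (?c h) = g0 h" if "h \<in> H" for h using class_rep[OF that] .
    have VH: "V \<subseteq> H" using cH by (auto simp: V_def)
    then have finV: "finite V" using fin(1) finite_subset by blast
    have same: "g h = g h' \<longleftrightarrow> g0 h = g0 h'" if "?r g = ?c" "h \<in> H" "h' \<in> H" for g h h'
      using that class_rep_eq_iff[of _ H] by metis
    have cV: "?c v = v" if "v \<in> V" for v
    proof -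
      from that obtain h where h: "h \<in> H" "v = ?c h" by (auto simp: V_def)
      show ?thesis using class_rep_eq_iff[OF cH(1)[OF h(1)] h(1), of g0] cH[OF h(1)] h(2) by simp
    qed
    have Lc: "L (?c h) = L h" if "h \<in> H" for h
    proof -
      have "g0 h \<in> L h \<inter> L (?c h)" using PiE_mem[OF g0] cH[OF that] that by (metis IntI)
      then show ?thesis using disj[OF that cH(1)[OF that]] by auto
    qed
    let ?J = "\<Sum>x\<in>{x\<in>PiE V L. inj_on x V}. \<Prod>i\<in>I. K i (x (?c (a i))) (x (?c (b i)))"
    have bij: "bij_betw (\<lambda>x. \<lambda>h\<in>H. x (?c h)) {x\<in>PiE V L. inj_on x V} {g\<in>?G. ?r g = ?c}"
    proof (rule bij_betw_byWitness[where f' = "\<lambda>g. restrict g V"])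
      show "\<forall>x\<in>{x\<in>PiE V L. inj_on x V}. restrict (\<lambda>h\<in>H. x (?c h)) V = x"
        using VH cV by (auto simp: fun_eq_iff PiE_iff extensional_def restrict_def)
      show "\<forall>g\<in>{g\<in>?G. ?r g = ?c}. (\<lambda>h\<in>H. restrict g V (?c h)) = g"
      proof
        fix g assume g: "g \<in> {g\<in>?G. ?r g = ?c}"
        have "g (?c h) = g h" if "h \<in> H" for h using class_rep(2)[OF that, of g] g by simp
        then show "(\<lambda>h\<in>H. restrict g V (?c h)) = g"
          using g by (auto simp: fun_eq_iff PiE_iff extensional_def restrict_def V_def)
      qed
      show "(\<lambda>x. \<lambda>h\<in>H. x (?c h)) ` {x\<in>PiE V L. inj_on x V} \<subseteq> {g\<in>?G. ?r g = ?c}"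
      proof (rule image_subsetI, rule CollectI, rule conjI)
        fix x assume "x \<in> {x\<in>PiE V L. inj_on x V}"
        then have x: "x \<in> PiE V L" "inj_on x V" by auto
        show "(\<lambda>h\<in>H. x (?c h)) \<in> ?G"
        proof (rule restrict_PiE_iff[THEN iffD2], rule ballI)
          fix h assume h: "h \<in> H"
          have "x (?c h) \<in> L (?c h)" by (rule PiE_mem[OF x(1)]) (simp add: V_def h)
          then show "x (?c h) \<in> L h" using Lc[OF h] by simp
        qed
        show "?r (\<lambda>h\<in>H. x (?c h)) = ?c"
        proof (rule class_rep_cong)
          fix h h' assume h: "h \<in> H" "h' \<in> H"
          then have "x (?c h') = x (?c h) \<longleftrightarrow> ?c h' = ?c h"
            using inj_on_eq_iff[OF x(2)] by (auto simp: V_def)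
          then show "((\<lambda>h\<in>H. x (?c h)) h' = (\<lambda>h\<in>H. x (?c h)) h) = (g0 h' = g0 h)"
            using h class_rep_eq_iff[OF h(2,1), of g0] by simp
        qed
      qed
      show "(\<lambda>g. restrict g V) ` {g\<in>?G. ?r g = ?c} \<subseteq> {x\<in>PiE V L. inj_on x V}"
      proof (rule image_subsetI, rule CollectI, rule conjI)
        fix g assume "g \<in> {g\<in>?G. ?r g = ?c}"
        then have g: "g \<in> ?G" "?r g = ?c" by auto
        show "restrict g V \<in> PiE V L" using g(1) VH by (auto simp: PiE_iff)
        show "inj_on (restrict g V) V"
        proof (rule inj_onI)
          fix v v' assume v: "v \<in> V" "v' \<in> V" "restrict g V v = restrict g V v'"
          then have "g0 v = g0 v'" using same[OF g(2)] VH by auto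
          then show "v = v'" using v class_rep_eq_iff[of v H v' g0] cV VH by auto
        qed
      qed
    qed
    have sum_eq: "(\<Sum>g\<in>{g\<in>?G. ?r g = ?c}. \<Phi> g * ?K g)
        = \<Phi> g0 * ?J"
    proof -
      have "(\<Sum>g\<in>{g\<in>?G. ?r g = ?c}. \<Phi> g * ?K g) = \<Phi> g0 * (\<Sum>g\<in>{g\<in>?G. ?r g = ?c}. ?K g)"
        unfolding sum_distrib_left
      proof (rule sum.cong[OF refl])
        fix g assume "g \<in> {g\<in>?G. ?r g = ?c}"
        then have "\<Phi> g = \<Phi> g0" using same[of g] by (intro const g0) auto
        then show "\<Phi> g * ?K g = \<Phi> g0 * ?K g" by simp
      qed
      also have "(\<Sum>g\<in>{g\<in>?G. ?r g = ?c}. ?K g)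
          = (\<Sum>x\<in>{x\<in>PiE V L. inj_on x V}. ?K (\<lambda>h\<in>H. x (?c h)))"
        by (rule sum.reindex_bij_betw[OF bij, symmetric])
      finally show ?thesis using ab by (simp cong: prod.cong)
    qed
    show ?thesis
    proof (cases "\<Phi> g0 = 0")
      case True
      then show ?thesis unfolding sum_eq using B0 by simp
    next
      case False
      define Q where "Q = (prod c I) * (\<Prod>h\<in>H. sqrt (sqrt (card (L h))))"
      have Q0: "0 \<le> Q" unfolding Q_def using c0 by (intro mult_nonneg_nonneg prod_nonneg) auto
      have cls: "{h\<in>H. ?c h = v} = {h\<in>H. g0 h = g0 v}" if "v \<in> V" for v
        using that class_rep_eq_iff[of _ H v g0] cV[OF that] VH by auto
      have "\<bar>\<Sum>x\<in>PiE V L'. \<Prod>i\<in>I. K i (x (?c (a i))) (x (?c (b i)))\<bar> \<le> Q"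
        if L': "\<And>v. v \<in> V \<Longrightarrow> L' v \<subseteq> L v" for L'
      proof -
        let ?N = "\<lambda>v. \<exists>i\<in>I. ?c (a i) \<noteq> ?c (b i) \<and> (v = ?c (a i) \<or> v = ?c (b i))"
        have finL': "finite (L' v)" if "v \<in> V" for v
          using L'[OF that] fin(3)[of v] VH that finite_subset by blast
        have "\<bar>\<Sum>x\<in>PiE V L'. \<Prod>i\<in>I. K i (x (?c (a i))) (x (?c (b i)))\<bar>
          \<le> (prod c I) * (\<Prod>v\<in>V. if ?N v then sqrt (card (L' v)) else card (L' v))"
        proof (rule graph_sum_bound[OF finV fin(2) finL'])
          fix i assume i: "i \<in> I"
          show cc: "?c (a i) \<in> V" "?c (b i) \<in> V" using ab[OF i] by (auto simp: V_def)
          show "kernel_bounded (L' (?c (a i))) (L' (?c (b i))) (K i) (c i)"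
            by (rule kernel_bounded_subset[OF K[OF i]])
              (use ab[OF i] fin L'[OF cc(1)] L'[OF cc(2)] Lc[OF ab(1)[OF i]] Lc[OF ab(2)[OF i]] in auto)
        qed
        also have "\<dots> \<le> (prod c I) * (\<Prod>v\<in>V. \<Prod>h\<in>{h\<in>H. ?c h = v}. sqrt (sqrt (card (L h))))"
        proof (intro mult_left_mono prod_mono prod_nonneg conjI)
          fix v assume v: "v \<in> V"
          have vH: "v \<in> H" using v VH by auto
          define l where "l = real (card (L v))"
          have l1: "1 \<le> l" using ne[OF vH] fin(3)[OF vH] by (simp add: l_def Suc_le_eq card_gt_0_iff)
          have le: "real (card (L' v)) \<le> l"
            using card_mono[OF fin(3)[OF vH] L'[OF v]] by (simp add: l_def)
          let ?s = "sqrt (sqrt l)"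
          have s1: "1 \<le> ?s" using l1 by simp
          have "(\<Prod>h\<in>{h\<in>H. ?c h = v}. sqrt (sqrt (card (L h)))) = (\<Prod>h\<in>{h\<in>H. ?c h = v}. ?s)"
            by (rule prod.cong) (auto simp: l_def dest: Lc)
          also have "\<dots> = ?s ^ card {h\<in>H. g0 h = g0 v}" by (simp add: cls[OF v])
          finally have eq: "(\<Prod>h\<in>{h\<in>H. ?c h = v}. sqrt (sqrt (card (L h)))) = ?s ^ card {h\<in>H. g0 h = g0 v}" .
          show "(if ?N v then sqrt (card (L' v)) else card (L' v))
              \<le> (\<Prod>h\<in>{h\<in>H. ?c h = v}. sqrt (sqrt (card (L h))))"
          proof (cases "?N v")
            case True
            have "sqrt (card (L' v)) \<le> ?s ^ 2" using le l1 by simp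
            also have "\<dots> \<le> ?s ^ card {h\<in>H. g0 h = g0 v}"
              by (rule power_increasing[OF two[OF g0 False vH] s1])
            finally show ?thesis using True eq by simp
          next
            case notN: False
            have iff: "?c h = v \<longleftrightarrow> g0 h = g0 v" if "h \<in> H" for h
              using class_rep_eq_iff[OF that vH, of g0] cV[OF v] by simp
            have "4 \<le> card {h\<in>H. g0 h = g0 v}"
            proof (rule four[OF g0 False vH])
              fix i assume i: "i \<in> I"
              show "(g0 (a i) = g0 v) = (g0 (b i) = g0 v)"
                using notN i iff[OF ab(1)[OF i]] iff[OF ab(2)[OF i]] by metis
            qed
            then have "?s ^ 4 \<le> ?s ^ card {h\<in>H. g0 h = g0 v}" by (rule power_increasing[OF _ s1])
            moreover have "?s ^ 4 = l"
            proof -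
              have "?s ^ 4 = (?s ^ 2) ^ 2" by (simp flip: power_mult)
              then show ?thesis using l1 by simp
            qed
            ultimately show ?thesis using le unfolding if_not_P[OF notN] eq by simp
          qed
        qed (use c0 in auto)
        also have "(\<Prod>v\<in>V. \<Prod>h\<in>{h\<in>H. ?c h = v}. sqrt (sqrt (card (L h))))
            = (\<Prod>h\<in>H. sqrt (sqrt (card (L h))))"
          unfolding V_def by (rule prod.image_gen[OF fin(1), symmetric])
        finally show ?thesis unfolding Q_def .
      qed
      from injective_sum_bound[OF finV _ this]
      have "\<bar>?J\<bar>
          \<le> real (card V) ^ card V * Q" using fin VH by auto
      also have "real (card V) ^ card V \<le> real (card H) ^ card H"
      proof (cases "H = {}")
        case False
        then have "1 \<le> real (card H)" using fin by (simp add: Suc_le_eq card_gt_0_iff)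
        moreover have "card V \<le> card H" by (rule card_mono[OF fin(1) VH])
        ultimately show ?thesis
          using power_mono[of "real (card V)" "real (card H)" "card V"] power_increasing[of "card V" "card H" "real (card H)"]
          by linarith
      qed (use VH in auto)
      finally have "\<bar>?J\<bar>
          \<le> real (card H) ^ card H * Q" using Q0 by (simp add: mult_right_mono)
      then have "\<bar>\<Phi> g0\<bar> * \<bar>?J\<bar>
          \<le> D * (real (card H) ^ card H * Q)"
        by (intro mult_mono D g0 D0) auto
      then show ?thesis unfolding sum_eq abs_mult by (simp add: B_def Q_def mult_ac)
    qed
  qed
  have "?r ` ?G \<subseteq> PiE H (\<lambda>_. H)"
    by (intro image_subsetI PiE_I class_rep(1)) (auto simp: class_rep_def)
  then have "card (?r ` ?G) \<le> card (PiE H (\<lambda>_. H))"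
    by (intro card_mono finite_PiE fin)
  also have "\<dots> = card H ^ card H" using fin(1) by (simp add: card_PiE)
  finally have cardr: "real (card (?r ` ?G)) \<le> real (card H) ^ card H"
    by (metis of_nat_le_iff of_nat_power)
  have "\<bar>\<Sum>g\<in>?G. \<Phi> g * ?K g\<bar> = \<bar>\<Sum>c\<in>?r ` ?G. \<Sum>g\<in>{g\<in>?G. ?r g = c}. \<Phi> g * ?K g\<bar>"
    by (subst sum.image_gen[OF finG, of _ ?r]) simp
  also have "\<dots> \<le> (\<Sum>c\<in>?r ` ?G. B)"
    by (rule order.trans[OF sum_abs], rule sum_mono) (use inner in auto)
  also have "\<dots> \<le> real (card H) ^ card H * B" using cardr B0 by (simp add: mult_right_mono)
  also have "\<dots> = real (card H) ^ (2 * card H) * D * (prod c I) * (\<Prod>h\<in>H. sqrt (sqrt (card (L h))))"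
    unfolding B_def mult_2 power_add by (simp add: mult_ac)
  finally show ?thesis .
qed

section \<open>Hermite polynomials\<close>

text \<open>The three-term recurrence is what induction on the degree needs; the defining formula with the
Gaussian density is used only to identify the two.\<close>
fun hermite_rec :: "nat \<Rightarrow> real \<Rightarrow> real" where
  "hermite_rec 0 y = 1"
| "hermite_rec (Suc 0) y = y"
| "hermite_rec (Suc (Suc n)) y = y * hermite_rec (Suc n) y - real (Suc n) * hermite_rec n y"

lemma hermite_rec_Suc: "hermite_rec (Suc n) y = y * hermite_rec n y - real n * hermite_rec (n - 1) y"
  by (cases n) auto

lemma DERIV_hermite_rec: "(hermite_rec n has_real_derivative real n * hermite_rec (n - 1) y) (at y)"
proof (induction n y rule: hermite_rec.induct)
  case (1 y)
  have "hermite_rec 0 = (\<lambda>_. 1)" by (rule ext) simp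
  then show ?case by simp
next
  case (2 y)
  have "hermite_rec (Suc 0) = (\<lambda>y. y)" by (rule ext) simp
  then show ?case by simp
next
  case (3 n y)
  have "hermite_rec (Suc (Suc n)) = (\<lambda>y. y * hermite_rec (Suc n) y - real (Suc n) * hermite_rec n y)"
    by (rule ext) simp
  moreover have "((\<lambda>y. y * hermite_rec (Suc n) y - real (Suc n) * hermite_rec n y) has_real_derivative
      (1 * hermite_rec (Suc n) y + real (Suc n) * hermite_rec (Suc n - 1) y * y)
       - real (Suc n) * (real n * hermite_rec (n - 1) y)) (at y)"
    by (intro DERIV_diff DERIV_mult DERIV_ident DERIV_cmult 3)
  moreover have "(1 * hermite_rec (Suc n) y + real (Suc n) * hermite_rec (Suc n - 1) y * y)
       - real (Suc n) * (real n * hermite_rec (n - 1) y)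
     = real (Suc (Suc n)) * hermite_rec (Suc (Suc n) - 1) y"
    by (simp add: hermite_rec_Suc[of n y] algebra_simps)
  ultimately show ?case by simp
qed

lemma hermite_eq_hermite_rec: "hermite n = hermite_rec n"
proof
  fix y :: real
  have "(deriv ^^ n) std_normal_density = (\<lambda>y. (-1) ^ n * hermite_rec n y * std_normal_density y)"
  proof (induction n)
    case (Suc n)
    have D: "(std_normal_density has_real_derivative - y * std_normal_density y) (at y)" for y
    proof -
      have "((\<lambda>y. (1 / sqrt (2 * pi)) * exp (- y\<^sup>2 / 2)) has_real_derivative
          (1 / sqrt (2 * pi)) * (exp (- y\<^sup>2 / 2) * (- y))) (at y)"
        by (intro DERIV_cmult) (auto intro!: derivative_eq_intros)
      then show ?thesis unfolding std_normal_density_def by (simp add: mult_ac)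
    qed
    have "((\<lambda>y. (-1) ^ n * hermite_rec n y * std_normal_density y) has_real_derivative
        (-1) ^ Suc n * hermite_rec (Suc n) y * std_normal_density y) (at y)" for y
      by (rule derivative_eq_intros DERIV_hermite_rec D refl)+
        (simp add: hermite_rec_Suc algebra_simps)
    then show ?case by (auto simp: Suc fun_eq_iff intro!: DERIV_imp_deriv)
  qed simp
  then have "hermite n y = ((-1) ^ n * (-1) ^ n) * hermite_rec n y * (std_normal_density y / std_normal_density y)"
    by (simp add: hermite_def)
  moreover have "((-1) ^ n * (-1) ^ n :: real) = 1" by (simp flip: power_add)
  moreover have "std_normal_density y \<noteq> 0" using normal_density_pos[of 1 0 y] by simp
  ultimately show "hermite n y = hermite_rec n y" by simp
qed

lemma hermite_0 [simp]: "hermite 0 y = 1"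
  and hermite_1: "hermite (Suc 0) y = y"
  and hermite_2: "hermite 2 y = y\<^sup>2 - 1"
  by (simp_all add: hermite_eq_hermite_rec numeral_2_eq_2 power2_eq_square)

lemma hermite_Suc: "hermite (Suc n) y = y * hermite n y - real n * hermite (n - 1) y"
  by (simp add: hermite_eq_hermite_rec hermite_rec_Suc)

lemma DERIV_hermite: "(hermite n has_real_derivative real n * hermite (n - 1) y) (at y)"
  unfolding hermite_eq_hermite_rec by (rule DERIV_hermite_rec)

lemma measurable_hermite [measurable]: "hermite n \<in> borel_measurable borel"
  by (intro borel_measurable_continuous_onI continuous_at_imp_continuous_on ballI)
    (rule DERIV_isCont[OF DERIV_hermite])

text \<open>A crude bound, sufficient because only the order of growth of the moments in the degree matters.\<close>
lemma abs_hermite_le: "\<bar>hermite n y\<bar> \<le> (\<bar>y\<bar> + real n) ^ n"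
proof (induction n rule: less_induct)
  case (less n)
  show ?case
  proof (cases n)
    case 0
    then show ?thesis by simp
  next
    case (Suc m)
    have "real m * \<bar>hermite (m - 1) y\<bar> \<le> (\<bar>y\<bar> + real m) ^ m"
    proof (cases m)
      case 0
      then show ?thesis by simp
    next
      case (Suc l)
      have "\<bar>hermite l y\<bar> \<le> (\<bar>y\<bar> + real l) ^ l" using less.IH[of l] \<open>n = Suc m\<close> Suc by simp
      also have "\<dots> \<le> (\<bar>y\<bar> + real m) ^ l" by (rule power_mono) (auto simp: Suc)
      finally have "real m * \<bar>hermite l y\<bar> \<le> (\<bar>y\<bar> + real m) * (\<bar>y\<bar> + real m) ^ l"
        by (intro mult_mono) auto
      then show ?thesis by (simp add: Suc)
    qed
    moreover have "\<bar>y\<bar> * \<bar>hermite m y\<bar> \<le> \<bar>y\<bar> * (\<bar>y\<bar> + real m) ^ m"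
      using less.IH[of m] Suc by (intro mult_left_mono) auto
    moreover have "\<bar>hermite n y\<bar> \<le> \<bar>y\<bar> * \<bar>hermite m y\<bar> + real m * \<bar>hermite (m - 1) y\<bar>"
      unfolding Suc hermite_Suc by (rule order.trans[OF abs_triangle_ineq4]) (simp add: abs_mult)
    ultimately have "\<bar>hermite n y\<bar> \<le> (\<bar>y\<bar> + 1) * (\<bar>y\<bar> + real m) ^ m"
      by (simp add: algebra_simps)
    also have "\<dots> \<le> (\<bar>y\<bar> + real n) * (\<bar>y\<bar> + real n) ^ m"
      by (intro mult_mono power_mono) (auto simp: Suc)
    finally show ?thesis by (simp add: Suc)
  qed
qed

text \<open>The Appell property. As functions of \<open>a\<close> both sides have derivative \<open>n\<close> times the same expression of
degree \<open>n - 1\<close>, and they agree at \<open>0\<close>.\<close>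
lemma hermite_add:
  "hermite n (a + e) = (\<Sum>l\<le>n. real (n choose l) * (a ^ (n - l) * hermite l e))"
proof (induction n arbitrary: a)
  case (Suc n)
  define D where "D a = hermite (Suc n) (a + e)
    - (\<Sum>l\<le>Suc n. real (Suc n choose l) * (a ^ (Suc n - l) * hermite l e))" for a
  have "(D has_real_derivative 0) (at x)" for x
  proof -
    have "(D has_real_derivative real (Suc n) * hermite n (x + e) * 1
      - (\<Sum>l\<le>Suc n. real (Suc n choose l) * (real (Suc n - l) * x ^ (Suc n - l - 1) * hermite l e))) (at x)"
      unfolding D_def
    proof (intro DERIV_diff DERIV_sum)
      show "((\<lambda>a. hermite (Suc n) (a + e)) has_real_derivative real (Suc n) * hermite n (x + e) * 1) (at x)"
        using DERIV_hermite[of "Suc n" "x + e"] by (simp add: DERIV_shift)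
      show "((\<lambda>a. real (Suc n choose l) * (a ^ (Suc n - l) * hermite l e)) has_real_derivative
          real (Suc n choose l) * (real (Suc n - l) * x ^ (Suc n - l - 1) * hermite l e)) (at x)" for l
        using DERIV_pow[of "Suc n - l" x UNIV] by (intro DERIV_cmult DERIV_cmult_right) simp
    qed
    moreover have "(\<Sum>l\<le>Suc n. real (Suc n choose l) * (real (Suc n - l) * x ^ (Suc n - l - 1) * hermite l e))
        = real (Suc n) * hermite n (x + e)"
    proof -
      have pred: "Suc n - l - 1 = n - l" for l by simp
      have abs: "real (Suc n choose l) * real (Suc n - l) = real (Suc n) * real (n choose l)" for l
        using binomial_absorb_comp[of "Suc n" l] by (metis diff_Suc_1 mult.commute of_nat_mult)
      have "(\<Sum>l\<le>Suc n. real (Suc n choose l) * (real (Suc n - l) * x ^ (Suc n - l - 1) * hermite l e))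
          = (\<Sum>l\<le>Suc n. real (Suc n) * (real (n choose l) * (x ^ (n - l) * hermite l e)))"
        by (rule sum.cong[OF refl]) (simp only: mult.assoc[symmetric] abs pred)
      also have "\<dots> = real (Suc n) * hermite n (x + e)"
        by (simp add: Suc[of x] sum_distrib_left binomial_eq_0 del: of_nat_Suc)
      finally show ?thesis .
    qed
    ultimately show ?thesis by simp
  qed
  then have "D a = D 0" by (intro DERIV_isconst_all) blast
  also have "D 0 = 0"
  proof -
    have "(\<Sum>l\<le>Suc n. real (Suc n choose l) * (0 ^ (Suc n - l) * hermite l e)) = hermite (Suc n) e"
      by (simp add: power_0_left if_distrib cong: if_cong)
    then show ?thesis by (simp add: D_def)
  qed
  finally show ?case by (simp add: D_def)
qed simp

lemma sum_Pow_card: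
  fixes f :: "nat \<Rightarrow> real"
  assumes "finite X"
  shows "(\<Sum>B\<in>Pow X. f (card B)) = (\<Sum>l\<le>card X. real (card X choose l) * f l)"
proof -
  have "(\<Sum>B\<in>Pow X. f (card B)) = (\<Sum>l\<le>card X. \<Sum>B\<in>{B\<in>Pow X. card B = l}. f (card B))"
    by (rule sum.group[symmetric]) (use assms in \<open>auto intro: card_mono\<close>)
  also have "\<dots> = (\<Sum>l\<le>card X. real (card X choose l) * f l)"
    by (rule sum.cong) (use n_subsets[OF assms] in \<open>auto simp: Pow_def\<close>)
  finally show ?thesis .
qed

lemma sum_Pow_Un:
  assumes "X \<inter> Y = {}"
  shows "(\<Sum>B\<in>Pow (X \<union> Y). f B) = (\<Sum>B\<in>Pow X. \<Sum>B'\<in>Pow Y. f (B \<union> B'))"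
proof -
  have "bij_betw (\<lambda>(B, B'). B \<union> B') (Pow X \<times> Pow Y) (Pow (X \<union> Y))"
    by (rule bij_betw_byWitness[where f' = "\<lambda>C. (C \<inter> X, C \<inter> Y)"]) (use assms in auto)
  from sum.reindex_bij_betw[OF this, of f]
  show ?thesis by (simp add: sum.cartesian_product case_prod_unfold)
qed

text \<open>Apply the Appell property to every fibre of \<open>\<kappa>\<close>: choosing which elements of a fibre read \<open>w\<close>
independently for all fibres amounts to choosing one subset \<open>B\<close> of \<open>X\<close>.\<close>
lemma prod_hermite_add:
  assumes "finite E" "finite X" "\<kappa> ` X \<subseteq> E"
  shows "(\<Prod>e\<in>E. hermite (card {t\<in>X. \<kappa> t = e}) (a e + w e))
    = (\<Sum>B\<in>Pow X. (\<Prod>t\<in>X - B. a (\<kappa> t)) * (\<Prod>e\<in>E. hermite (card {t\<in>B. \<kappa> t = e}) (w e)))"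
  using assms
proof (induction E arbitrary: X)
  case empty
  then show ?case by simp
next
  case (insert e0 E)
  define X0 where "X0 = {t\<in>X. \<kappa> t = e0}"
  define X1 where "X1 = {t\<in>X. \<kappa> t \<noteq> e0}"
  have X: "X = X0 \<union> X1" "X0 \<inter> X1 = {}" "finite X0" "finite X1"
    using insert.prems by (auto simp: X0_def X1_def)
  let ?F = "\<lambda>B. (\<Prod>t\<in>X0 - B. a (\<kappa> t)) * hermite (card B) (w e0)"
  let ?G = "\<lambda>B. (\<Prod>t\<in>X1 - B. a (\<kappa> t)) * (\<Prod>e\<in>E. hermite (card {t\<in>B. \<kappa> t = e}) (w e))"
  have "(\<Sum>B\<in>Pow X0. ?F B) = (\<Sum>B\<in>Pow X0. a e0 ^ (card X0 - card B) * hermite (card B) (w e0))"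
  proof (rule sum.cong[OF refl])
    fix B assume B: "B \<in> Pow X0"
    have "(\<Prod>t\<in>X0 - B. a (\<kappa> t)) = (\<Prod>t\<in>X0 - B. a e0)" by (rule prod.cong) (auto simp: X0_def)
    also have "\<dots> = a e0 ^ (card X0 - card B)"
      using B X by (simp add: card_Diff_subset finite_subset)
    finally show "?F B = a e0 ^ (card X0 - card B) * hermite (card B) (w e0)" by simp
  qed
  also have "\<dots> = hermite (card X0) (a e0 + w e0)"
    unfolding hermite_add by (rule sum_Pow_card[OF X(3)])
  finally have F: "hermite (card X0) (a e0 + w e0) = (\<Sum>B\<in>Pow X0. ?F B)" by simp
  have eqX: "{t\<in>X. \<kappa> t = e} = {t\<in>X1. \<kappa> t = e}" if "e \<in> E" for e
    using that insert.hyps by (auto simp: X1_def)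
  have G: "(\<Prod>e\<in>E. hermite (card {t\<in>X. \<kappa> t = e}) (a e + w e)) = (\<Sum>B\<in>Pow X1. ?G B)"
  proof -
    have "(\<Prod>e\<in>E. hermite (card {t\<in>X. \<kappa> t = e}) (a e + w e))
        = (\<Prod>e\<in>E. hermite (card {t\<in>X1. \<kappa> t = e}) (a e + w e))"
      by (rule prod.cong) (auto simp: eqX)
    also have "\<dots> = (\<Sum>B\<in>Pow X1. ?G B)"
      by (rule insert.IH) (use X insert.prems in \<open>auto simp: X1_def\<close>)
    finally show ?thesis .
  qed
  have "(\<Sum>B\<in>Pow X. (\<Prod>t\<in>X - B. a (\<kappa> t)) * (\<Prod>e\<in>insert e0 E. hermite (card {t\<in>B. \<kappa> t = e}) (w e)))
      = (\<Sum>B\<in>Pow X0. \<Sum>B'\<in>Pow X1. ?F B * ?G B')"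
    unfolding X(1) sum_Pow_Un[OF X(2)]
  proof (intro sum.cong refl)
    fix B B' assume B: "B \<in> Pow X0" "B' \<in> Pow X1"
    have "X0 \<union> X1 - (B \<union> B') = (X0 - B) \<union> (X1 - B')" using B X by auto
    then have 1: "(\<Prod>t\<in>X0 \<union> X1 - (B \<union> B'). a (\<kappa> t)) = (\<Prod>t\<in>X0 - B. a (\<kappa> t)) * (\<Prod>t\<in>X1 - B'. a (\<kappa> t))"
      using X by (simp, subst prod.union_disjoint) auto
    have 2: "{t\<in>B \<union> B'. \<kappa> t = e0} = B" using B by (auto simp: X0_def X1_def)
    have 3: "{t\<in>B \<union> B'. \<kappa> t = e} = {t\<in>B'. \<kappa> t = e}" if "e \<in> E" for e
      using B that insert.hyps by (auto simp: X0_def)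
    have "(\<Prod>e\<in>E. hermite (card {t\<in>B \<union> B'. \<kappa> t = e}) (w e)) = (\<Prod>e\<in>E. hermite (card {t\<in>B'. \<kappa> t = e}) (w e))"
      by (rule prod.cong) (auto simp only: 3)
    then show "(\<Prod>t\<in>X0 \<union> X1 - (B \<union> B'). a (\<kappa> t)) *
        (\<Prod>e\<in>insert e0 E. hermite (card {t\<in>B \<union> B'. \<kappa> t = e}) (w e)) = ?F B * ?G B'"
      unfolding 1 using insert.hyps 2 by (simp add: mult_ac)
  qed
  also have "\<dots> = (\<Sum>B\<in>Pow X0. ?F B) * (\<Sum>B\<in>Pow X1. ?G B)" by (rule sum_product[symmetric])
  also have "\<dots> = (\<Prod>e\<in>insert e0 E. hermite (card {t\<in>X. \<kappa> t = e}) (a e + w e))"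
    using insert.hyps F G by (simp add: X0_def)
  finally show ?case by (rule sym)
qed

section \<open>Moments of the noise\<close>

text \<open>The sub-Gaussian norm is the infimum of the admissible scales.\<close>
definition psi2_admissible :: "real measure \<Rightarrow> real \<Rightarrow> bool" where
  "psi2_admissible \<mu> t \<longleftrightarrow> 0 < t \<and> (\<integral>\<^sup>+x. ennreal (exp (x\<^sup>2 / t\<^sup>2)) \<partial>\<mu>) \<le> 2"

lemma psi2_admissible_integrable:
  assumes sets: "sets \<mu> = sets borel" and t: "psi2_admissible \<mu> t"
  shows "integrable \<mu> (\<lambda>x. exp (x\<^sup>2 / t\<^sup>2))" "(LINT x|\<mu>. exp (x\<^sup>2 / t\<^sup>2)) \<le> 2"
proof -
  note [measurable_cong] = sets
  have le: "(\<integral>\<^sup>+x. ennreal (exp (x\<^sup>2 / t\<^sup>2)) \<partial>\<mu>) \<le> 2" using t by (simp add: psi2_admissible_def)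
  then have "(\<integral>\<^sup>+x. ennreal (exp (x\<^sup>2 / t\<^sup>2)) \<partial>\<mu>) < \<infinity>"
    by (rule le_less_trans) simp
  then show int: "integrable \<mu> (\<lambda>x. exp (x\<^sup>2 / t\<^sup>2))"
    by (intro integrableI_nonneg) auto
  have "ennreal (LINT x|\<mu>. exp (x\<^sup>2 / t\<^sup>2)) \<le> ennreal 2"
    using nn_integral_eq_integral[OF int] le by simp
  then show "(LINT x|\<mu>. exp (x\<^sup>2 / t\<^sup>2)) \<le> 2" by (subst (asm) ennreal_le_iff) auto
qed

lemma psi2_admissible_mono:
  assumes "psi2_admissible \<mu> t" "t \<le> t'"
  shows "psi2_admissible \<mu> t'"
proof -
  have t: "0 < t" using assms by (simp add: psi2_admissible_def)
  have "(\<integral>\<^sup>+x. ennreal (exp (x\<^sup>2 / t'\<^sup>2)) \<partial>\<mu>) \<le> (\<integral>\<^sup>+x. ennreal (exp (x\<^sup>2 / t\<^sup>2)) \<partial>\<mu>)"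
    using t assms(2) by (intro nn_integral_mono ennreal_leI) (simp add: frac_le power_mono)
  then show ?thesis using assms t by (auto simp: psi2_admissible_def)
qed

locale standardized_law = prob_space \<mu> for \<mu> :: "real measure" +
  assumes sets_eq_borel [measurable_cong]: "sets \<mu> = sets borel"
    and mean_0: "expectation (\<lambda>x. x) = 0"
    and variance_1: "variance (\<lambda>x. x) = 1"
begin

lemma second_moment: "integrable \<mu> (\<lambda>x. x\<^sup>2)" "expectation (\<lambda>x. x\<^sup>2) = 1"
proof -
  show e: "expectation (\<lambda>x. x\<^sup>2) = 1" using variance_1 by (simp add: mean_0)
  show "integrable \<mu> (\<lambda>x. x\<^sup>2)"
    by (rule ccontr) (use e in \<open>simp add: not_integrable_integral_eq\<close>)
qed

text \<open>Unit variance and \<open>1 + u \<le> exp u\<close> give \<open>1 + 1 / t\<^sup>2 \<le> 2\<close>.\<close>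
lemma psi2_admissible_ge_1:
  assumes "psi2_admissible \<mu> t"
  shows "1 \<le> t"
proof -
  have t: "0 < t" using assms by (simp add: psi2_admissible_def)
  note E = psi2_admissible_integrable[OF sets_eq_borel assms]
  have "expectation (\<lambda>x. 1 + x\<^sup>2 / t\<^sup>2) \<le> expectation (\<lambda>x. exp (x\<^sup>2 / t\<^sup>2))"
    by (rule integral_mono) (use E second_moment(1) in \<open>auto simp: exp_ge_add_one_self\<close>)
  also have "expectation (\<lambda>x. 1 + x\<^sup>2 / t\<^sup>2) = 1 + 1 / t\<^sup>2"
    using second_moment by (simp add: prob_space)
  finally have "1 / t\<^sup>2 \<le> 1" using E(2) by simp
  then have "1\<^sup>2 \<le> t\<^sup>2" using t by (simp add: field_simps)
  then show ?thesis using t power2_le_imp_le[of 1 t] by simp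
qed

text \<open>Doubling the norm spares the argument that the infimum is attained; the factor 2 goes into the
constant.\<close>
lemma psi2_norm_admissible:
  assumes "subgaussian \<mu> (\<lambda>x. x)"
  shows "1 \<le> psi2_norm \<mu> (\<lambda>x. x)" "psi2_admissible \<mu> (2 * psi2_norm \<mu> (\<lambda>x. x))"
proof -
  let ?T = "{t. psi2_admissible \<mu> t}"
  have eq: "psi2_norm \<mu> (\<lambda>x. x) = Inf ?T" by (simp add: psi2_norm_def psi2_admissible_def)
  have ne: "?T \<noteq> {}" using assms by (auto simp: subgaussian_def psi2_admissible_def)
  show ge: "1 \<le> psi2_norm \<mu> (\<lambda>x. x)"
    unfolding eq by (rule cInf_greatest[OF ne]) (auto intro: psi2_admissible_ge_1)
  have "bdd_below ?T" by (rule bdd_belowI[of _ 1]) (auto intro: psi2_admissible_ge_1)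
  moreover have "Inf ?T < 2 * psi2_norm \<mu> (\<lambda>x. x)" using ge eq by simp
  ultimately obtain t where "psi2_admissible \<mu> t" "t < 2 * psi2_norm \<mu> (\<lambda>x. x)"
    using cInf_less_iff[OF ne] by auto
  then show "psi2_admissible \<mu> (2 * psi2_norm \<mu> (\<lambda>x. x))"
    by (rule psi2_admissible_mono[OF _ less_imp_le])
qed

text \<open>With \<open>n \<le> D\<close> the power \<open>(1 + \<bar>x\<bar> / (t D))^n\<close> is at most \<open>exp (\<bar>x\<bar> / t)\<close>, and completing the square
bounds this by a constant multiple of \<open>exp (x\<^sup>2 / t\<^sup>2)\<close>.\<close>
lemma shifted_power_moment:
  assumes t: "psi2_admissible \<mu> t" and D: "1 \<le> D" "real n \<le> D"
  shows "integrable \<mu> (\<lambda>x. (\<bar>x\<bar> + D) ^ n)" "expectation (\<lambda>x. (\<bar>x\<bar> + D) ^ n) \<le> 3 * (t * D) ^ n"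
proof -
  have t1: "1 \<le> t" by (rule psi2_admissible_ge_1[OF t])
  have tD: "0 < t * D" using t1 D by simp
  have pt: "(\<bar>x\<bar> + D) ^ n \<le> (t * D) ^ n * (3 / 2 * exp (x\<^sup>2 / t\<^sup>2))" for x
  proof -
    have "D * 1 \<le> t * D" using t1 D by simp
    then have "\<bar>x\<bar> + D \<le> t * D * (1 + \<bar>x\<bar> / (t * D))" using tD t1 D by (simp add: field_simps)
    also have "\<dots> \<le> t * D * exp (\<bar>x\<bar> / (t * D))" using tD by (intro mult_left_mono exp_ge_add_one_self) auto
    finally have "(\<bar>x\<bar> + D) ^ n \<le> (t * D * exp (\<bar>x\<bar> / (t * D))) ^ n"
      using D by (intro power_mono) auto
    also have "\<dots> = (t * D) ^ n * exp (real n * (\<bar>x\<bar> / (t * D)))"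
      unfolding power_mult_distrib exp_of_nat_mult ..
    also have "\<dots> \<le> (t * D) ^ n * exp (1 / 4 + x\<^sup>2 / t\<^sup>2)"
    proof (intro mult_left_mono)
      have "real n * (\<bar>x\<bar> / (t * D)) \<le> D * (\<bar>x\<bar> / (t * D))"
        using D tD by (intro mult_right_mono) auto
      also have "\<dots> = \<bar>x\<bar> / t" using D t1 by simp
      also have "\<dots> \<le> 1 / 4 + (\<bar>x\<bar> / t)\<^sup>2"
        using zero_le_power2[of "\<bar>x\<bar> / t - 1 / 2"] by (simp add: power2_diff) (simp add: power2_eq_square)
      finally show "exp (real n * (\<bar>x\<bar> / (t * D))) \<le> exp (1 / 4 + x\<^sup>2 / t\<^sup>2)"
        by (simp add: power_divide)
    qed (use tD in simp)
    also have "exp (1 / 4 + x\<^sup>2 / t\<^sup>2) \<le> 3 / 2 * exp (x\<^sup>2 / t\<^sup>2)"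
    proof -
      have "exp (1 / 4 :: real) \<le> 1 + 1 / 4 + (1 / 4)\<^sup>2" by (rule exp_bound) auto
      also have "\<dots> \<le> 3 / 2" by (simp add: power2_eq_square)
      finally show ?thesis by (simp add: exp_add)
    qed
    finally show ?thesis using tD by simp
  qed
  note E = psi2_admissible_integrable[OF sets_eq_borel t]
  have int': "integrable \<mu> (\<lambda>x. (t * D) ^ n * (3 / 2 * exp (x\<^sup>2 / t\<^sup>2)))" using E(1) by simp
  have p0: "\<bar>(t * D) ^ n\<bar> = (t * D) ^ n" using tD by simp
  show int: "integrable \<mu> (\<lambda>x. (\<bar>x\<bar> + D) ^ n)"
    by (rule Bochner_Integration.integrable_bound[OF int'])
      (use pt D p0 in \<open>auto simp: abs_mult intro!: AE_I2\<close>)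
  have "expectation (\<lambda>x. (\<bar>x\<bar> + D) ^ n) \<le> expectation (\<lambda>x. (t * D) ^ n * (3 / 2 * exp (x\<^sup>2 / t\<^sup>2)))"
    by (rule integral_mono[OF int int' pt])
  also have "\<dots> = (t * D) ^ n * (3 / 2 * expectation (\<lambda>x. exp (x\<^sup>2 / t\<^sup>2)))" by simp
  also have "\<dots> \<le> (t * D) ^ n * (3 / 2 * 2)" using E(2) tD by (intro mult_left_mono) auto
  finally show "expectation (\<lambda>x. (\<bar>x\<bar> + D) ^ n) \<le> 3 * (t * D) ^ n" by simp
qed

definition hermite_moment :: "nat \<Rightarrow> nat \<Rightarrow> real" where
  "hermite_moment a b = expectation (\<lambda>x. hermite a x * hermite b x)"

lemma abs_hermite_mult_le:
  assumes "real (a + b) \<le> D"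
  shows "\<bar>hermite a x * hermite b x\<bar> \<le> (\<bar>x\<bar> + D) ^ (a + b)"
proof -
  have "\<bar>hermite a x\<bar> \<le> (\<bar>x\<bar> + D) ^ a" "\<bar>hermite b x\<bar> \<le> (\<bar>x\<bar> + D) ^ b"
    using assms by (auto intro!: order.trans[OF abs_hermite_le] power_mono)
  then show ?thesis unfolding abs_mult power_add by (intro mult_mono) auto
qed

lemma hermite_mult_integrable:
  assumes t: "psi2_admissible \<mu> t"
  shows "integrable \<mu> (\<lambda>x. hermite a x * hermite b x)"
proof (rule Bochner_Integration.integrable_bound)
  show "integrable \<mu> (\<lambda>x. (\<bar>x\<bar> + real (Suc (a + b))) ^ (a + b))"
    by (rule shifted_power_moment(1)[OF t]) auto
  show "AE x in \<mu>. norm (hermite a x * hermite b x) \<le> norm ((\<bar>x\<bar> + real (Suc (a + b))) ^ (a + b))"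
    using abs_hermite_mult_le[of a b "real (Suc (a + b))"] by (intro AE_I2) simp
qed measurable

lemma abs_hermite_moment_le:
  assumes t: "psi2_admissible \<mu> t" and D: "1 \<le> D" "real (a + b) \<le> D"
  shows "\<bar>hermite_moment a b\<bar> \<le> 3 * (t * D) ^ (a + b)"
proof -
  have "\<bar>hermite_moment a b\<bar> \<le> expectation (\<lambda>x. \<bar>hermite a x * hermite b x\<bar>)"
    unfolding hermite_moment_def by (rule integral_abs_bound)
  also have "\<dots> \<le> expectation (\<lambda>x. (\<bar>x\<bar> + D) ^ (a + b))"
    by (intro integral_mono shifted_power_moment[OF t D] integrable_abs hermite_mult_integrable[OF t]
        abs_hermite_mult_le D)
  also have "\<dots> \<le> 3 * (t * D) ^ (a + b)" by (rule shifted_power_moment(2)[OF t D])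
  finally show ?thesis .
qed

lemma hermite_moment_0 [simp]: "hermite_moment 0 0 = 1"
  by (simp add: hermite_moment_def prob_space)

text \<open>Mean 0 and variance 1 annihilate the expectations of \<open>H_1\<close> and \<open>H_2\<close>; those of higher degree need
not vanish.\<close>
lemma hermite_moment_vanishes:
  "hermite_moment (Suc 0) 0 = 0" "hermite_moment 0 (Suc 0) = 0"
  "hermite_moment 2 0 = 0" "hermite_moment 0 2 = 0"
  using second_moment
  by (simp_all add: hermite_moment_def hermite_1 hermite_2 mean_0 prob_space)

lemma second_moment_hermite_chaos:
  fixes Z :: "'z set" and \<alpha> :: "'z \<Rightarrow> real" and N :: "'z \<Rightarrow> 'e \<Rightarrow> nat"
  assumes E: "finite E" and t: "psi2_admissible \<mu> t"
  defines "W \<equiv> \<lambda>\<omega>. \<Sum>z\<in>Z. \<alpha> z * (\<Prod>e\<in>E. hermite (N z e) (\<omega> e))"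
  shows "integrable (PiM E (\<lambda>_. \<mu>)) W" "integrable (PiM E (\<lambda>_. \<mu>)) (\<lambda>\<omega>. (W \<omega>)\<^sup>2)"
    "(LINT \<omega>|PiM E (\<lambda>_. \<mu>). (W \<omega>)\<^sup>2)
      = (\<Sum>z\<in>Z. \<Sum>z'\<in>Z. \<alpha> z * \<alpha> z' * (\<Prod>e\<in>E. hermite_moment (N z e) (N z' e)))"
proof -
  interpret product_sigma_finite "\<lambda>_. \<mu>"
    by unfold_locales
  define f where "f M M' \<omega> = (\<Prod>e\<in>E. hermite (M e) (\<omega> e) * hermite (M' e) (\<omega> e))"
    for M M' :: "'e \<Rightarrow> nat" and \<omega>
  have int: "integrable (PiM E (\<lambda>_. \<mu>)) (f M M')" for M M'
    unfolding f_def by (rule product_integrable_prod[OF E]) (rule hermite_mult_integrable[OF t])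
  have mean: "(LINT \<omega>|PiM E (\<lambda>_. \<mu>). f M M' \<omega>) = (\<Prod>e\<in>E. hermite_moment (M e) (M' e))" for M M'
    unfolding f_def hermite_moment_def by (rule product_integral_prod[OF E hermite_mult_integrable[OF t]])
  have sq: "(W \<omega>)\<^sup>2 = (\<Sum>z\<in>Z. \<Sum>z'\<in>Z. \<alpha> z * \<alpha> z' * f (N z) (N z') \<omega>)" for \<omega>
    unfolding W_def f_def power2_eq_square sum_product by (simp add: prod.distrib mult_ac)
  show "integrable (PiM E (\<lambda>_. \<mu>)) W"
    unfolding W_def using int[of _ "\<lambda>_. 0"]
    by (intro Bochner_Integration.integrable_sum integrable_mult_right) (simp add: f_def[abs_def])
  show "integrable (PiM E (\<lambda>_. \<mu>)) (\<lambda>\<omega>. (W \<omega>)\<^sup>2)"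
    unfolding sq by (intro Bochner_Integration.integrable_sum integrable_mult_right int)
  show "(LINT \<omega>|PiM E (\<lambda>_. \<mu>). (W \<omega>)\<^sup>2)
      = (\<Sum>z\<in>Z. \<Sum>z'\<in>Z. \<alpha> z * \<alpha> z' * (\<Prod>e\<in>E. hermite_moment (N z e) (N z' e)))"
    unfolding sq by (simp add: Bochner_Integration.integral_sum int mean)
qed

end

section \<open>Closed walks with marked steps\<close>

text \<open>The matrix product of the step kernels at times \<open>t, \<dots>, t + l - 1\<close>. Both the steps and the label
sets depend on time because a walk alternates between rows and columns.\<close>
fun path_kernel :: "(nat \<Rightarrow> 'l set) \<Rightarrow> (nat \<Rightarrow> 'l \<Rightarrow> 'l \<Rightarrow> real) \<Rightarrow> nat \<Rightarrow> nat \<Rightarrow> 'l \<Rightarrow> 'l \<Rightarrow> real" where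
  "path_kernel L s t 0 x y = of_bool (x = y)"
| "path_kernel L s t (Suc l) x y = (\<Sum>z\<in>L (t + l). path_kernel L s t l x z * s (t + l) z y)"

lemma path_kernel_cong:
  assumes "\<And>i. t \<le> i \<Longrightarrow> i < t + l \<Longrightarrow> s i = s' i"
  shows "path_kernel L s t l = path_kernel L s' t l"
  using assms
proof (induction l)
  case (Suc l)
  then show ?case by (intro ext) simp
qed (intro ext, simp)

lemma path_kernel_shift:
  assumes "\<And>t. L (t + n) = L t" "\<And>t. s (t + n) = s t"
  shows "path_kernel L s (t + n) l = path_kernel L s t l"
proof (induction l)
  case (Suc l)
  show ?case using assms(1)[of "t + l"] assms(2)[of "t + l"] Suc by (intro ext) (simp add: add_ac)
qed (intro ext, simp)

lemma path_kernel_append: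
  assumes fin: "\<And>t. finite (L t)" and y: "y \<in> L (t + l + l')"
  shows "(\<Sum>z\<in>L (t + l). path_kernel L s t l x z * path_kernel L s (t + l) l' z y)
    = path_kernel L s t (l + l') x y"
  using y
proof (induction l' arbitrary: y)
  case 0
  then show ?case using fin by (simp add: of_bool_def if_distrib[of "\<lambda>t. _ * t"] cong: if_cong)
next
  case (Suc l')
  have "(\<Sum>z\<in>L (t + l). path_kernel L s t l x z * path_kernel L s (t + l) (Suc l') z y)
     = (\<Sum>v\<in>L (t + l + l'). (\<Sum>z\<in>L (t + l). path_kernel L s t l x z * path_kernel L s (t + l) l' z v)
          * s (t + l + l') v y)"
    by (simp add: sum_distrib_left sum_distrib_right mult_ac) (rule sum.swap)
  also have "\<dots> = (\<Sum>v\<in>L (t + l + l'). path_kernel L s t (l + l') x v * s (t + l + l') v y)"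
    by (intro sum.cong refl) (simp add: Suc.IH)
  finally show ?case by (simp add: add_ac)
qed

lemma path_kernel_bounded:
  assumes fin: "\<And>t. finite (L t)" and s: "\<And>t. kernel_bounded (L t) (L (Suc t)) (s t) \<sigma>"
  shows "kernel_bounded (L t) (L (t + l)) (path_kernel L s t l) (\<sigma> ^ l)"
proof (induction l)
  case 0
  have "path_kernel L s t 0 = (\<lambda>x y. of_bool (x = y))" by (intro ext) simp
  then show ?case using kernel_bounded_id[OF fin] by simp
next
  case (Suc l)
  have "path_kernel L s t (Suc l) = (\<lambda>x y. \<Sum>z\<in>L (t + l). path_kernel L s t l x z * s (t + l) z y)"
    by (intro ext) simp
  then show ?case using kernel_bounded_compose[OF Suc s[of "t + l"]] by (simp add: mult.commute)
qed

text \<open>The arbitrary function \<open>h\<close> of the two ends makes the induction on the length possible and later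
closes the walk.\<close>
lemma sum_walks_eq_path_kernel:
  assumes fin: "\<And>t. finite (L t)"
  shows "(\<Sum>z\<in>PiE {..<Suc n} L. (\<Prod>t<n. s t (z t) (z (Suc t))) * h (z 0) (z n))
    = (\<Sum>u\<in>L 0. \<Sum>v\<in>L n. path_kernel L s 0 n u v * h u v)"
proof (induction n arbitrary: h)
  case 0
  have "(\<Sum>v\<in>L 0. of_bool (u = v) * h u v) = h u u" if "u \<in> L 0" for u
    using fin that by (simp add: of_bool_def if_distrib[of "\<lambda>t. t * _"] cong: if_cong)
  then show ?case by (simp add: lessThan_Suc sum_PiE_insert[of 0 "{}"])
next
  case (Suc n)
  have "(\<Sum>z\<in>PiE {..<Suc (Suc n)} L. (\<Prod>t<Suc n. s t (z t) (z (Suc t))) * h (z 0) (z (Suc n)))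
      = (\<Sum>w\<in>L (Suc n). \<Sum>z\<in>PiE {..<Suc n} L.
          (\<Prod>t<n. s t (z t) (z (Suc t))) * (s n (z n) w * h (z 0) w))"
  proof -
    have "(\<Prod>t<Suc n. s t ((z(Suc n := w)) t) ((z(Suc n := w)) (Suc t)))
        = (\<Prod>t<n. s t (z t) (z (Suc t))) * s n (z n) w" for z w
      unfolding prod.lessThan_Suc by (intro arg_cong2[of _ _ _ _ "(*)"] prod.cong refl) auto
    then show ?thesis
      unfolding lessThan_Suc[of "Suc n"] by (subst sum_PiE_insert) (simp_all add: mult.assoc)
  qed
  also have "\<dots> = (\<Sum>w\<in>L (Suc n). \<Sum>u\<in>L 0. \<Sum>v\<in>L n. path_kernel L s 0 n u v * (s n v w * h u w))"
  proof (rule sum.cong[OF refl])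
    fix w
    show "(\<Sum>z\<in>PiE {..<Suc n} L. (\<Prod>t<n. s t (z t) (z (Suc t))) * (s n (z n) w * h (z 0) w))
        = (\<Sum>u\<in>L 0. \<Sum>v\<in>L n. path_kernel L s 0 n u v * (s n v w * h u w))"
      by (rule Suc.IH[where h = "\<lambda>u v. s n v w * h u w"])
  qed
  also have "\<dots> = (\<Sum>u\<in>L 0. \<Sum>w\<in>L (Suc n). \<Sum>v\<in>L n. path_kernel L s 0 n u v * (s n v w * h u w))"
    by (rule sum.swap)
  finally show ?case by (simp add: sum_distrib_left sum_distrib_right mult_ac)
qed

lemma sum_closed_walks_eq_path_kernel:
  assumes fin: "\<And>t. finite (L t)" and n: "0 < n"
  shows "(\<Sum>z\<in>PiE {..<n} L. \<Prod>t<n. s t (z t) (z (Suc t mod n))) = (\<Sum>u\<in>L 0. path_kernel L s 0 n u u)"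
proof -
  obtain m where m: "n = Suc m" using n by (cases n) auto
  have "(\<Sum>z\<in>PiE {..<n} L. \<Prod>t<n. s t (z t) (z (Suc t mod n)))
      = (\<Sum>z\<in>PiE {..<Suc m} L. (\<Prod>t<m. s t (z t) (z (Suc t))) * s m (z m) (z 0))"
    unfolding m by (intro sum.cong refl) (auto intro!: prod.cong)
  also have "\<dots> = (\<Sum>u\<in>L 0. \<Sum>v\<in>L m. path_kernel L s 0 m u v * s m v u)"
    by (rule sum_walks_eq_path_kernel[OF fin, where h = "\<lambda>u v. s m v u"])
  finally show ?thesis by (simp add: m)
qed

text \<open>At a marked time the step is a matrix unit, which forces the walk through the prescribed labels
\<open>X t\<close> before and \<open>Y t\<close> after the step.\<close>
definition marked_kernel :: "nat set \<Rightarrow> (nat \<Rightarrow> 'l) \<Rightarrow> (nat \<Rightarrow> 'l) \<Rightarrow> (nat \<Rightarrow> 'l \<Rightarrow> 'l \<Rightarrow> real) \<Rightarrow> nat \<Rightarrow> 'l \<Rightarrow> 'l \<Rightarrow> real" where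
  "marked_kernel B X Y s t = (if t \<in> B then (\<lambda>x y. of_bool (x = X t \<and> y = Y t)) else s t)"

text \<open>Matrix units cut a product of kernels into the blocks between them: \<open>f\<close> and \<open>l\<close> are the first and the
last mark, \<open>next_mark\<close> leads from a mark to the following one, and \<open>gap\<close> counts the unmarked steps
in between.\<close>
lemma marked_path_kernel:
  fixes s :: "nat \<Rightarrow> 'l \<Rightarrow> 'l \<Rightarrow> real"
  assumes fin: "\<And>t. finite (L t)" and B: "B \<subseteq> {..<m}" "B \<noteq> {}"
  shows "\<exists>f l next_mark gap. f \<in> B \<and> l \<in> B \<and> bij_betw next_mark (B - {l}) (B - {f}) \<and>
    (\<forall>t\<in>B - {l}. Suc t + gap t = next_mark t) \<and>
    f + (\<Sum>t\<in>B - {l}. gap t) + (m - Suc l) + card B = m \<and>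
    (\<forall>X Y u v. (\<forall>t\<in>B. X t \<in> L t) \<longrightarrow>
      path_kernel L (marked_kernel B X Y s) 0 m u v =
        path_kernel L s 0 f u (X f) * (\<Prod>t\<in>B - {l}. path_kernel L s (Suc t) (gap t) (Y t) (X (next_mark t)))
         * path_kernel L s (Suc l) (m - Suc l) (Y l) v)"
  using B
proof (induction m arbitrary: B)
  case 0
  then show ?case by simp
next
  case (Suc m)
  let ?p = "path_kernel L s" and ?q = "\<lambda>B X Y. path_kernel L (marked_kernel B X Y s) 0"
  show ?case
  proof (cases "m \<in> B")
    case False
    then have Bm: "B \<subseteq> {..<m}" using Suc.prems by (auto simp: less_Suc_eq)
    from Suc.IH[OF Bm Suc.prems(2)] obtain f l next_mark gap where *: "f \<in> B" "l \<in> B"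
      "bij_betw next_mark (B - {l}) (B - {f})" "\<forall>t\<in>B - {l}. Suc t + gap t = next_mark t"
      "f + (\<Sum>t\<in>B - {l}. gap t) + (m - Suc l) + card B = m"
      and eq: "\<And>X Y u v. \<forall>t\<in>B. X t \<in> L t \<Longrightarrow>
        ?q B X Y m u v =
        ?p 0 f u (X f) * (\<Prod>t\<in>B - {l}. ?p (Suc t) (gap t) (Y t) (X (next_mark t)))
         * ?p (Suc l) (m - Suc l) (Y l) v" by blast
    have lm: "l < m" using * Bm by auto
    have sm: "Suc m - Suc l = Suc (m - Suc l)" "Suc l + (m - Suc l) = m" using lm by auto
    show ?thesis
    proof (rule exI[of _ f], rule exI[of _ l], rule exI[of _ next_mark], rule exI[of _ gap], intro conjI allI impI)
      show "f + (\<Sum>t\<in>B - {l}. gap t) + (Suc m - Suc l) + card B = Suc m" using * sm by simp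
      fix X Y :: "nat \<Rightarrow> 'l" and u v assume X: "\<forall>t\<in>B. X t \<in> L t"
      have "marked_kernel B X Y s m = s m" using False by (simp add: marked_kernel_def)
      then show "?q B X Y (Suc m) u v =
        ?p 0 f u (X f) * (\<Prod>t\<in>B - {l}. ?p (Suc t) (gap t) (Y t) (X (next_mark t)))
         * ?p (Suc l) (Suc m - Suc l) (Y l) v"
        unfolding sm(1) path_kernel.simps(2) sm(2) by (simp add: eq[OF X] sum_distrib_left mult_ac)
    qed (use * in auto)
  next
    case True
    define B' where "B' = B - {m}"
    have B'm: "B' \<subseteq> {..<m}" using Suc.prems by (auto simp: B'_def less_Suc_eq)
    have B: "B = insert m B'" "m \<notin> B'" using True by (auto simp: B'_def)
    have finB': "finite B'" using B'm finite_subset by blast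
    have last: "?q B X Y (Suc m) u v
        = ?q B' X Y m u (X m) * of_bool (Y m = v)"
      if X: "\<forall>t\<in>B. X t \<in> L t" for X Y u v
    proof -
      have "?q B X Y m = ?q B' X Y m"
        by (rule path_kernel_cong) (auto simp: marked_kernel_def B'_def)
      moreover have "X m \<in> L m" using X True by blast
      ultimately show ?thesis using True fin
        by (auto simp: marked_kernel_def of_bool_def if_distrib[of "\<lambda>t. _ * t"] cong: if_cong)
    qed
    show ?thesis
    proof (cases "B' = {}")
      case empty: True
      have Bm: "B = {m}" using B empty by simp
      have no: "path_kernel L (marked_kernel {} X Y s) 0 m = ?p 0 m" for X Y
        by (rule path_kernel_cong) (simp add: marked_kernel_def)
      show ?thesis
        by (rule exI[of _ m], rule exI[of _ m], rule exI[of _ id], rule exI[of _ "\<lambda>_. 0"])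
          (use last in \<open>auto simp: empty no Bm bij_betw_def\<close>)
    next
      case False
      from Suc.IH[OF B'm False] obtain f l next_mark gap where *: "f \<in> B'" "l \<in> B'"
        "bij_betw next_mark (B' - {l}) (B' - {f})" "\<forall>t\<in>B' - {l}. Suc t + gap t = next_mark t"
        "f + (\<Sum>t\<in>B' - {l}. gap t) + (m - Suc l) + card B' = m"
        and eq: "\<And>X Y u v. \<forall>t\<in>B'. X t \<in> L t \<Longrightarrow>
          ?q B' X Y m u v =
          ?p 0 f u (X f) * (\<Prod>t\<in>B' - {l}. ?p (Suc t) (gap t) (Y t) (X (next_mark t)))
           * ?p (Suc l) (m - Suc l) (Y l) v" by blast
      have lm: "l < m" using * B'm by auto
      \<comment> \<open>The new mark \<open>m\<close> becomes the last one and succeeds \<open>l\<close>.\<close>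
      define next_mark' where "next_mark' = next_mark(l := m)"
      define gap' where "gap' = gap(l := m - Suc l)"
      have Bl: "B - {m} = insert l (B' - {l})" using B *(2) by auto
      have prod': "(\<Prod>t\<in>B - {m}. ?p (Suc t) (gap' t) (Y t) (X (next_mark' t)))
          = ?p (Suc l) (m - Suc l) (Y l) (X m)
            * (\<Prod>t\<in>B' - {l}. ?p (Suc t) (gap t) (Y t) (X (next_mark t)))" for X Y
      proof -
        have "(\<Prod>t\<in>B' - {l}. ?p (Suc t) (gap' t) (Y t) (X (next_mark' t)))
          = (\<Prod>t\<in>B' - {l}. ?p (Suc t) (gap t) (Y t) (X (next_mark t)))"
          by (rule prod.cong) (auto simp: gap'_def next_mark'_def)
        then show ?thesis unfolding Bl using finB'
          by (subst prod.insert) (auto simp: gap'_def next_mark'_def)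
      qed
      have sum': "(\<Sum>t\<in>B - {m}. gap' t) = (m - Suc l) + (\<Sum>t\<in>B' - {l}. gap t)"
      proof -
        have "(\<Sum>t\<in>B' - {l}. gap' t) = (\<Sum>t\<in>B' - {l}. gap t)"
          by (rule sum.cong) (auto simp: gap'_def)
        then show ?thesis unfolding Bl using finB'
          by (subst sum.insert) (auto simp: gap'_def)
      qed
      have bij: "bij_betw next_mark' (B - {m}) (B - {f})"
      proof -
        have "bij_betw next_mark' (B' - {l}) (B' - {f})"
          using *(3) by (subst bij_betw_cong[of _ _ next_mark]) (auto simp: next_mark'_def)
        then have "bij_betw next_mark' (insert l (B' - {l})) (insert (next_mark' l) (B' - {f}))"
          using B'm by (subst notIn_Un_bij_betw3[symmetric, of l _ next_mark', unfolded Un_insert_right Un_empty_right])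
            (auto simp: next_mark'_def)
        moreover have "insert (next_mark' l) (B' - {f}) = B - {f}" using B *(1) by (auto simp: next_mark'_def)
        ultimately show ?thesis unfolding Bl by simp
      qed
      show ?thesis
      proof (rule exI[of _ f], rule exI[of _ m], rule exI[of _ next_mark'], rule exI[of _ gap'], intro conjI allI impI ballI)
        show "f \<in> B" "m \<in> B" using B * by auto
        show "f + (\<Sum>t\<in>B - {m}. gap' t) + (Suc m - Suc m) + card B = Suc m"
          using * B finB' sum' by simp
        show "Suc t + gap' t = next_mark' t" if "t \<in> B - {m}" for t
          using that * lm B unfolding Bl by (auto simp: gap'_def next_mark'_def)
        fix X Y :: "nat \<Rightarrow> 'l" and u v assume X: "\<forall>t\<in>B. X t \<in> L t"
        then have X': "\<forall>t\<in>B'. X t \<in> L t" using B by blast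
        show "?q B X Y (Suc m) u v =
          ?p 0 f u (X f) * (\<Prod>t\<in>B - {m}. ?p (Suc t) (gap' t) (Y t) (X (next_mark' t)))
           * ?p (Suc m) (Suc m - Suc m) (Y m) v"
          unfolding last[OF X] eq[OF X'] prod' by simp
      qed (rule bij)
    qed
  qed
qed

text \<open>In a closed walk the block after the last mark continues, through time \<open>n\<close>, with the block before
the first mark. Thus every mark has a successor, and the alternative with \<open>+ n\<close> is the
passage through the starting point.\<close>
lemma closed_marked_path_kernel:
  fixes s :: "nat \<Rightarrow> 'l \<Rightarrow> 'l \<Rightarrow> real"
  assumes fin: "\<And>t. finite (L t)" and B: "B \<subseteq> {..<n}" "B \<noteq> {}"
    and per: "\<And>t. L (t + n) = L t" "\<And>t. s (t + n) = s t"
  obtains next_mark gap where "bij_betw next_mark B B" "(\<Sum>t\<in>B. gap t) + card B = n"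
    "\<And>t. t \<in> B \<Longrightarrow> Suc t + gap t = next_mark t \<or> Suc t + gap t = next_mark t + n"
    "\<forall>X Y. (\<forall>t\<in>B. X t \<in> L t) \<longrightarrow>
      (\<Sum>u\<in>L 0. path_kernel L (marked_kernel B X Y s) 0 n u u)
        = (\<Prod>t\<in>B. path_kernel L s (Suc t) (gap t) (Y t) (X (next_mark t)))"
proof -
  let ?p = "path_kernel L s" and ?q = "\<lambda>X Y. path_kernel L (marked_kernel B X Y s) 0 n"
  from marked_path_kernel[where s = s and L = L, OF fin B] obtain f l next_mark gap where *: "f \<in> B" "l \<in> B"
      "bij_betw next_mark (B - {l}) (B - {f})" "\<forall>t\<in>B - {l}. Suc t + gap t = next_mark t"
      "f + (\<Sum>t\<in>B - {l}. gap t) + (n - Suc l) + card B = n"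
      and eq: "\<And>X Y u v. \<forall>t\<in>B. X t \<in> L t \<Longrightarrow>
        ?q X Y u v =
        ?p 0 f u (X f) * (\<Prod>t\<in>B - {l}. ?p (Suc t) (gap t) (Y t) (X (next_mark t)))
         * ?p (Suc l) (n - Suc l) (Y l) v" by blast
  have ln: "l < n" using * B by auto
  have finB: "finite B" using B finite_subset by blast
  \<comment> \<open>The last mark is followed by the first one of the next round.\<close>
  define next_mark' where "next_mark' = next_mark(l := f)"
  define gap' where "gap' = gap(l := n - Suc l + f)"
  have Bl: "B = insert l (B - {l})" using *(2) by auto
  have prod': "(\<Prod>t\<in>B. ?p (Suc t) (gap' t) (Y t) (X (next_mark' t)))
      = ?p (Suc l) (n - Suc l + f) (Y l) (X f)
        * (\<Prod>t\<in>B - {l}. ?p (Suc t) (gap t) (Y t) (X (next_mark t)))" for X Y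
  proof -
    have "(\<Prod>t\<in>B - {l}. ?p (Suc t) (gap' t) (Y t) (X (next_mark' t)))
      = (\<Prod>t\<in>B - {l}. ?p (Suc t) (gap t) (Y t) (X (next_mark t)))"
      by (rule prod.cong) (auto simp: gap'_def next_mark'_def)
    then show ?thesis using prod.remove[OF finB *(2), of "\<lambda>t. ?p (Suc t) (gap' t) (Y t) (X (next_mark' t))"]
      by (simp add: gap'_def next_mark'_def)
  qed
  show thesis
  proof (rule that[of next_mark' gap'])
    have "bij_betw next_mark' (B - {l}) (B - {f})"
      using *(3) by (subst bij_betw_cong[of _ _ next_mark]) (auto simp: next_mark'_def)
    then have "bij_betw next_mark' (insert l (B - {l})) (insert (next_mark' l) (B - {f}))"
      by (subst notIn_Un_bij_betw3[symmetric, of l _ next_mark', unfolded Un_insert_right Un_empty_right])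
        (auto simp: next_mark'_def)
    then show "bij_betw next_mark' B B" using *(1,2) by (simp add: next_mark'_def insert_absorb)
    have "(\<Sum>t\<in>B - {l}. gap' t) = (\<Sum>t\<in>B - {l}. gap t)"
      by (rule sum.cong) (auto simp: gap'_def)
    then show "(\<Sum>t\<in>B. gap' t) + card B = n"
      using sum.remove[OF finB *(2), of gap'] *(5) by (simp add: gap'_def)
    show "Suc t + gap' t = next_mark' t \<or> Suc t + gap' t = next_mark' t + n" if "t \<in> B" for t
      using that * ln by (cases "t = l") (auto simp: gap'_def next_mark'_def)
    show "\<forall>X Y. (\<forall>t\<in>B. X t \<in> L t) \<longrightarrow>
      (\<Sum>u\<in>L 0. ?q X Y u u)
        = (\<Prod>t\<in>B. ?p (Suc t) (gap' t) (Y t) (X (next_mark' t)))"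
  proof (intro allI impI)
    fix X Y :: "nat \<Rightarrow> 'l" assume X: "\<forall>t\<in>B. X t \<in> L t"
    let ?P = "\<Prod>t\<in>B - {l}. ?p (Suc t) (gap t) (Y t) (X (next_mark t))"
    have L0: "L 0 = L (Suc l + (n - Suc l))" using per(1)[of 0] ln by simp
    have p0: "?p 0 f = ?p (Suc l + (n - Suc l)) f"
      using path_kernel_shift[where L = L and s = s, OF per, of 0 f] ln by simp
    have "(\<Sum>u\<in>L 0. ?q X Y u u)
      = ?P * (\<Sum>u\<in>L (Suc l + (n - Suc l)). ?p (Suc l) (n - Suc l) (Y l) u
           * ?p (Suc l + (n - Suc l)) f u (X f))"
      unfolding eq[OF X] p0 by (simp add: L0 sum_distrib_left mult_ac)
    also have "\<dots> = ?P * ?p (Suc l) (n - Suc l + f) (Y l) (X f)"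
    proof (subst path_kernel_append[OF fin])
      have "X f \<in> L f" using X *(1) by blast
      then show "X f \<in> L (Suc l + (n - Suc l) + f)" using per(1)[of f] ln by (simp add: add.commute)
    qed simp
    finally show "(\<Sum>u\<in>L 0. ?q X Y u u)
        = (\<Prod>t\<in>B. ?p (Suc t) (gap' t) (Y t) (X (next_mark' t)))"
      unfolding prod' by simp
  qed
  qed
qed

text \<open>The labels that a walk attaches to the two ends of its marked steps; the half \<open>(t, False)\<close> is the
start and \<open>(t, True)\<close> the end of step \<open>t\<close>.\<close>
definition walk_halves :: "nat \<Rightarrow> nat set \<Rightarrow> (nat \<Rightarrow> 'l) \<Rightarrow> nat \<times> bool \<Rightarrow> 'l" where
  "walk_halves n B z = (\<lambda>(t, e)\<in>B \<times> UNIV. if e then z (Suc t mod n) else z t)"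

definition half_labels :: "(nat \<Rightarrow> 'l set) \<Rightarrow> nat \<times> bool \<Rightarrow> 'l set" where
  "half_labels L = (\<lambda>(t, e). L (if e then Suc t else t))"

text \<open>Split a walk sum according to the labels of the marked steps, and sum out the positions that no
marked step touches. A function of the marked labels alone is multiplied by the kernels of
the gaps, each of which joins the end of a mark with the start of the next one.\<close>
lemma sum_walks_marked:
  fixes s :: "nat \<Rightarrow> 'l \<Rightarrow> 'l \<Rightarrow> real"
  assumes fin: "\<And>t. finite (L t)" and B: "B \<subseteq> {..<n}" "B \<noteq> {}"
    and per: "\<And>t. L (t + n) = L t" "\<And>t. s (t + n) = s t"
  obtains next_mark gap where "bij_betw next_mark B B" "(\<Sum>t\<in>B. gap t) + card B = n"
    "\<And>t. t \<in> B \<Longrightarrow> Suc t + gap t = next_mark t \<or> Suc t + gap t = next_mark t + n"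
    "\<And>\<Psi>. (\<Sum>z\<in>PiE {..<n} L. (\<Prod>t\<in>{..<n} - B. s t (z t) (z (Suc t mod n))) * \<Psi> (walk_halves n B z))
      = (\<Sum>g\<in>PiE (B \<times> UNIV) (half_labels L).
          \<Psi> g * (\<Prod>t\<in>B. path_kernel L s (Suc t) (gap t) (g (t, True)) (g (next_mark t, False))))"
proof -
  obtain next_mark gap where *: "bij_betw next_mark B B" "(\<Sum>t\<in>B. gap t) + card B = n"
    "\<And>t. t \<in> B \<Longrightarrow> Suc t + gap t = next_mark t \<or> Suc t + gap t = next_mark t + n"
    and eq: "\<forall>X Y. (\<forall>t\<in>B. X t \<in> L t) \<longrightarrow>
      (\<Sum>u\<in>L 0. path_kernel L (marked_kernel B X Y s) 0 n u u)
        = (\<Prod>t\<in>B. path_kernel L s (Suc t) (gap t) (Y t) (X (next_mark t)))"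
    by (rule closed_marked_path_kernel[where L = L and s = s, OF fin B per]) (rule that)
  have n: "0 < n" using B by auto
  have finB: "finite B" using B finite_subset by blast
  have Lmod: "L (Suc t mod n) = L (Suc t)" if "t < n" for t
  proof (cases "Suc t = n")
    case True
    then show ?thesis using per(1)[of 0] by simp
  qed (use that in simp)
  show thesis
  proof (rule that[OF *])
    let ?T = "\<lambda>g. \<Prod>t\<in>B. path_kernel L s (Suc t) (gap t) (g (t, True)) (g (next_mark t, False))"
    let ?m = "\<lambda>g. marked_kernel B (\<lambda>t. g (t, False)) (\<lambda>t. g (t, True)) s"
    fix \<Psi> :: "(nat \<times> bool \<Rightarrow> 'l) \<Rightarrow> real"
    let ?P = "\<lambda>z. \<Prod>t\<in>{..<n} - B. s t (z t) (z (Suc t mod n))"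
    let ?H = "PiE (B \<times> UNIV) (half_labels L)"
    have finH: "finite ?H" using finB fin by (intro finite_PiE) (auto simp: half_labels_def)
    have mem: "walk_halves n B z \<in> ?H" if z: "z \<in> PiE {..<n} L" for z
    proof (rule PiE_I)
      fix h :: "nat \<times> bool" assume h: "h \<in> B \<times> UNIV"
      then obtain t e where te: "h = (t, e)" "t \<in> B" by auto
      then have t: "t < n" using B by auto
      have "z t \<in> L t" "z (Suc t mod n) \<in> L (Suc t mod n)" using PiE_mem[OF z, of t] PiE_mem[OF z, of "Suc t mod n"] t n by auto
      then show "walk_halves n B z h \<in> half_labels L h"
        using te Lmod[OF t] by (auto simp: walk_halves_def half_labels_def)
    qed (auto simp: walk_halves_def)
    have delta: "?P z * of_bool (walk_halves n B z = g)
        = (\<Prod>t<n. ?m g t (z t) (z (Suc t mod n)))"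
      if g: "g \<in> ?H" for z g
    proof -
      have "walk_halves n B z = g \<longleftrightarrow> (\<forall>t\<in>B. z t = g (t, False) \<and> z (Suc t mod n) = g (t, True))"
      proof
        assume "walk_halves n B z = g"
        then show "\<forall>t\<in>B. z t = g (t, False) \<and> z (Suc t mod n) = g (t, True)"
          by (auto simp: walk_halves_def)
      next
        assume a: "\<forall>t\<in>B. z t = g (t, False) \<and> z (Suc t mod n) = g (t, True)"
        show "walk_halves n B z = g"
        proof (rule PiE_ext[OF _ g])
          show "walk_halves n B z \<in> ?H"
          proof (rule PiE_I)
            fix h :: "nat \<times> bool" assume h: "h \<in> B \<times> UNIV"
            then obtain t e where te: "h = (t, e)" "t \<in> B" by auto
            have "walk_halves n B z h = g h" using te a by (cases e) (auto simp: walk_halves_def)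
            then show "walk_halves n B z h \<in> half_labels L h" using PiE_mem[OF g h] by simp
          qed (auto simp: walk_halves_def)
          fix h :: "nat \<times> bool" assume h: "h \<in> B \<times> UNIV"
          then obtain t e where te: "h = (t, e)" "t \<in> B" by auto
          show "walk_halves n B z h = g h" using te a by (cases e) (auto simp: walk_halves_def)
        qed
      qed
      then have "of_bool (walk_halves n B z = g)
          = (\<Prod>t\<in>B. of_bool (z t = g (t, False) \<and> z (Suc t mod n) = g (t, True)) :: real)"
        using finB by (auto simp: of_bool_def prod_zero_iff)
      moreover have "(\<Prod>t<n. ?m g t (z t) (z (Suc t mod n)))
          = ?P z * (\<Prod>t\<in>B. of_bool (z t = g (t, False) \<and> z (Suc t mod n) = g (t, True)))"
        by (subst prod.subset_diff[OF B(1)]) (auto simp: marked_kernel_def intro!: arg_cong2[of _ _ _ _ "(*)"] prod.cong)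
      ultimately show ?thesis by simp
    qed
    have "(\<Sum>z\<in>PiE {..<n} L. ?P z * \<Psi> (walk_halves n B z))
        = (\<Sum>z\<in>PiE {..<n} L. \<Sum>g\<in>?H. \<Psi> g * (?P z * of_bool (walk_halves n B z = g)))"
    proof (rule sum.cong[OF refl])
      fix z assume "z \<in> PiE {..<n} L"
      from mem[OF this] show "?P z * \<Psi> (walk_halves n B z)
          = (\<Sum>g\<in>?H. \<Psi> g * (?P z * of_bool (walk_halves n B z = g)))"
        using finH by (simp add: of_bool_def if_distrib[of "\<lambda>t. _ * t"] cong: if_cong)
    qed
    also have "\<dots> = (\<Sum>g\<in>?H. \<Psi> g * (\<Sum>z\<in>PiE {..<n} L. ?P z * of_bool (walk_halves n B z = g)))"
      unfolding sum_distrib_left by (rule sum.swap)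
    also have "\<dots> = (\<Sum>g\<in>?H. \<Psi> g * ?T g)"
    proof (rule sum.cong[OF refl])
      fix g assume g: "g \<in> ?H"
      have "(\<Sum>z\<in>PiE {..<n} L. ?P z * of_bool (walk_halves n B z = g))
          = (\<Sum>u\<in>L 0. path_kernel L (?m g) 0 n u u)"
        unfolding delta[OF g] by (rule sum_closed_walks_eq_path_kernel[OF fin n])
      also have "\<dots> = ?T g"
      proof (rule eq[rule_format])
        fix t assume "t \<in> B"
        then show "g (t, False) \<in> L t" using PiE_mem[OF g, of "(t, False)"] by (simp add: half_labels_def)
      qed
      finally show "\<Psi> g * (\<Sum>z\<in>PiE {..<n} L. ?P z * of_bool (walk_halves n B z = g))
        = \<Psi> g * ?T g" by simp
    qed
    finally show "(\<Sum>z\<in>PiE {..<n} L. ?P z * \<Psi> (walk_halves n B z))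
      = (\<Sum>g\<in>?H. \<Psi> g * (\<Prod>t\<in>B. path_kernel L s (Suc t) (gap t) (g (t, True)) (g (next_mark t, False))))" .
  qed
qed

section \<open>Powers of the Gram matrix and singular values\<close>

text \<open>For an eigenvector \<open>v\<close>, \<open>z\<close> times the squared norm of \<open>v\<close> is the squared norm of \<open>A v\<close>.\<close>
lemma eigenvalue_gram_real_nonneg:
  fixes A :: "real mat"
  assumes A: "A \<in> carrier_mat p q" and ev: "eigenvalue (map_mat complex_of_real (A\<^sup>T * A)) z"
  shows "\<exists>e\<ge>0. z = complex_of_real e"
proof -
  define C where "C = map_mat complex_of_real A"
  have C: "C \<in> carrier_mat p q" using A by (simp add: C_def)
  have CT: "C\<^sup>T \<in> carrier_mat q p" using C by simp
  have B: "map_mat complex_of_real (A\<^sup>T * A) = C\<^sup>T * C"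
    using of_real_hom.mat_hom_mult[of "A\<^sup>T" q p A q] A by (simp add: C_def map_mat_transpose)
  from ev obtain v where v: "v \<in> carrier_vec q" "v \<noteq> 0\<^sub>v q" "(C\<^sup>T * C) *\<^sub>v v = z \<cdot>\<^sub>v v"
    unfolding eigenvalue_def eigenvector_def B using CT by auto
  define w where "w = C *\<^sub>v v"
  have w: "w \<in> carrier_vec p" using C v by (simp add: w_def)
  have cv: "conjugate v \<in> carrier_vec q" using v by simp
  have cw: "conjugate w = C *\<^sub>v conjugate v"
  proof (rule eq_vecI)
    fix i assume "i < dim_vec (C *\<^sub>v conjugate v)"
    then have i: "i < p" using C by simp
    have "conjugate w $ i = cnj (\<Sum>j = 0..<q. C $$ (i, j) * v $ j)"
      using i C v w by (simp add: w_def scalar_prod_def)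
    also have "\<dots> = (\<Sum>j = 0..<q. C $$ (i, j) * cnj (v $ j))"
      using i A by (simp add: C_def)
    also have "\<dots> = (C *\<^sub>v conjugate v) $ i"
      using i C v by (simp add: scalar_prod_def)
    finally show "conjugate w $ i = (C *\<^sub>v conjugate v) $ i" .
  qed (use C w in simp)
  have "z * (v \<bullet>c v) = (z \<cdot>\<^sub>v v) \<bullet> conjugate v" using v cv by simp
  also have "z \<cdot>\<^sub>v v = C\<^sup>T *\<^sub>v w"
    unfolding v(3)[symmetric] w_def by (rule assoc_mult_mat_vec[OF CT C v(1)])
  also have "(C\<^sup>T *\<^sub>v w) \<bullet> conjugate v = w \<bullet>c w"
    unfolding cw by (rule transpose_vec_mult_scalar[OF C cv w])
  finally have eq: "z * (v \<bullet>c v) = w \<bullet>c w" .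
  have vp: "v \<bullet>c v > 0" using v by (simp add: conjugate_square_greater_0_vec)
  have wp: "w \<bullet>c w \<ge> 0" by (rule conjugate_square_ge_0_vec)
  define a where "a = Re (v \<bullet>c v)"
  define b where "b = Re (w \<bullet>c w)"
  have a: "v \<bullet>c v = complex_of_real a" "0 < a"
    using vp by (auto simp: a_def less_complex_def complex_eq_iff)
  have b: "w \<bullet>c w = complex_of_real b" "0 \<le> b"
    using wp by (auto simp: b_def less_eq_complex_def complex_eq_iff)
  have "z = complex_of_real (b / a)" using eq a b by (simp add: field_simps)
  then show ?thesis using a b by (intro exI[of _ "b / a"]) auto
qed

text \<open>The factorization over the complex numbers descends to the reals because all roots are real; hence
the real roots of the characteristic polynomial account for its full degree.\<close>
lemma char_poly_gram:
  fixes A :: "real mat"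
  assumes A: "A \<in> carrier_mat p q"
  obtains es where "char_poly (A\<^sup>T * A) = (\<Prod>e\<leftarrow>es. [:- e, 1:])" "length es = q" "\<forall>e\<in>set es. 0 \<le> e"
proof -
  let ?B = "A\<^sup>T * A"
  let ?C = "map_mat complex_of_real ?B"
  have B: "?B \<in> carrier_mat q q" using A by simp
  then have C: "?C \<in> carrier_mat q q" by simp
  obtain as where as: "char_poly ?C = (\<Prod>a\<leftarrow>as. [:- a, 1:])" "length as = q"
    using char_poly_factorized[OF C] by blast
  have real: "\<exists>e\<ge>0. a = complex_of_real e" if "a \<in> set as" for a
  proof -
    have "poly (char_poly ?C) a = 0" using that unfolding as(1) by (auto simp: poly_prod_list prod_list_zero_iff)
    then have "eigenvalue ?C a" using eigenvalue_root_char_poly[OF C] by simp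
    then show ?thesis by (rule eigenvalue_gram_real_nonneg[OF A])
  qed
  define es where "es = map Re as"
  have as_es: "as = map complex_of_real es"
    unfolding es_def map_map by (rule sym, rule map_idI) (use real in force)
  interpret h: map_poly_inj_idom_hom complex_of_real ..
  have "map_poly complex_of_real (char_poly ?B) = map_poly complex_of_real (\<Prod>e\<leftarrow>es. [:- e, 1:])"
    unfolding of_real_hom.char_poly_hom[OF B, symmetric] as(1) as_es
    by (simp add: h.hom_prod_list o_def)
  then have "char_poly ?B = (\<Prod>e\<leftarrow>es. [:- e, 1:])" by simp
  moreover have "0 \<le> e" if "e \<in> set es" for e using that real by (force simp: es_def)
  moreover have "length es = q" by (simp add: es_def as(2))
  ultimately show thesis using that[of es] by blast
qed

lemma proots_prod_linear: "proots (\<Prod>e\<leftarrow>es. [:- e, 1:]) = mset (es :: 'a :: idom list)"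
proof (induction es)
  case (Cons e es)
  have "(\<Prod>e\<leftarrow>es. [:- e, 1:]) \<noteq> 0" by (auto simp: prod_list_zero_iff)
  then have "proots ([:- e, 1:] * (\<Prod>e\<leftarrow>es. [:- e, 1:])) = proots [:- e, 1:] + proots (\<Prod>e\<leftarrow>es. [:- e, 1:])"
    by (intro proots_mult) simp
  then show ?case using Cons by (simp del: mult_pCons_left)
qed simp

lemma trace_similar:
  fixes P Q X :: "'a :: comm_ring_1 mat"
  assumes "P \<in> carrier_mat n n" "Q \<in> carrier_mat n n" "X \<in> carrier_mat n n" "Q * P = 1\<^sub>m n"
  shows "(\<Sum>i<n. (P * X * Q) $$ (i, i)) = (\<Sum>i<n. X $$ (i, i))"
proof -
  have comm: "(\<Sum>i<n. (Y * Z) $$ (i, i)) = (\<Sum>i<n. (Z * Y) $$ (i, i))"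
    if "Y \<in> carrier_mat n n" "Z \<in> carrier_mat n n" for Y Z :: "'a mat"
    using that by (simp add: scalar_prod_def) (subst sum.swap, simp add: mult.commute atLeast0LessThan)
  have "(\<Sum>i<n. (P * X * Q) $$ (i, i)) = (\<Sum>i<n. (P * (X * Q)) $$ (i, i))"
    using assms by (simp add: assoc_mult_mat[of P n n X n Q n])
  also have "\<dots> = (\<Sum>i<n. (X * Q * P) $$ (i, i))" using assms by (intro comm) auto
  also have "X * Q * P = X * (Q * P)" using assms by (intro assoc_mult_mat) auto
  finally show ?thesis using assms by simp
qed

lemma upper_triangular_pow:
  fixes T :: "'a :: comm_ring_1 mat"
  assumes T: "T \<in> carrier_mat n n" "upper_triangular T"
  shows "upper_triangular (T ^\<^sub>m k) \<and> (\<forall>i<n. (T ^\<^sub>m k) $$ (i, i) = (T $$ (i, i)) ^ k)"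
proof (induction k)
  case 0
  then show ?case using T by auto
next
  case (Suc k)
  let ?S = "T ^\<^sub>m k"
  have S: "?S \<in> carrier_mat n n" using T by simp
  have S0: "?S $$ (i, j) = 0" if "j < i" "i < n" for i j
    using Suc S that by (auto intro: upper_triangularD)
  have T0: "T $$ (i, j) = 0" if "j < i" "i < n" for i j
    using T that by (auto intro: upper_triangularD)
  have entry: "(?S * T) $$ (i, j) = (\<Sum>l = 0..<n. ?S $$ (i, l) * T $$ (l, j))" if "i < n" "j < n" for i j
    using that S T by (simp add: scalar_prod_def)
  have "(?S * T) $$ (i, j) = 0" if "j < i" "i < n" for i j
  proof -
    have "?S $$ (i, l) * T $$ (l, j) = 0" if "l < n" for l
      using S0[of l i] T0[of j l] that \<open>j < i\<close> \<open>i < n\<close> by (cases "l < i") auto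
    then show ?thesis using entry[of i j] that by simp
  qed
  moreover have "(?S * T) $$ (i, i) = (T $$ (i, i)) ^ Suc k" if i: "i < n" for i
  proof -
    have "?S $$ (i, l) * T $$ (l, i) = (if l = i then ?S $$ (i, i) * T $$ (i, i) else 0)" if "l < n" for l
      using S0[of l i] T0[of i l] that i by (cases l i rule: linorder_cases) auto
    then have "(?S * T) $$ (i, i) = (\<Sum>l = 0..<n. if l = i then ?S $$ (i, i) * T $$ (i, i) else 0)"
      unfolding entry[OF i i] by (intro sum.cong) auto
    then have "(?S * T) $$ (i, i) = ?S $$ (i, i) * T $$ (i, i)" using i by simp
    moreover have "?S $$ (i, i) = (T $$ (i, i)) ^ k" using Suc i by blast
    ultimately show ?thesis by (simp add: mult.commute)
  qed
  moreover have "dim_row (?S * T) = n" using carrier_matD(1)[OF T(1)] by simp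
  ultimately show ?case by (simp add: upper_triangular_def)
qed

text \<open>Traces of powers survive the passage to the upper triangular Schur form, where they can be read off
the diagonal.\<close>
lemma trace_pow_eq_sum_eigenvalues:
  fixes B :: "real mat"
  assumes B: "B \<in> carrier_mat n n" and es: "char_poly B = (\<Prod>e\<leftarrow>es. [:- e, 1:])" "length es = n"
  shows "(\<Sum>i<n. (B ^\<^sub>m k) $$ (i, i)) = (\<Sum>e\<leftarrow>es. e ^ k)"
proof -
  obtain T P Q where dec: "schur_decomposition B es = (T, P, Q)" by (cases "schur_decomposition B es")
  from schur_decomposition[OF B es(1) dec]
  have wit: "similar_mat_wit B T P Q" and T: "upper_triangular T" "diag_mat T = es" by auto
  note W = similar_mat_witD2[OF B wit]
  have Tk: "T ^\<^sub>m k \<in> carrier_mat n n" using W by simp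
  have "B ^\<^sub>m k = P * T ^\<^sub>m k * Q" by (rule similar_mat_wit_pow_id[OF wit])
  then have "(\<Sum>i<n. (B ^\<^sub>m k) $$ (i, i)) = (\<Sum>i<n. (T ^\<^sub>m k) $$ (i, i))"
    by (simp only:) (rule trace_similar, use W Tk in auto)
  also have "\<dots> = (\<Sum>i<n. (es ! i) ^ k)"
    using upper_triangular_pow[OF _ T(1), of n k] W T(2) by (auto simp: diag_mat_def intro!: sum.cong)
  also have "\<dots> = (\<Sum>e\<leftarrow>es. e ^ k)"
    using es(2) by (simp add: sum_list_sum_nth atLeast0LessThan)
  finally show ?thesis .
qed

lemma sum_singular_values_eq_trace:
  assumes A: "A \<in> carrier_mat p q"
  shows "(\<Sum>i<dim_col A. (singular_values A ! i) ^ (2 * k)) = (\<Sum>i<q. ((A\<^sup>T * A) ^\<^sub>m k) $$ (i, i))"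
proof -
  obtain es where es: "char_poly (A\<^sup>T * A) = (\<Prod>e\<leftarrow>es. [:- e, 1:])" "length es = q"
    and nn: "\<forall>e\<in>set es. 0 \<le> e"
    by (rule char_poly_gram[OF A])
  have roots: "proots (char_poly (A\<^sup>T * A)) = mset es"
    unfolding es(1) by (rule proots_prod_linear)
  let ?s = "singular_values A"
  have ms: "mset ?s = image_mset sqrt (mset es)"
    by (simp add: singular_values_def roots)
  then have len: "length ?s = q" using es(2) by (metis size_image_mset size_mset)
  have "(\<Sum>i<dim_col A. (?s ! i) ^ (2 * k)) = (\<Sum>x\<leftarrow>?s. x ^ (2 * k))"
    using A len by (simp add: sum_list_sum_nth atLeast0LessThan)
  also have "\<dots> = sum_mset (image_mset (\<lambda>x. x ^ (2 * k)) (mset ?s))"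
    by (simp flip: sum_mset_sum_list)
  also have "\<dots> = sum_mset (image_mset (\<lambda>e. e ^ k) (mset es))"
    unfolding ms image_mset.compositionality
    by (intro arg_cong[of _ _ sum_mset] image_mset_cong) (simp add: nn power_mult)
  also have "\<dots> = (\<Sum>e\<leftarrow>es. e ^ k)" by (simp flip: sum_mset_sum_list)
  also have "\<dots> = (\<Sum>i<q. ((A\<^sup>T * A) ^\<^sub>m k) $$ (i, i))"
    by (rule trace_pow_eq_sum_eigenvalues[symmetric]) (use A es in auto)
  finally show ?thesis .
qed

section \<open>Walks through the entries of a matrix\<close>

type_synonym site = "bool \<times> nat"

text \<open>The labels available at time \<open>t\<close>: columns at even and rows at odd times, in accordance with the
pairs \<open>(i_t, j_t)\<close> and \<open>(i_t, j_{t+1})\<close> of the definition of \<open>U_k\<close>. The tag keeps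
row and column labels apart, so that equality of labels never relates a row to a column.\<close>
definition sites :: "nat \<Rightarrow> nat \<Rightarrow> nat \<Rightarrow> site set" where
  "sites p q t = {odd t} \<times> {..<(if odd t then p else q)}"

text \<open>The entry read on the way between a row and a column, in either direction.\<close>
definition cell :: "site \<Rightarrow> site \<Rightarrow> nat \<times> nat" where
  "cell u v = (if fst u then (snd u, snd v) else (snd v, snd u))"

lemma finite_sites [simp]: "finite (sites p q t)"
  by (simp add: sites_def)

lemma sites_add_2 [simp]: "sites p q (Suc (Suc t)) = sites p q t"
  by (simp add: sites_def)

lemma sites_add_even: "even n \<Longrightarrow> sites p q (t + n) = sites p q t"
  by (simp add: sites_def)

lemma fst_sites: "u \<in> sites p q t \<Longrightarrow> fst u = odd t"
  by (auto simp: sites_def)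

lemma card_sites: "card (sites p q t) = (if odd t then p else q)"
  by (simp add: sites_def card_cartesian_product)

lemma sites_eq_or_disjoint: "sites p q s = sites p q t \<or> sites p q s \<inter> sites p q t = {}"
  by (cases "odd s \<longleftrightarrow> odd t") (auto simp: sites_def)

lemma cell_in_range: "u \<in> sites p q t \<Longrightarrow> v \<in> sites p q (Suc t) \<Longrightarrow> cell u v \<in> {..<p} \<times> {..<q}"
  by (auto simp: sites_def cell_def)

lemma cell_commute: "fst u \<noteq> fst v \<Longrightarrow> cell u v = cell v u"
  by (auto simp: cell_def)

text \<open>Through this equivalence the pattern of equal labels determines which steps read the same entry.\<close>
lemma cell_eq_iff:
  assumes "fst u \<noteq> fst v" "fst u' \<noteq> fst v'"
  shows "cell u v = cell u' v' \<longleftrightarrow> {u, v} = {u', v'}"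
  using assms by (cases u; cases v; cases u'; cases v') (auto simp: cell_def doubleton_eq_iff)

abbreviation entry_step :: "(nat \<times> nat \<Rightarrow> real) \<Rightarrow> nat \<Rightarrow> site \<Rightarrow> site \<Rightarrow> real" where
  "entry_step a \<equiv> \<lambda>_ u v. a (cell u v)"

abbreviation entry_path :: "nat \<Rightarrow> nat \<Rightarrow> (nat \<times> nat \<Rightarrow> real) \<Rightarrow> nat \<Rightarrow> nat \<Rightarrow> site \<Rightarrow> site \<Rightarrow> real" where
  "entry_path p q a \<equiv> path_kernel (sites p q) (entry_step a)"

lemma entry_path_shift: "even n \<Longrightarrow> entry_path p q a (t + n) l = entry_path p q a t l"
  by (rule path_kernel_shift) (auto simp: sites_add_even)

lemma entry_path_reverse:
  assumes "u \<in> sites p q t" "v \<in> sites p q (t + l)"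
  shows "entry_path p q a t l u v = entry_path p q a (t + l) l v u"
  using assms(2)
proof (induction l arbitrary: v)
  case 0
  then show ?case by auto
next
  case (Suc l)
  let ?S = "sites p q"
  let ?P = "entry_path p q a"
  have one: "?P (Suc (t + l)) 1 v z = a (cell v z)" if "z \<in> ?S (t + l)" for z
    using Suc.prems by (simp add: of_bool_def if_distrib[of "\<lambda>t. t * _"] cong: if_cong)
  have "?P t (Suc l) u v = (\<Sum>z\<in>?S (t + l). ?P t l u z * a (cell z v))" by simp
  also have "\<dots> = (\<Sum>z\<in>?S (t + l). ?P (Suc (t + l)) 1 v z * ?P (t + l) l z u)"
  proof (rule sum.cong[OF refl])
    fix z assume z: "z \<in> ?S (t + l)"
    have "fst z \<noteq> fst v" using fst_sites[OF z] fst_sites[OF Suc.prems] by simp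
    then show "?P t l u z * a (cell z v) = ?P (Suc (t + l)) 1 v z * ?P (t + l) l z u"
      using Suc.IH[OF z] one[OF z] by (simp add: cell_commute)
  qed
  also have "\<dots> = (\<Sum>z\<in>?S (Suc (t + l) + 1). ?P (Suc (t + l)) 1 v z * ?P (Suc (t + l) + 1) l z u)"
    using entry_path_shift[of 2 p q a "t + l" l] by simp
  also have "\<dots> = ?P (Suc (t + l)) (1 + l) v u"
  proof (rule path_kernel_append)
    have "?S (Suc (t + l) + 1 + l) = sites p q t" by (simp add: sites_def)
    then show "u \<in> ?S (Suc (t + l) + 1 + l)" using assms(1) by (simp only:)
  qed simp
  finally show ?case by simp
qed

text \<open>Cut a closed path of length \<open>2 k\<close> in the middle: by symmetry of the steps its second half is the
first half of a path run backwards.\<close>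
lemma sum_entry_path_squares:
  "(\<Sum>u\<in>sites p q 0. \<Sum>v\<in>sites p q k. (entry_path p q a 0 k u v)\<^sup>2)
     = (\<Sum>u\<in>sites p q 0. entry_path p q a 0 (2 * k) u u)"
proof (rule sum.cong[OF refl])
  fix u assume u: "u \<in> sites p q 0"
  let ?P = "entry_path p q a"
  have "(\<Sum>v\<in>sites p q k. (?P 0 k u v)\<^sup>2) = (\<Sum>v\<in>sites p q (0 + k). ?P 0 k u v * ?P (0 + k) k v u)"
    unfolding power2_eq_square
    by (rule sum.cong) (use entry_path_reverse[OF u, of _ k a] in auto)
  also have "\<dots> = ?P 0 (k + k) u u"
    by (rule path_kernel_append) (use u sites_add_even[of "k + k" p q 0] in auto)
  finally show "(\<Sum>v\<in>sites p q k. (?P 0 k u v)\<^sup>2) = ?P 0 (2 * k) u u" by (simp add: mult_2)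
qed

text \<open>The ratios of consecutive terms increase, so each of the first \<open>k\<close> ratios is at least
\<open>c 1 / c 0\<close>.\<close>
lemma log_convex_power_le:
  fixes c :: "nat \<Rightarrow> real"
  assumes nn: "\<And>m. 0 \<le> c m" and lc: "\<And>m. (c (Suc m))\<^sup>2 \<le> c m * c (Suc (Suc m))"
  shows "c 1 ^ k * c 0 \<le> c k * c 0 ^ k"
proof (cases "c 0 = 0")
  case True
  then have "c 1 = 0" using lc[of 0] by simp
  then show ?thesis using True by (cases k) auto
next
  case False
  then have c0: "0 < c 0" using nn[of 0] by simp
  have ratio: "c 1 * c m \<le> c (Suc m) * c 0" for m
  proof (induction m)
    case (Suc m)
    show ?case
    proof (cases "c m = 0")
      case True
      then have "c (Suc m) = 0" using lc[of m] by simp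
      then show ?thesis using nn[of "Suc (Suc m)"] c0 by simp
    next
      case False
      then have cm: "0 < c m" using nn[of m] by simp
      have "(c 1 * c (Suc m)) * c m \<le> c (Suc m) * (c (Suc m) * c 0)"
        using mult_left_mono[OF Suc nn[of "Suc m"]] by (simp add: mult_ac)
      also have "\<dots> \<le> (c (Suc (Suc m)) * c 0) * c m"
        using mult_right_mono[OF lc[of m] nn[of 0]] by (simp add: mult_ac power2_eq_square)
      finally show ?thesis using cm by simp
    qed
  qed simp
  show ?thesis
  proof (induction k)
    case (Suc k)
    have "c 1 ^ Suc k * c 0 \<le> c 1 * (c k * c 0 ^ k)"
      using mult_left_mono[OF Suc nn[of 1]] by (simp add: mult_ac)
    also have "\<dots> \<le> (c (Suc k) * c 0) * c 0 ^ k"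
      using mult_right_mono[OF ratio[of k], of "c 0 ^ k"] c0 by (simp add: mult_ac)
    finally show ?case by (simp add: mult_ac)
  qed simp
qed

text \<open>The operator norm is at most the Schatten norm. Instead of diagonalizing, follow a vector \<open>f\<close> under
the alternating action of \<open>A\<close> and its transpose. The squared norms of the iterates are log-convex,
and the \<open>k\<close>-th one is at most the squared Frobenius norm of the \<open>k\<close>-fold product, which is
\<open>\<sigma>^(2 k)\<close>, times that of \<open>f\<close>.\<close>
lemma entry_step_bounded:
  assumes k: "0 < k" and \<sigma>: "0 \<le> \<sigma>" "\<sigma> ^ (2 * k) = (\<Sum>u\<in>sites p q 0. entry_path p q a 0 (2 * k) u u)"
  shows "kernel_bounded (sites p q t) (sites p q (Suc t)) (\<lambda>u v. a (cell u v)) \<sigma>"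
proof -
  let ?S = "sites p q" and ?p = "entry_path p q a 0"
  have base: "kernel_bounded (?S 0) (?S 1) (\<lambda>u v. a (cell u v)) \<sigma>"
    unfolding kernel_bounded_def
  proof (intro conjI allI \<sigma>(1))
    fix f :: "site \<Rightarrow> real"
    define w where "w m y = (\<Sum>x\<in>?S 0. ?p m x y * f x)" for m y
    define c where "c m = (\<Sum>y\<in>?S m. (w m y)\<^sup>2)" for m
    have wS: "w (Suc m) y = (\<Sum>z\<in>?S m. w m z * a (cell z y))" for m y
      unfolding w_def by (simp add: sum_distrib_left sum_distrib_right mult_ac) (rule sum.swap)
    have w0: "w 0 y = f y" if "y \<in> ?S 0" for y
      using that by (simp add: w_def of_bool_def if_distrib[of "\<lambda>t. t * _"] cong: if_cong)
    have nn: "0 \<le> c m" for m by (simp add: c_def sum_nonneg)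
    have lc: "(c (Suc m))\<^sup>2 \<le> c m * c (Suc (Suc m))" for m
    proof -
      have "c (Suc m) = (\<Sum>y\<in>?S (Suc m). \<Sum>z\<in>?S m. w (Suc m) y * (w m z * a (cell z y)))"
        unfolding c_def power2_eq_square sum_distrib_left[symmetric] wS[symmetric] ..
      also have "\<dots> = (\<Sum>z\<in>?S m. \<Sum>y\<in>?S (Suc m). w (Suc m) y * (w m z * a (cell z y)))"
        by (rule sum.swap)
      also have "\<dots> = (\<Sum>z\<in>?S m. w m z * w (Suc (Suc m)) z)"
      proof (rule sum.cong[OF refl])
        fix z assume z: "z \<in> ?S m"
        have "a (cell y z) = a (cell z y)" if "y \<in> ?S (Suc m)" for y
          using fst_sites[OF z] fst_sites[OF that] by (subst cell_commute) auto
        then have "w (Suc (Suc m)) z = (\<Sum>y\<in>?S (Suc m). w (Suc m) y * a (cell z y))"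
          unfolding wS[of "Suc m"] by (intro sum.cong) auto
        then show "(\<Sum>y\<in>?S (Suc m). w (Suc m) y * (w m z * a (cell z y))) = w m z * w (Suc (Suc m)) z"
          by (simp add: sum_distrib_left mult_ac)
      qed
      also have "(\<dots>)\<^sup>2 \<le> c m * c (Suc (Suc m))"
        unfolding c_def sites_add_2 by (rule Cauchy_Schwarz_ineq_sum)
      finally show ?thesis .
    qed
    have ck: "c k \<le> \<sigma> ^ (2 * k) * c 0"
    proof -
      have "c k \<le> (\<Sum>y\<in>?S k. (\<Sum>x\<in>?S 0. (?p k x y)\<^sup>2) * (\<Sum>x\<in>?S 0. (f x)\<^sup>2))"
        unfolding c_def w_def by (intro sum_mono Cauchy_Schwarz_ineq_sum)
      also have "\<dots> = (\<Sum>x\<in>?S 0. \<Sum>y\<in>?S k. (?p k x y)\<^sup>2) * (\<Sum>x\<in>?S 0. (f x)\<^sup>2)"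
        by (subst sum.swap) (simp add: sum_distrib_right)
      finally show ?thesis unfolding \<sigma>(2) sum_entry_path_squares by (simp add: c_def w0)
    qed
    have "c 1 \<le> \<sigma>\<^sup>2 * c 0"
    proof (cases "c 0 = 0")
      case True
      then show ?thesis using lc[of 0] by simp
    next
      case False
      then have c0: "0 < c 0" using nn[of 0] by simp
      have "c 1 ^ k * c 0 \<le> c k * c 0 ^ k" by (rule log_convex_power_le[where c = c, OF nn lc])
      also have "\<dots> \<le> (\<sigma> ^ (2 * k) * c 0) * c 0 ^ k" using c0 by (intro mult_right_mono ck) simp
      finally have "c 1 ^ k \<le> (\<sigma>\<^sup>2 * c 0) ^ k"
        using c0 by (simp add: power_mult power_mult_distrib)
      moreover obtain k' where "k = Suc k'" using k by (cases k) auto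
      ultimately show ?thesis using power_le_imp_le_base[of "c 1" k' "\<sigma>\<^sup>2 * c 0"] c0 by simp
    qed
    moreover have "w 1 y = (\<Sum>x\<in>?S 0. a (cell x y) * f x)" for y
      using wS[of 0 y] by (simp add: w0 mult.commute)
    ultimately show "(\<Sum>y\<in>?S 1. (\<Sum>x\<in>?S 0. a (cell x y) * f x)\<^sup>2)
        \<le> \<sigma>\<^sup>2 * (\<Sum>x\<in>?S 0. (f x)\<^sup>2)"
      by (simp add: c_def w0)
  qed
  show ?thesis
  proof (cases "even t")
    case True
    then have "?S t = ?S 0" "?S (Suc t) = ?S 1" by (auto simp: sites_def)
    then show ?thesis using base by simp
  next
    case False
    then have eq: "?S t = ?S 1" "?S (Suc t) = ?S 0" by (auto simp: sites_def)
    have "kernel_bounded (?S 1) (?S 0) (\<lambda>u v. a (cell u v)) \<sigma>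
        \<longleftrightarrow> kernel_bounded (?S 1) (?S 0) (\<lambda>u v. a (cell v u)) \<sigma>"
      by (rule kernel_bounded_cong, subst cell_commute) (auto dest!: fst_sites)
    then show ?thesis unfolding eq using kernel_bounded_transpose[OF base] by simp
  qed
qed

lemma entry_path_eq_gram_power:
  assumes A: "A \<in> carrier_mat p q" and j: "j < q" "j' < q"
  shows "entry_path p q (($$) A) 0 (2 * k) (False, j) (False, j') = ((A\<^sup>T * A) ^\<^sub>m k) $$ (j, j')"
  using j(2)
proof (induction k arbitrary: j')
  case 0
  then show ?case using A j(1) by simp
next
  case (Suc k)
  let ?B = "A\<^sup>T * A"
  let ?P = "entry_path p q (($$) A) 0"
  have B: "?B \<in> carrier_mat q q" using A by simp
  have col: "sum F (sites p q (2 * k)) = (\<Sum>l<q. F (False, l))" for F :: "site \<Rightarrow> real"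
  proof -
    have "sites p q (2 * k) = Pair False ` {..<q}" by (auto simp: sites_def)
    then show ?thesis by (simp add: sum.reindex inj_on_def)
  qed
  have row: "sum F (sites p q (Suc (2 * k))) = (\<Sum>l<p. F (True, l))" for F :: "site \<Rightarrow> real"
  proof -
    have "sites p q (Suc (2 * k)) = Pair True ` {..<p}" by (auto simp: sites_def)
    then show ?thesis by (simp add: sum.reindex inj_on_def)
  qed
  have "?P (2 * Suc k) (False, j) (False, j')
      = (\<Sum>i<p. (\<Sum>l<q. ?P (2 * k) (False, j) (False, l) * A $$ (i, l)) * A $$ (i, j'))"
    by (simp add: col row cell_def)
  also have "\<dots> = (\<Sum>i<p. \<Sum>l<q. (?B ^\<^sub>m k) $$ (j, l) * (A $$ (i, l) * A $$ (i, j')))"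
    by (simp add: Suc.IH sum_distrib_right mult.assoc)
  also have "\<dots> = (\<Sum>l<q. (?B ^\<^sub>m k) $$ (j, l) * (\<Sum>i<p. A $$ (i, l) * A $$ (i, j')))"
    unfolding sum_distrib_left by (rule sum.swap)
  also have "\<dots> = (\<Sum>l<q. (?B ^\<^sub>m k) $$ (j, l) * ?B $$ (l, j'))"
    using A Suc.prems by (intro sum.cong) (auto simp: scalar_prod_def atLeast0LessThan)
  also have "\<dots> = (?B ^\<^sub>m Suc k) $$ (j, j')"
  proof -
    have "?B ^\<^sub>m k \<in> carrier_mat q q" using B by simp
    then have "(?B ^\<^sub>m k * ?B) $$ (j, j') = (\<Sum>l = 0..<q. (?B ^\<^sub>m k) $$ (j, l) * ?B $$ (l, j'))"
      using B j(1) Suc.prems by (subst index_mult_mat) (auto simp: scalar_prod_def simp del: index_mult_mat)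
    then show ?thesis by (simp add: atLeast0LessThan)
  qed
  finally show ?case .
qed

lemma schatten_norm_power:
  assumes A: "A \<in> carrier_mat p q" and k: "0 < k"
  shows "0 \<le> schatten_norm (2 * k) A"
    "schatten_norm (2 * k) A ^ (2 * k) = (\<Sum>u\<in>sites p q 0. entry_path p q (($$) A) 0 (2 * k) u u)"
proof -
  let ?S = "\<Sum>u\<in>sites p q 0. entry_path p q (($$) A) 0 (2 * k) u u"
  have "sites p q 0 = Pair False ` {..<q}" by (auto simp: sites_def)
  then have "?S = (\<Sum>j<q. ((A\<^sup>T * A) ^\<^sub>m k) $$ (j, j))"
    by (simp add: sum.reindex inj_on_def entry_path_eq_gram_power[OF A])
  also have "\<dots> = (\<Sum>i<dim_col A. (singular_values A ! i) ^ (2 * k))"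
    by (rule sum_singular_values_eq_trace[OF A, symmetric])
  finally have S: "schatten_norm (2 * k) A = ?S powr (1 / real (2 * k))"
    by (simp add: schatten_norm_def)
  have S0: "0 \<le> ?S" unfolding sum_entry_path_squares[symmetric] by (simp add: sum_nonneg)
  show "0 \<le> schatten_norm (2 * k) A" unfolding S by simp
  show "schatten_norm (2 * k) A ^ (2 * k) = ?S"
  proof (cases "?S = 0")
    case True
    then show ?thesis using k unfolding S by simp
  next
    case False
    then have "0 < ?S powr (1 / real (2 * k))" using S0 by simp
    then have "schatten_norm (2 * k) A ^ (2 * k) = (?S powr (1 / real (2 * k))) powr real (2 * k)"
      unfolding S by (rule powr_realpow[symmetric])
    also have "\<dots> = ?S" using S0 k by (simp add: powr_powr)
    finally show ?thesis .
  qed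
qed

text \<open>The step at the even time \<open>2 t\<close> reads the pair \<open>(i_t, j_t)\<close>, the step at the odd time \<open>2 t + 1\<close> the
pair \<open>(i_t, j_{t+1})\<close>.\<close>
lemma pair_count_eq_card_cells:
  fixes k :: nat
  assumes k: "0 < k"
    and z: "\<And>t. t < k \<Longrightarrow> z (2 * t) = (False, j t)" "\<And>t. t < k \<Longrightarrow> z (Suc (2 * t)) = (True, i t)"
  shows "pair_count k i j r s = card {m\<in>{..<2 * k}. cell (z m) (z (Suc m mod (2 * k))) = (r, s)}"
proof -
  let ?X = "{t. t < k \<and> i t = r \<and> j t = s}"
  let ?Y = "{t. t < k \<and> i t = r \<and> j (Suc t mod k) = s}"
  have ev: "cell (z (2 * t)) (z (Suc (2 * t) mod (2 * k))) = (i t, j t)" if "t < k" for t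
    using that z by (simp add: cell_def)
  have od: "cell (z (Suc (2 * t))) (z (Suc (Suc (2 * t)) mod (2 * k))) = (i t, j (Suc t mod k))" if "t < k" for t
  proof -
    have "Suc (Suc (2 * t)) mod (2 * k) = 2 * (Suc t mod k)"
      using mult_mod_right[of 2 "Suc t" k] by simp
    then show ?thesis using that z k by (simp add: cell_def)
  qed
  have "{m\<in>{..<2 * k}. cell (z m) (z (Suc m mod (2 * k))) = (r, s)}
      = (\<lambda>t. 2 * t) ` ?X \<union> (\<lambda>t. Suc (2 * t)) ` ?Y" (is "?M = _")
  proof (intro equalityI subsetI)
    fix m assume m: "m \<in> ?M"
    show "m \<in> (\<lambda>t. 2 * t) ` ?X \<union> (\<lambda>t. Suc (2 * t)) ` ?Y"
    proof (cases "even m")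
      case True
      then obtain t where "m = 2 * t" by (elim evenE)
      then show ?thesis using m ev[of t] by auto
    next
      case False
      then obtain t where t: "m = Suc (2 * t)" by (elim oddE) simp
      then have "t < k" using m by auto
      then show ?thesis using m od[of t] t by auto
    qed
  qed (use ev od in auto)
  then have "card ?M = card ((\<lambda>t. 2 * t) ` ?X \<union> (\<lambda>t. Suc (2 * t)) ` ?Y)" by (simp only:)
  also have "\<dots> = card ((\<lambda>t. 2 * t) ` ?X) + card ((\<lambda>t. Suc (2 * t)) ` ?Y)"
  proof (rule card_Un_disjoint)
    show "(\<lambda>t. 2 * t) ` ?X \<inter> (\<lambda>t. Suc (2 * t)) ` ?Y = {}" by (auto, presburger)
  qed auto
  also have "\<dots> = card ?X + card ?Y"
    by (subst (1 2) card_image) (auto simp: inj_on_def)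
  finally show ?thesis by (simp add: pair_count_def)
qed

lemma U_stat_eq_sum_walks:
  assumes Y: "Y \<in> carrier_mat p q" and k: "0 < k"
  shows "U_stat k Y = (\<Sum>z\<in>PiE {..<2 * k} (sites p q). \<Prod>e\<in>{..<p} \<times> {..<q}.
     hermite (card {m\<in>{..<2 * k}. cell (z m) (z (Suc m mod (2 * k))) = e}) (Y $$ e))"
proof -
  let ?h = "\<lambda>z. (\<lambda>t\<in>{..<k}. snd (z (Suc (2 * t))), \<lambda>t\<in>{..<k}. snd (z (2 * t)))"
  let ?I = "{..<k} \<rightarrow>\<^sub>E {..<p}" and ?J = "{..<k} \<rightarrow>\<^sub>E {..<q}"
  let ?W = "PiE {..<2 * k} (sites p q)"
  \<comment> \<open>Interleave: the column \<open>j t\<close> at time \<open>2 t\<close>, the row \<open>i t\<close> at time \<open>2 t + 1\<close>.\<close>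
  define f :: "(nat \<Rightarrow> nat) \<times> (nat \<Rightarrow> nat) \<Rightarrow> nat \<Rightarrow> site" where
    "f = (\<lambda>(i, j). \<lambda>m\<in>{..<2 * k}. (odd m, (if odd m then i else j) (m div 2)))"
  have f_even: "f (i, j) (2 * t) = (False, j t)" if "t < k" for i j t using that by (simp add: f_def)
  have f_odd: "f (i, j) (Suc (2 * t)) = (True, i t)" if "t < k" for i j t using that by (simp add: f_def)
  have bij: "bij_betw f (?I \<times> ?J) ?W"
  proof (rule bij_betw_byWitness[where f' = ?h])
    show "\<forall>ij\<in>?I \<times> ?J. (\<lambda>t\<in>{..<k}. snd (f ij (Suc (2 * t))), \<lambda>t\<in>{..<k}. snd (f ij (2 * t))) = ij"
      using f_even f_odd by (auto simp: fun_eq_iff PiE_iff extensional_def)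
    show "\<forall>z\<in>?W. f (?h z) = z"
    proof
      fix z assume z: "z \<in> ?W"
      show "f (?h z) = z"
      proof
        fix m
        show "f (?h z) m = z m"
        proof (cases "m < 2 * k")
          case True
          then have "m div 2 < k" by simp
          moreover have "fst (z m) = odd m" using z True fst_sites[of "z m" p q m] by auto
          moreover have "2 * (m div 2) = m" if "even m" using that by simp
          moreover have "Suc (2 * (m div 2)) = m" if "odd m" using that by simp
          ultimately show ?thesis using True by (auto simp: f_def prod_eq_iff)
        qed (use z in \<open>auto simp: f_def PiE_iff extensional_def\<close>)
      qed
    qed
    show "f ` (?I \<times> ?J) \<subseteq> ?W"
    proof (rule image_subsetI, clarify, rule PiE_I)
      fix i j m assume ij: "i \<in> ?I" "j \<in> ?J" and m: "m \<in> {..<2 * k}"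
      then have "m div 2 < k" by auto
      then have "i (m div 2) < p" "j (m div 2) < q" using ij by auto
      then show "f (i, j) m \<in> sites p q m" using m by (auto simp: f_def sites_def)
    qed (auto simp: f_def)
    show "?h ` ?W \<subseteq> ?I \<times> ?J"
    proof (rule image_subsetI, rule SigmaI)
      fix z assume z: "z \<in> ?W"
      have "z (Suc (2 * t)) \<in> sites p q (Suc (2 * t))" "z (2 * t) \<in> sites p q (2 * t)" if "t < k" for t
        using that by (auto intro!: PiE_mem[OF z])
      then show "(\<lambda>t\<in>{..<k}. snd (z (Suc (2 * t)))) \<in> ?I" "(\<lambda>t\<in>{..<k}. snd (z (2 * t))) \<in> ?J"
        by (auto simp: sites_def mem_Times_iff)
    qed
  qed
  let ?F = "\<lambda>z. \<Prod>e\<in>{..<p} \<times> {..<q}. hermite (card {m\<in>{..<2 * k}. cell (z m) (z (Suc m mod (2 * k))) = e}) (Y $$ e)"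
  have "U_stat k Y = (\<Sum>ij\<in>?I \<times> ?J. ?F (f ij))"
  proof -
    have "(\<Prod>r<p. \<Prod>s<q. hermite (pair_count k i j r s) (Y $$ (r, s))) = ?F (f (i, j))" for i j
      unfolding prod.cartesian_product
      by (rule prod.cong[OF refl]) (auto simp: pair_count_eq_card_cells[where z = "f (i, j)" and i = i and j = j, OF k f_even f_odd])
    then show ?thesis
      using Y unfolding U_stat_def by (simp add: sum.cartesian_product case_prod_unfold)
  qed
  also have "\<dots> = (\<Sum>z\<in>?W. ?F z)" by (rule sum.reindex_bij_betw[OF bij])
  finally show ?thesis .
qed

section \<open>The second moment of one part of the expansion\<close>

text \<open>A pair of labellings of \<open>S\<close> is one labelling of two disjoint copies of \<open>S\<close>.\<close>
lemma sum_PiE_pair: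
  "(\<Sum>g\<in>PiE S L. \<Sum>g'\<in>PiE S L. F g g')
    = (\<Sum>G\<in>PiE (UNIV \<times> S) (\<lambda>(c, h). L h). F (\<lambda>h. G (False, h)) (\<lambda>h. G (True, h)))"
proof -
  let ?g = "\<lambda>(g, g'). \<lambda>(c, h). if c then g' h else g h" and ?X = "PiE (UNIV \<times> S) (\<lambda>(c, h). L h)"
  let ?f = "\<lambda>G. (\<lambda>h. G (False, h), \<lambda>h. G (True, h))"
  have "bij_betw ?f ?X (PiE S L \<times> PiE S L)"
  proof (rule bij_betw_byWitness[where f' = "?g"])
    show "\<forall>a\<in>?X. ?g (?f a) = a"
      by (auto simp: fun_eq_iff)
    show "\<forall>a'\<in>PiE S L \<times> PiE S L. ?f (?g a') = a'"
      by auto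
    show "?f ` ?X \<subseteq> PiE S L \<times> PiE S L"
      by (auto simp: PiE_iff extensional_def)
    show "?g ` (PiE S L \<times> PiE S L) \<subseteq> ?X"
      by (auto simp: PiE_iff extensional_def split: if_splits)
  qed
  from sum.reindex_bij_betw[OF this, of "\<lambda>(g, g'). F g g'"]
  show ?thesis by (simp add: sum.cartesian_product)
qed

text \<open>The right-hand side refers to \<open>\<kappa>\<close> only through the partition of \<open>I\<close> into its fibres, whatever the
values of \<open>\<kappa>\<close> are.\<close>
lemma prod_fibres:
  fixes f :: "'i set \<Rightarrow> real"
  assumes "finite I" "finite E" "\<kappa> ` I \<subseteq> E" "f {} = 1"
  shows "(\<Prod>e\<in>E. f {i\<in>I. \<kappa> i = e}) = (\<Prod>P\<in>(\<lambda>i. {j\<in>I. \<kappa> j = \<kappa> i}) ` I. f P)"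
proof -
  let ?P = "\<lambda>e. {i\<in>I. \<kappa> i = e}"
  have "(\<Prod>e\<in>E. f (?P e)) = (\<Prod>e\<in>\<kappa> ` I. f (?P e))"
  proof (rule prod.mono_neutral_right)
    show "\<forall>e\<in>E - \<kappa> ` I. f (?P e) = 1"
    proof
      fix e assume "e \<in> E - \<kappa> ` I"
      then have "?P e = {}" by auto
      then show "f (?P e) = 1" using assms(4) by (simp only:)
    qed
  qed (use assms in auto)
  also have "\<dots> = (\<Prod>P\<in>?P ` \<kappa> ` I. f P)"
    by (subst prod.reindex) (auto simp: inj_on_def)
  also have "?P ` \<kappa> ` I = (\<lambda>i. {j\<in>I. \<kappa> j = \<kappa> i}) ` I" by (simp add: image_image)
  finally show ?thesis .
qed

text \<open>The copy of the walk, the time of a marked step, and the end of that step.\<close>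
type_synonym half = "bool \<times> nat \<times> bool"

definition step_cell :: "(half \<Rightarrow> site) \<Rightarrow> bool \<times> nat \<Rightarrow> nat \<times> nat" where
  "step_cell G i = cell (G (fst i, snd i, False)) (G (fst i, snd i, True))"

definition labelings :: "nat \<Rightarrow> nat \<Rightarrow> nat set \<Rightarrow> (half \<Rightarrow> site) set" where
  "labelings p q B = PiE (UNIV \<times> B \<times> UNIV) (\<lambda>(c, h). half_labels (sites p q) h)"

lemma labelings_sites:
  assumes "G \<in> labelings p q B" "t \<in> B"
  shows "G (c, t, e) \<in> sites p q (if e then Suc t else t)"
proof -
  have "(c, t, e) \<in> UNIV \<times> B \<times> UNIV" using assms(2) by simp
  from PiE_mem[OF assms(1)[unfolded labelings_def] this] show ?thesis by (simp add: half_labels_def)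
qed

lemma labelings_fst:
  assumes "G \<in> labelings p q B" "t \<in> B"
  shows "fst (G (c, t, e)) = (odd t \<noteq> e)"
  using fst_sites[OF labelings_sites[OF assms, of c e]] by (cases e) auto

lemma step_cell_in_range:
  assumes "G \<in> labelings p q B" "i \<in> UNIV \<times> B"
  shows "step_cell G i \<in> {..<p} \<times> {..<q}"
  unfolding step_cell_def
  using labelings_sites[OF assms(1), of "snd i" "fst i" False] labelings_sites[OF assms(1), of "snd i" "fst i" True]
    assms(2) by (intro cell_in_range[where t = "snd i"]) auto

lemma step_cell_eq_iff:
  assumes "G \<in> labelings p q B" "i \<in> UNIV \<times> B" "j \<in> UNIV \<times> B"
  shows "step_cell G i = step_cell G j \<longleftrightarrow>
    {G (fst i, snd i, False), G (fst i, snd i, True)} = {G (fst j, snd j, False), G (fst j, snd j, True)}"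
  unfolding step_cell_def
  by (rule cell_eq_iff) (use assms labelings_fst[OF assms(1)] in auto)

text \<open>The contribution of the walks that read the noise \<open>\<omega>\<close> exactly at the steps in \<open>B\<close> and the matrix
entries \<open>a\<close> elsewhere.\<close>
definition chaos_part :: "nat \<Rightarrow> nat \<Rightarrow> (nat \<times> nat \<Rightarrow> real) \<Rightarrow> nat \<Rightarrow> nat set \<Rightarrow> (nat \<times> nat \<Rightarrow> real) \<Rightarrow> real" where
  "chaos_part p q a n B \<omega> = (\<Sum>z\<in>PiE {..<n} (sites p q).
     (\<Prod>t\<in>{..<n} - B. a (cell (z t) (z (Suc t mod n)))) *
     (\<Prod>e\<in>{..<p} \<times> {..<q}. hermite (card {t\<in>B. cell (z t) (z (Suc t mod n)) = e}) (\<omega> e)))"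

context standardized_law
begin

text \<open>All steps of a block read the same entry of the noise, with one Hermite polynomial for each copy of
the walk.\<close>
definition block_moment :: "(bool \<times> nat) set \<Rightarrow> real" where
  "block_moment P = hermite_moment (card {t. (False, t) \<in> P}) (card {t. (True, t) \<in> P})"

text \<open>The expectation of the product of both copies' Hermite factors when the marked steps carry the
labels \<open>G\<close>; entries that no step reads contribute the factor 1.\<close>
definition pattern_moment :: "nat \<Rightarrow> nat \<Rightarrow> nat set \<Rightarrow> (half \<Rightarrow> site) \<Rightarrow> real" where
  "pattern_moment p q B G = (\<Prod>e\<in>{..<p} \<times> {..<q}. block_moment {i\<in>UNIV \<times> B. step_cell G i = e})"

text \<open>One or two steps of the same copy, with none of the other copy, would contribute the expectation of
\<open>H_1\<close> or \<open>H_2\<close>, which is zero. So besides a given step and any second step of the same copy, the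
block contains a further step.\<close>
lemma block_moment_nonzero:
  assumes "block_moment P \<noteq> 0" "(c, t) \<in> P"
  shows "\<exists>j\<in>P. j \<noteq> (c, t) \<and> j \<noteq> (c, t')"
proof (rule ccontr)
  assume "\<not> ?thesis"
  then have P: "P \<subseteq> {(c, t), (c, t')}" by auto
  have other: "{s. (\<not> c, s) \<in> P} = {}" using P by auto
  have "{s. (c, s) \<in> P} = {t} \<or> {s. (c, s) \<in> P} = {t, t'}" using P assms(2) by auto
  then have "card {s. (c, s) \<in> P} = Suc 0 \<or> card {s. (c, s) \<in> P} = 2"
    by (cases "t = t'") auto
  then have "block_moment P = 0"
    using other by (cases c) (auto simp: block_moment_def hermite_moment_vanishes)
  then show False using assms(1) by simp
qed

lemma pattern_moment_cong:
  assumes B: "finite B" and G: "G \<in> labelings p q B" "G' \<in> labelings p q B"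
    and same: "\<And>h h'. h \<in> UNIV \<times> B \<times> UNIV \<Longrightarrow> h' \<in> UNIV \<times> B \<times> UNIV \<Longrightarrow> G h = G h' \<longleftrightarrow> G' h = G' h'"
  shows "pattern_moment p q B G = pattern_moment p q B G'"
proof -
  have b0: "block_moment {} = 1" by (simp add: block_moment_def)
  let ?I = "UNIV \<times> B :: (bool \<times> nat) set"
  have blocks: "pattern_moment p q B H = (\<Prod>P\<in>(\<lambda>i. {j\<in>?I. step_cell H j = step_cell H i}) ` ?I. block_moment P)"
    if "H \<in> labelings p q B" for H
    unfolding pattern_moment_def
  proof (rule prod_fibres)
    show "step_cell H ` ?I \<subseteq> {..<p} \<times> {..<q}"
      by (rule image_subsetI) (rule step_cell_in_range[OF that])
  qed (use B b0 in auto)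
  have "(\<lambda>i. {j\<in>?I. step_cell G j = step_cell G i}) ` ?I = (\<lambda>i. {j\<in>?I. step_cell G' j = step_cell G' i}) ` ?I"
  proof (rule image_cong[OF refl])
    fix i assume i: "i \<in> ?I"
    have "step_cell G j = step_cell G i \<longleftrightarrow> step_cell G' j = step_cell G' i" if j: "j \<in> ?I" for j
      unfolding step_cell_eq_iff[OF G(1) j i] step_cell_eq_iff[OF G(2) j i] doubleton_eq_iff
      using i j by (subst (1 2 3 4) same) auto
    then show "{j\<in>?I. step_cell G j = step_cell G i} = {j\<in>?I. step_cell G' j = step_cell G' i}" by blast
  qed
  then show ?thesis unfolding blocks[OF G(1)] blocks[OF G(2)] by simp
qed

lemma sum_card_fibres:
  assumes "finite B" "finite E" "\<kappa> ` B \<subseteq> E"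
  shows "(\<Sum>e\<in>E. card {t\<in>B. \<kappa> t = e}) = card B"
  using sum.group[OF assms, of "\<lambda>_. 1 :: nat"] by simp

lemma abs_pattern_moment_le:
  assumes t: "psi2_admissible \<mu> t" and D: "1 \<le> D" "2 * real (card B) \<le> D"
    and B: "finite B" and G: "G \<in> labelings p q B"
  shows "\<bar>pattern_moment p q B G\<bar> \<le> (3 * (t * D)) ^ (2 * card B)"
proof -
  let ?E = "{..<p} \<times> {..<q}"
  have t1: "1 \<le> t" by (rule psi2_admissible_ge_1[OF t])
  have tD: "1 \<le> t * D" using mult_mono[OF t1 D(1)] t1 by simp
  let ?N = "\<lambda>c e. card {s\<in>B. step_cell G (c, s) = e}"
  have N: "?N c e \<le> card B" for c e using B by (intro card_mono) auto
  have bm: "block_moment {i\<in>UNIV \<times> B. step_cell G i = e} = hermite_moment (?N False e) (?N True e)" for e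
    by (simp add: block_moment_def)
  have one: "\<bar>block_moment {i\<in>UNIV \<times> B. step_cell G i = e}\<bar> \<le> (3 * (t * D)) ^ (?N False e + ?N True e)" for e
  proof (cases "?N False e + ?N True e = 0")
    case True
    then show ?thesis unfolding bm by simp
  next
    case False
    then obtain m where m: "?N False e + ?N True e = Suc m" using not0_implies_Suc by blast
    have "real (?N False e + ?N True e) \<le> D" using N[of False e] N[of True e] D(2) by linarith
    from abs_hermite_moment_le[OF t D(1) this]
    have "\<bar>block_moment {i\<in>UNIV \<times> B. step_cell G i = e}\<bar> \<le> 3 * (t * D) ^ Suc m" unfolding bm m .
    also have "\<dots> \<le> 3 ^ Suc m * (t * D) ^ Suc m" using tD by (intro mult_right_mono) auto
    finally show ?thesis unfolding m power_mult_distrib .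
  qed
  have "\<bar>pattern_moment p q B G\<bar> \<le> (\<Prod>e\<in>?E. (3 * (t * D)) ^ (?N False e + ?N True e))"
    unfolding pattern_moment_def by (rule abs_prod_le_prod) (rule one)
  also have "\<dots> = (3 * (t * D)) ^ (\<Sum>e\<in>?E. ?N False e + ?N True e)" by (rule power_sum[symmetric])
  also have "(\<Sum>e\<in>?E. ?N False e + ?N True e) = 2 * card B"
  proof -
    have "(\<Sum>e\<in>?E. ?N c e) = card B" for c
    proof (rule sum_card_fibres[OF B])
      show "(\<lambda>s. step_cell G (c, s)) ` B \<subseteq> ?E"
        by (rule image_subsetI, rule step_cell_in_range[OF G]) simp
    qed simp
    then show ?thesis by (simp only: sum.distrib)
  qed
  finally show ?thesis .
qed

text \<open>Two steps that read the same entry have the same pair of labels at their ends, so a further step in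
the block of a half's own step yields a further half with the same label.\<close>
lemma pattern_moment_nonzeroD:
  assumes B: "finite B" and G: "G \<in> labelings p q B" and nz: "pattern_moment p q B G \<noteq> 0"
    and t: "t \<in> B"
  obtains c' t' e' where "t' \<in> B" "(c', t') \<noteq> (c, t)" "(c', t') \<noteq> (c, s)" "G (c', t', e') = G (c, t, e)"
proof -
  let ?P = "{i\<in>UNIV \<times> B. step_cell G i = step_cell G (c, t)}"
  have ct: "(c, t) \<in> UNIV \<times> B" using t by simp
  have "block_moment ?P \<noteq> 0"
    using nz step_cell_in_range[OF G ct] unfolding pattern_moment_def by (auto simp: prod_zero_iff)
  from block_moment_nonzero[OF this, of c t s] t
  obtain c' t' where j: "(c', t') \<in> ?P" "(c', t') \<noteq> (c, t)" "(c', t') \<noteq> (c, s)" by auto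
  then have j': "(c', t') \<in> UNIV \<times> B" "step_cell G (c', t') = step_cell G (c, t)" by auto
  have "{G (c', t', False), G (c', t', True)} = {G (c, t, False), G (c, t, True)}"
    using step_cell_eq_iff[OF G j'(1) ct] j'(2) by simp
  then obtain e' where "G (c', t', e') = G (c, t, e)"
    by (cases e) (auto simp: doubleton_eq_iff)
  then show thesis using that j j' by blast
qed

lemma pattern_moment_two:
  assumes B: "finite B" and G: "G \<in> labelings p q B" and nz: "pattern_moment p q B G \<noteq> 0"
    and h: "h \<in> UNIV \<times> B \<times> UNIV"
  shows "2 \<le> card {h'\<in>UNIV \<times> B \<times> UNIV. G h' = G h}"
proof -
  obtain c t e where h': "h = (c, t, e)" "t \<in> B" using h by auto
  obtain c' t' e' where *: "t' \<in> B" "(c', t') \<noteq> (c, t)" "G (c', t', e') = G (c, t, e)"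
    using pattern_moment_nonzeroD[OF B G nz h'(2)] by metis
  have "card {(c, t, e), (c', t', e')} \<le> card {h'\<in>UNIV \<times> B \<times> UNIV. G h' = G h}"
    using * h' B by (intro card_mono) auto
  then show ?thesis using * by auto
qed

text \<open>The gaps pair every half with another one of the same copy, and a closed class contains the
partners of its members. Given a half and its partner, there is a third half in the class that
belongs to neither of their two steps; together with the partner of the third these are four.\<close>
lemma pattern_moment_four:
  assumes B: "finite B" and G: "G \<in> labelings p q B" and nz: "pattern_moment p q B G \<noteq> 0"
    and h: "h \<in> UNIV \<times> B \<times> UNIV" and next_mark: "bij_betw next_mark B B"
    and closed: "\<And>c t. t \<in> B \<Longrightarrow> G (c, t, True) = G h \<longleftrightarrow> G (c, next_mark t, False) = G h"
  shows "4 \<le> card {h'\<in>UNIV \<times> B \<times> UNIV. G h' = G h}"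
proof -
  let ?H = "UNIV \<times> B \<times> UNIV :: half set"
  let ?C = "{h'\<in>?H. G h' = G h}"
  define prv where "prv = inv_into B next_mark"
  \<comment> \<open>The half at the other end of the adjacent gap.\<close>
  define \<tau> :: "half \<Rightarrow> half" where
    "\<tau> = (\<lambda>(c, t, e). if e then (c, next_mark t, False) else (c, prv t, True))"
  have prv: "prv t \<in> B" "next_mark (prv t) = t" if "t \<in> B" for t
    using that next_mark by (auto simp: prv_def bij_betw_def inv_into_into f_inv_into_f)
  have nx: "next_mark t \<in> B" "prv (next_mark t) = t" if "t \<in> B" for t
    using that next_mark by (auto simp: prv_def bij_betw_def inv_into_f_f)
  have \<tau>C: "\<tau> x \<in> ?C" if "x \<in> ?C" for x
  proof -
    obtain c t e where x: "x = (c, t, e)" by (cases x)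
    show ?thesis
    proof (cases e)
      case True
      then show ?thesis using that x closed[of t c] nx[of t] by (auto simp: \<tau>_def)
    next
      case False
      then show ?thesis using that x closed[of "prv t" c] prv[of t] by (auto simp: \<tau>_def)
    qed
  qed
  have inv: "\<tau> (\<tau> x) = x" if "x \<in> ?C" for x
    using that prv nx by (cases x) (auto simp: \<tau>_def)
  have ne: "\<tau> x \<noteq> x" for x by (cases x) (auto simp: \<tau>_def)
  obtain c t e where h': "h = (c, t, e)" "t \<in> B" using h by auto
  have hC: "h \<in> ?C" using h by simp
  obtain t1 where t1: "\<tau> h = (c, t1, \<not> e)" by (cases e) (auto simp: h' \<tau>_def)
  obtain c' t' e' where *: "t' \<in> B" "(c', t') \<noteq> (c, t)" "(c', t') \<noteq> (c, t1)" "G (c', t', e') = G (c, t, e)"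
    by (rule pattern_moment_nonzeroD[OF B G nz h'(2), of c t1 e])
  define x where "x = (c', t', e')"
  have xC: "x \<in> ?C" using * h' by (simp add: x_def)
  have x: "x \<noteq> h" "x \<noteq> \<tau> h" using * h' t1 by (auto simp: x_def)
  have x': "\<tau> x \<noteq> h" "\<tau> x \<noteq> \<tau> h" using x inv[OF xC] inv[OF hC] by metis+
  have "card {h, \<tau> h, x, \<tau> x} \<le> card ?C"
    using hC xC \<tau>C B by (intro card_mono) auto
  moreover have "card {h, \<tau> h, x, \<tau> x} = 4"
    using x x' ne[of h] ne[of x] by (auto simp: card_insert_if)
  ultimately show ?thesis by simp
qed

text \<open>The square is a sum over two walks, and the expectation depends only on the labels of their marked
steps. Reducing first one walk and then the other to its marked labels leaves a sum over the
labels of two copies of the marks.\<close>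
lemma chaos_part_second_moment:
  assumes t: "psi2_admissible \<mu> t" and n: "even n" and B: "B \<subseteq> {..<n}" "B \<noteq> {}"
  obtains next_mark gap where "bij_betw next_mark B B" "(\<Sum>t\<in>B. gap t) + card B = n"
    "\<And>t. t \<in> B \<Longrightarrow> Suc t + gap t = next_mark t \<or> Suc t + gap t = next_mark t + n"
    "(LINT \<omega>|iid_entries p q \<mu>. (chaos_part p q a n B \<omega>)\<^sup>2) =
      (\<Sum>G\<in>labelings p q B. pattern_moment p q B G *
        (\<Prod>i\<in>UNIV \<times> B. entry_path p q a (Suc (snd i)) (gap (snd i))
           (G (fst i, snd i, True)) (G (fst i, next_mark (snd i), False))))"
proof -
  let ?S = "sites p q"
  let ?E = "{..<p} \<times> {..<q}"
  let ?Z = "PiE {..<n} ?S"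
  let ?H = "PiE (B \<times> UNIV) (half_labels ?S)"
  have finB: "finite B" using B finite_subset by blast
  have per: "\<And>t. ?S (t + n) = ?S t" using n by (rule sites_add_even)
  obtain next_mark gap where *: "bij_betw next_mark B B" "(\<Sum>t\<in>B. gap t) + card B = n"
    "\<And>t. t \<in> B \<Longrightarrow> Suc t + gap t = next_mark t \<or> Suc t + gap t = next_mark t + n"
    and walk: "\<And>\<Psi>. (\<Sum>z\<in>?Z. (\<Prod>t\<in>{..<n} - B. entry_step a t (z t) (z (Suc t mod n))) * \<Psi> (walk_halves n B z))
      = (\<Sum>g\<in>?H. \<Psi> g * (\<Prod>t\<in>B. entry_path p q a (Suc t) (gap t) (g (t, True)) (g (next_mark t, False))))"
    by (rule sum_walks_marked[where L = ?S and s = "entry_step a", OF finite_sites B per refl]) blast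
  define w where "w z = (\<Prod>t\<in>{..<n} - B. a (cell (z t) (z (Suc t mod n))))" for z :: "nat \<Rightarrow> site"
  define T where "T g = (\<Prod>t\<in>B. entry_path p q a (Suc t) (gap t) (g (t, True)) (g (next_mark t, False)))" for g :: "nat \<times> bool \<Rightarrow> site"
  define N where "N z e = card {t\<in>B. cell (z t) (z (Suc t mod n)) = e}" for z :: "nat \<Rightarrow> site" and e
  define M where "M g e = card {t\<in>B. cell (g (t, False)) (g (t, True)) = e}" for g :: "nat \<times> bool \<Rightarrow> site" and e
  define \<Psi> where "\<Psi> g g' = (\<Prod>e\<in>?E. hermite_moment (M g e) (M g' e))" for g g'
  have NM: "N z e = M (walk_halves n B z) e" for z e
    unfolding N_def M_def by (rule arg_cong[of _ _ card]) (auto simp: walk_halves_def)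
  have walk': "(\<Sum>z\<in>?Z. w z * F (walk_halves n B z)) = (\<Sum>g\<in>?H. F g * T g)" for F
    using walk[of F] by (simp only: w_def T_def)
  have "(LINT \<omega>|iid_entries p q \<mu>. (chaos_part p q a n B \<omega>)\<^sup>2)
      = (\<Sum>z\<in>?Z. \<Sum>z'\<in>?Z. w z * w z' * (\<Prod>e\<in>?E. hermite_moment (N z e) (N z' e)))"
    unfolding chaos_part_def iid_entries_def w_def N_def
    by (rule second_moment_hermite_chaos(3)[OF _ t]) simp
  also have "\<dots> = (\<Sum>z\<in>?Z. w z * (\<Sum>z'\<in>?Z. w z' * \<Psi> (walk_halves n B z) (walk_halves n B z')))"
    by (simp add: NM \<Psi>_def sum_distrib_left mult.assoc)
  also have "\<dots> = (\<Sum>g\<in>?H. (\<Sum>z'\<in>?Z. w z' * \<Psi> g (walk_halves n B z')) * T g)"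
    by (rule walk'[of "\<lambda>g. \<Sum>z'\<in>?Z. w z' * \<Psi> g (walk_halves n B z')"])
  also have "\<dots> = (\<Sum>g\<in>?H. \<Sum>g'\<in>?H. \<Psi> g g' * (T g * T g'))"
  proof (rule sum.cong[OF refl])
    fix g
    show "(\<Sum>z'\<in>?Z. w z' * \<Psi> g (walk_halves n B z')) * T g = (\<Sum>g'\<in>?H. \<Psi> g g' * (T g * T g'))"
      unfolding walk'[of "\<Psi> g"] by (simp add: sum_distrib_left mult_ac)
  qed
  also have "\<dots> = (\<Sum>G\<in>labelings p q B. \<Psi> (\<lambda>h. G (False, h)) (\<lambda>h. G (True, h)) *
      (T (\<lambda>h. G (False, h)) * T (\<lambda>h. G (True, h))))"
    unfolding labelings_def by (rule sum_PiE_pair)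
  also have "\<dots> = (\<Sum>G\<in>labelings p q B. pattern_moment p q B G *
        (\<Prod>i\<in>UNIV \<times> B. entry_path p q a (Suc (snd i)) (gap (snd i))
           (G (fst i, snd i, True)) (G (fst i, next_mark (snd i), False))))"
  proof (intro sum.cong refl arg_cong2[of _ _ _ _ "(*)"])
    fix G :: "half \<Rightarrow> site"
    show "\<Psi> (\<lambda>h. G (False, h)) (\<lambda>h. G (True, h)) = pattern_moment p q B G"
      unfolding \<Psi>_def pattern_moment_def block_moment_def M_def
      by (intro prod.cong refl arg_cong2[of _ _ _ _ hermite_moment] arg_cong[of _ _ card])
        (auto simp: step_cell_def)
    let ?F = "\<lambda>c t. entry_path p q a (Suc t) (gap t) (G (c, t, True)) (G (c, next_mark t, False))"
    have "(\<Prod>i\<in>UNIV \<times> B. ?F (fst i) (snd i)) = (\<Prod>c\<in>UNIV. \<Prod>t\<in>B. ?F c t)"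
      by (subst prod.cartesian_product) (simp add: case_prod_unfold)
    then show "T (\<lambda>h. G (False, h)) * T (\<lambda>h. G (True, h)) = (\<Prod>i\<in>UNIV \<times> B. ?F (fst i) (snd i))"
      by (simp add: T_def UNIV_bool mult.commute)
  qed
  finally show thesis by (intro that[of next_mark gap] *)
qed

text \<open>Apply the bound for pattern sums to the halves, with the gaps as kernels. In each of the two copies
the gaps have total length \<open>2 k - card B\<close>, which gives the power of \<open>\<sigma>\<close>, and each marked step has one
half among \<open>p\<close> rows and one among \<open>q\<close> columns, which gives the power of the fourth root of \<open>p q\<close>.\<close>
lemma chaos_part_second_moment_le:
  assumes t: "psi2_admissible \<mu> t" and k: "0 < k" and pq: "0 < p" "0 < q"
    and B: "B \<subseteq> {..<2 * k}" "B \<noteq> {}"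
    and \<sigma>: "0 \<le> \<sigma>" "\<sigma> ^ (2 * k) = (\<Sum>u\<in>sites p q 0. entry_path p q a 0 (2 * k) u u)"
  shows "(LINT \<omega>|iid_entries p q \<mu>. (chaos_part p q a (2 * k) B \<omega>)\<^sup>2)
    \<le> (8 * real k) ^ (16 * k) * (12 * t * real k) ^ (4 * k)
       * (\<sigma> ^ (2 * k - card B) * sqrt (sqrt (real (p * q))) ^ card B)\<^sup>2"
proof -
  let ?S = "sites p q"
  let ?H = "UNIV \<times> B \<times> UNIV :: half set"
  let ?I = "UNIV \<times> B :: (bool \<times> nat) set"
  let ?L = "\<lambda>(c :: bool, h). half_labels ?S h"
  define m where "m = sqrt (sqrt (real (p * q)))"
  define b where "b = card B"
  have finB: "finite B" using B finite_subset by blast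
  have bk: "b \<le> 2 * k" using card_mono[OF _ B(1)] by (simp add: b_def)
  have b0: "0 < b" using finB B(2) by (simp add: b_def card_gt_0_iff)
  have t1: "1 \<le> t" by (rule psi2_admissible_ge_1[OF t])
  obtain next_mark gap where next_mark: "bij_betw next_mark B B" and gap: "(\<Sum>t\<in>B. gap t) + card B = 2 * k"
    and pos: "\<And>t. t \<in> B \<Longrightarrow> Suc t + gap t = next_mark t \<or> Suc t + gap t = next_mark t + 2 * k"
    and eq: "(LINT \<omega>|iid_entries p q \<mu>. (chaos_part p q a (2 * k) B \<omega>)\<^sup>2) =
      (\<Sum>G\<in>labelings p q B. pattern_moment p q B G *
        (\<Prod>i\<in>?I. entry_path p q a (Suc (snd i)) (gap (snd i))
           (G (fst i, snd i, True)) (G (fst i, next_mark (snd i), False))))"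
    by (rule chaos_part_second_moment[OF t _ B, of p q a]) auto
  have nxtB: "next_mark t \<in> B" if "t \<in> B" for t using next_mark that by (auto simp: bij_betw_def)
  have L: "?L (c, s, e) = ?S (if e then Suc s else s)" for c s e by (simp add: half_labels_def)
  have cardH: "card ?H = 4 * b" by (simp add: card_cartesian_product b_def)
  have "\<bar>\<Sum>G\<in>labelings p q B. pattern_moment p q B G *
        (\<Prod>i\<in>?I. entry_path p q a (Suc (snd i)) (gap (snd i))
           (G (fst i, snd i, True)) (G (fst i, next_mark (snd i), False)))\<bar>
    \<le> real (card ?H) ^ (2 * card ?H) * (3 * (t * real (4 * k))) ^ (2 * card B)
       * (\<Prod>i\<in>?I. \<sigma> ^ gap (snd i)) * (\<Prod>h\<in>?H. sqrt (sqrt (card (?L h))))"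
    unfolding labelings_def
  proof (rule pattern_sum_bound, fold labelings_def)
    show "finite ?H" "finite ?I" using finB by auto
    show "finite (?L h)" if "h \<in> ?H" for h by (cases h) (simp add: half_labels_def)
    show "?L h \<noteq> {}" if "h \<in> ?H" for h using pq by (cases h) (auto simp: half_labels_def sites_def)
    show "?L h = ?L h' \<or> ?L h \<inter> ?L h' = {}" if "h \<in> ?H" "h' \<in> ?H" for h h'
      by (cases h; cases h') (simp only: L sites_eq_or_disjoint)
    show "(fst i, snd i, True) \<in> ?H" "(fst i, next_mark (snd i), False) \<in> ?H" if "i \<in> ?I" for i
      using that nxtB by auto
    show "kernel_bounded (?L (fst i, snd i, True)) (?L (fst i, next_mark (snd i), False))
        (entry_path p q a (Suc (snd i)) (gap (snd i))) (\<sigma> ^ gap (snd i))" if "i \<in> ?I" for i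
    proof -
      have "snd i \<in> B" using that by auto
      moreover have "?S (next_mark (snd i) + 2 * k) = ?S (next_mark (snd i))"
        by (rule sites_add_even) simp
      ultimately have "?S (next_mark (snd i)) = ?S (Suc (snd i) + gap (snd i))"
        using pos[of "snd i"] by metis
      moreover have "kernel_bounded (?S (Suc (snd i))) (?S (Suc (snd i) + gap (snd i)))
          (entry_path p q a (Suc (snd i)) (gap (snd i))) (\<sigma> ^ gap (snd i))"
        by (rule path_kernel_bounded) (auto intro: entry_step_bounded[OF k \<sigma>])
      ultimately show ?thesis by (simp only: L if_True if_False)
    qed
    show "pattern_moment p q B g = pattern_moment p q B g'"
      if "g \<in> labelings p q B" "g' \<in> labelings p q B"
        "\<And>h h'. h \<in> ?H \<Longrightarrow> h' \<in> ?H \<Longrightarrow> (g h = g h') = (g' h = g' h')" for g g'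
      by (rule pattern_moment_cong[OF finB that])
    show "\<bar>pattern_moment p q B g\<bar> \<le> (3 * (t * real (4 * k))) ^ (2 * card B)"
      if "g \<in> labelings p q B" for g
      by (rule abs_pattern_moment_le[OF t _ _ finB that]) (use k bk in \<open>auto simp: b_def\<close>)
    show "2 \<le> card {h'\<in>?H. g h' = g h}"
      if "g \<in> labelings p q B" "pattern_moment p q B g \<noteq> 0" "h \<in> ?H" for g h
      by (rule pattern_moment_two[OF finB that])
    show "4 \<le> card {h'\<in>?H. g h' = g h}"
      if "g \<in> labelings p q B" "pattern_moment p q B g \<noteq> 0" "h \<in> ?H"
        and "\<And>i. i \<in> ?I \<Longrightarrow> (g (fst i, snd i, True) = g h) = (g (fst i, next_mark (snd i), False) = g h)" for g h
    proof (rule pattern_moment_four[OF finB that(1-3) next_mark])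
      fix c s assume "s \<in> B"
      then show "(g (c, s, True) = g h) = (g (c, next_mark s, False) = g h)" using that(4)[of "(c, s)"] by simp
    qed
  qed
  also have "(\<Prod>i\<in>?I. \<sigma> ^ gap (snd i)) = (\<sigma> ^ (2 * k - b))\<^sup>2"
  proof -
    have "(\<Prod>i\<in>?I. \<sigma> ^ gap (snd i)) = (\<Prod>c\<in>(UNIV :: bool set). \<Prod>t\<in>B. \<sigma> ^ gap t)"
      by (subst prod.cartesian_product) (simp add: case_prod_unfold)
    also have "\<dots> = (\<sigma> ^ (\<Sum>t\<in>B. gap t))\<^sup>2"
      by (simp add: power_sum UNIV_bool power2_eq_square)
    also have "(\<Sum>t\<in>B. gap t) = 2 * k - b" using gap by (simp add: b_def)
    finally show ?thesis .
  qed
  also have "(\<Prod>h\<in>?H. sqrt (sqrt (card (?L h)))) = (m ^ b)\<^sup>2"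
  proof -
    have "(\<Prod>h\<in>?H. sqrt (sqrt (card (?L h))))
        = (\<Prod>c\<in>(UNIV :: bool set). \<Prod>s\<in>B. \<Prod>e\<in>(UNIV :: bool set). sqrt (sqrt (card (?L (c, s, e)))))"
      unfolding prod.cartesian_product by (simp only: case_prod_unfold fst_conv snd_conv prod.collapse)
    also have "\<dots> = (\<Prod>c\<in>(UNIV :: bool set). \<Prod>s\<in>B. m)"
    proof (intro prod.cong refl)
      fix c s
      show "(\<Prod>e\<in>(UNIV :: bool set). sqrt (sqrt (card (?L (c, s, e))))) = m"
        unfolding L by (simp add: UNIV_bool card_sites m_def real_sqrt_mult[symmetric])
    qed
    also have "\<dots> = (m ^ b)\<^sup>2" by (simp add: b_def UNIV_bool power2_eq_square)
    finally show ?thesis .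
  qed
  finally have "(LINT \<omega>|iid_entries p q \<mu>. (chaos_part p q a (2 * k) B \<omega>)\<^sup>2)
      \<le> (real (4 * b) ^ (2 * (4 * b)) * (3 * (t * real (4 * k))) ^ (2 * b)) * (\<sigma> ^ (2 * k - b) * m ^ b)\<^sup>2"
    unfolding eq cardH by (simp add: b_def power_mult_distrib mult_ac)
  also have "\<dots> \<le> ((8 * real k) ^ (16 * k) * (12 * t * real k) ^ (4 * k)) * (\<sigma> ^ (2 * k - b) * m ^ b)\<^sup>2"
  proof (intro mult_right_mono mult_mono)
    have "real (4 * b) ^ (2 * (4 * b)) \<le> (8 * real k) ^ (2 * (4 * b))"
      using bk by (intro power_mono) auto
    also have "\<dots> \<le> (8 * real k) ^ (16 * k)"
      using bk k by (intro power_increasing) auto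
    finally show "real (4 * b) ^ (2 * (4 * b)) \<le> (8 * real k) ^ (16 * k)" .
    have "1 \<le> 12 * t * real k" using mult_mono[OF t1, of 1 "real k"] k t1 by simp
    then show "(3 * (t * real (4 * k))) ^ (2 * b) \<le> (12 * t * real k) ^ (4 * k)"
      using bk power_increasing[of "2 * b" "4 * k" "12 * t * real k"] by (simp add: mult_ac)
  qed (use t1 in auto)
  finally show ?thesis by (simp only: b_def m_def)
qed

end

section \<open>From the expansion to the Schatten norm\<close>

lemma U_stat_chaos_expansion:
  assumes A: "A \<in> carrier_mat p q" and k: "0 < k"
  shows "U_stat k (A + mat p q \<omega>) = (\<Sum>B\<in>Pow {..<2 * k}. chaos_part p q (($$) A) (2 * k) B \<omega>)"
proof -
  let ?E = "{..<p} \<times> {..<q}"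
  let ?Z = "PiE {..<2 * k} (sites p q)"
  let ?\<kappa> = "\<lambda>z t. cell (z t) (z (Suc t mod (2 * k)))"
  let ?F = "\<lambda>z B. (\<Prod>t\<in>{..<2 * k} - B. A $$ ?\<kappa> z t) * (\<Prod>e\<in>?E. hermite (card {t\<in>B. ?\<kappa> z t = e}) (\<omega> e))"
  have Y: "A + mat p q \<omega> \<in> carrier_mat p q" using A by simp
  have "(\<Prod>e\<in>?E. hermite (card {t\<in>{..<2 * k}. ?\<kappa> z t = e}) ((A + mat p q \<omega>) $$ e))
      = (\<Sum>B\<in>Pow {..<2 * k}. ?F z B)"
    if z: "z \<in> ?Z" for z
  proof -
    have "(\<Prod>e\<in>?E. hermite (card {t\<in>{..<2 * k}. ?\<kappa> z t = e}) ((A + mat p q \<omega>) $$ e))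
      = (\<Prod>e\<in>?E. hermite (card {t\<in>{..<2 * k}. ?\<kappa> z t = e}) (A $$ e + \<omega> e))"
      using A by (intro prod.cong) auto
    also have "\<dots> = (\<Sum>B\<in>Pow {..<2 * k}. ?F z B)"
    proof (rule prod_hermite_add)
      show "?\<kappa> z ` {..<2 * k} \<subseteq> ?E"
      proof (rule image_subsetI)
        fix t assume t: "t \<in> {..<2 * k}"
        show "?\<kappa> z t \<in> ?E"
        proof (rule cell_in_range)
          show "z t \<in> sites p q t" by (rule PiE_mem[OF z t])
          have "z (Suc t mod (2 * k)) \<in> sites p q (Suc t mod (2 * k))"
            by (rule PiE_mem[OF z]) (use k in simp)
          moreover have "odd (Suc t mod (2 * k)) = odd (Suc t)" by (simp add: dvd_mod_iff)
          ultimately show "z (Suc t mod (2 * k)) \<in> sites p q (Suc t)" by (simp add: sites_def)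
        qed
      qed
    qed auto
    finally show ?thesis .
  qed
  then have "U_stat k (A + mat p q \<omega>) = (\<Sum>z\<in>?Z. \<Sum>B\<in>Pow {..<2 * k}. ?F z B)"
    unfolding U_stat_eq_sum_walks[OF Y k] by (rule sum.cong[OF refl])
  also have "\<dots> = (\<Sum>B\<in>Pow {..<2 * k}. chaos_part p q (($$) A) (2 * k) B \<omega>)"
    unfolding chaos_part_def by (rule sum.swap)
  finally show ?thesis .
qed

lemma chaos_part_empty:
  assumes A: "A \<in> carrier_mat p q" and k: "0 < k"
  shows "chaos_part p q (($$) A) (2 * k) {} \<omega> = schatten_norm (2 * k) A ^ (2 * k)"
proof -
  have "chaos_part p q (($$) A) (2 * k) {} \<omega>
      = (\<Sum>z\<in>PiE {..<2 * k} (sites p q). \<Prod>t<2 * k. A $$ cell (z t) (z (Suc t mod (2 * k))))"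
    by (simp add: chaos_part_def)
  also have "\<dots> = (\<Sum>u\<in>sites p q 0. entry_path p q (($$) A) 0 (2 * k) u u)"
    by (rule sum_closed_walks_eq_path_kernel) (use k in auto)
  finally show ?thesis unfolding schatten_norm_power(2)[OF A k] .
qed

text \<open>With \<open>w\<close> for the root: if \<open>\<bar>w - s\<bar>\<close> exceeds \<open>m\<close>, then the larger of \<open>w\<close> and \<open>s\<close> is at least
\<open>max s m\<close>, so the \<open>n\<close>-th powers are separated by at least \<open>\<bar>w - s\<bar>\<close> times \<open>max s m ^ (n - 1)\<close>.
The bound is linear in \<open>\<bar>u - s ^ n\<bar>\<close>, so expectations can be taken on both sides even when \<open>s\<close> is small.\<close>
lemma root_error_le:
  fixes s m u :: real
  assumes n: "0 < n" and s: "0 \<le> s" and m: "0 < m"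
  shows "\<bar>max u 0 powr (1 / real n) - s\<bar> \<le> m + \<bar>u - s ^ n\<bar> / max s m ^ (n - 1)"
proof -
  define w where "w = max u 0 powr (1 / real n)"
  define M where "M = max s m"
  have M: "0 < M" "s \<le> M" "m \<le> M" using m by (auto simp: M_def)
  have w0: "0 \<le> w" by (simp add: w_def)
  have wn: "w ^ n = max u 0"
  proof (cases "max u 0 = 0")
    case True
    then show ?thesis using n by (simp add: w_def)
  next
    case False
    then have pos: "0 < max u 0" by (simp add: max_def split: if_splits)
    then have "0 < w" by (simp add: w_def)
    then have "w ^ n = w powr real n" by (simp add: powr_realpow)
    also have "\<dots> = max u 0" using pos n by (simp add: w_def powr_powr)
    finally show ?thesis .
  qed
  have diff: "\<bar>w ^ n - s ^ n\<bar> \<le> \<bar>u - s ^ n\<bar>"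
    unfolding wn using zero_le_power[OF s, of n] by (auto simp: max_def)
  have gap: "(y - x) * y ^ (n - 1) \<le> y ^ n - x ^ n" if "0 \<le> x" "x \<le> y" for x y :: real
  proof -
    have "x * x ^ (n - 1) \<le> x * y ^ (n - 1)" using that by (intro mult_left_mono power_mono) auto
    moreover have "x ^ n = x * x ^ (n - 1)" "y ^ n = y * y ^ (n - 1)"
      using n by (simp_all flip: power_Suc)
    ultimately show ?thesis by (simp add: algebra_simps)
  qed
  show ?thesis
  proof (cases "\<bar>w - s\<bar> \<le> m")
    case True
    moreover have "0 \<le> \<bar>u - s ^ n\<bar> / M ^ (n - 1)" using M by simp
    ultimately show ?thesis unfolding w_def M_def by linarith
  next
    case False
    have "\<bar>w - s\<bar> * M ^ (n - 1) \<le> \<bar>w ^ n - s ^ n\<bar>"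
    proof (cases "s \<le> w")
      case True
      have "M \<le> w" using True False s m by (auto simp: M_def)
      then have "(w - s) * M ^ (n - 1) \<le> (w - s) * w ^ (n - 1)"
        using True M by (intro mult_left_mono power_mono) auto
      also have "\<dots> \<le> w ^ n - s ^ n" by (rule gap[OF s True])
      finally show ?thesis using True by simp
    next
      case False': False
      then have "M = s" using False w0 by (auto simp: M_def)
      then show ?thesis using gap[OF w0, of s] False' by simp
    qed
    also note diff
    finally have "\<bar>w - s\<bar> \<le> \<bar>u - s ^ n\<bar> / M ^ (n - 1)" using M by (simp add: pos_le_divide_eq)
    then show ?thesis using m unfolding w_def M_def by linarith
  qed
qed

lemma (in prob_space) expectation_abs_le_sqrt:
  fixes f :: "'a \<Rightarrow> real"
  assumes "integrable M f" "integrable M (\<lambda>x. (f x)\<^sup>2)"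
  shows "expectation (\<lambda>x. \<bar>f x\<bar>) \<le> sqrt (expectation (\<lambda>x. (f x)\<^sup>2))"
proof -
  have "0 \<le> variance (\<lambda>x. \<bar>f x\<bar>)" by (rule variance_positive)
  also have "\<dots> = expectation (\<lambda>x. \<bar>f x\<bar>\<^sup>2) - (expectation (\<lambda>x. \<bar>f x\<bar>))\<^sup>2"
    by (rule variance_eq) (use assms in simp_all)
  finally show ?thesis by (intro real_le_rsqrt) simp
qed

context standardized_law
begin

lemma prob_space_iid_entries: "prob_space (iid_entries p q \<mu>)"
  unfolding iid_entries_def by (intro prob_space_PiM prob_space_axioms)

lemma chaos_part_integrable:
  assumes t: "psi2_admissible \<mu> t"
  shows "integrable (iid_entries p q \<mu>) (chaos_part p q a n B)"
    "integrable (iid_entries p q \<mu>) (\<lambda>\<omega>. (chaos_part p q a n B \<omega>)\<^sup>2)"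
  unfolding chaos_part_def[abs_def] iid_entries_def
  by (rule second_moment_hermite_chaos(1)[OF _ t], simp) (rule second_moment_hermite_chaos(2)[OF _ t], simp)

text \<open>At least one step reads the noise, which is where the single factor \<open>m\<close> comes from; the remaining
\<open>2 k - 1\<close> factors are estimated by the larger of \<open>\<sigma>\<close> and \<open>m\<close>.\<close>
lemma expectation_abs_chaos_part_le:
  assumes t: "psi2_admissible \<mu> t" and k: "0 < k" and pq: "0 < p" "0 < q"
    and A: "A \<in> carrier_mat p q" and B: "B \<subseteq> {..<2 * k}" "B \<noteq> {}"
  defines "\<sigma> \<equiv> schatten_norm (2 * k) A" and "m \<equiv> sqrt (sqrt (real (p * q)))"
  shows "(LINT \<omega>|iid_entries p q \<mu>. \<bar>chaos_part p q (($$) A) (2 * k) B \<omega>\<bar>)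
    \<le> (8 * real k) ^ (8 * k) * (12 * t * real k) ^ (2 * k) * (max \<sigma> m ^ (2 * k - 1) * m)"
proof -
  interpret P: prob_space "iid_entries p q \<mu>" by (rule prob_space_iid_entries)
  let ?W = "chaos_part p q (($$) A) (2 * k) B"
  let ?Q = "(8 * real k) ^ (8 * k) * (12 * t * real k) ^ (2 * k)"
  define b where "b = card B"
  have finB: "finite B" using B finite_subset by blast
  have bk: "b \<le> 2 * k" using card_mono[OF _ B(1)] by (simp add: b_def)
  have b0: "0 < b" using finB B(2) by (simp add: b_def card_gt_0_iff)
  have t0: "0 \<le> t" using psi2_admissible_ge_1[OF t] by simp
  have \<sigma>0: "0 \<le> \<sigma>" unfolding \<sigma>_def by (rule schatten_norm_power(1)[OF A k])
  have m0: "0 \<le> m" by (simp add: m_def)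
  have "(LINT \<omega>|iid_entries p q \<mu>. \<bar>?W \<omega>\<bar>) \<le> sqrt (LINT \<omega>|iid_entries p q \<mu>. (?W \<omega>)\<^sup>2)"
    by (rule P.expectation_abs_le_sqrt) (rule chaos_part_integrable[OF t])+
  also have "\<dots> \<le> sqrt ((8 * real k) ^ (16 * k) * (12 * t * real k) ^ (4 * k) * (\<sigma> ^ (2 * k - b) * m ^ b)\<^sup>2)"
    unfolding b_def m_def \<sigma>_def
    by (intro real_sqrt_le_mono chaos_part_second_moment_le[OF t k pq B] schatten_norm_power[OF A k])
  also have "(8 * real k) ^ (16 * k) * (12 * t * real k) ^ (4 * k) * (\<sigma> ^ (2 * k - b) * m ^ b)\<^sup>2
      = (?Q * (\<sigma> ^ (2 * k - b) * m ^ b))\<^sup>2"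
  proof -
    have "16 * k = 8 * k * 2" "4 * k = 2 * k * 2" by simp_all
    then show ?thesis by (simp only: power_mult power_mult_distrib)
  qed
  also have "sqrt \<dots> = ?Q * (\<sigma> ^ (2 * k - b) * m ^ b)"
    using t0 \<sigma>0 m0 by (intro real_sqrt_abs[THEN trans] abs_of_nonneg) simp
  also have "\<dots> \<le> ?Q * (max \<sigma> m ^ (2 * k - 1) * m)"
  proof (intro mult_left_mono)
    have "\<sigma> ^ (2 * k - b) * m ^ b = \<sigma> ^ (2 * k - b) * m ^ (b - 1) * m"
      using b0 by (simp flip: power_Suc2 add: mult.assoc)
    also have "\<dots> \<le> max \<sigma> m ^ (2 * k - b) * max \<sigma> m ^ (b - 1) * m"
      using \<sigma>0 m0 by (intro mult_right_mono mult_mono power_mono) auto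
    also have "max \<sigma> m ^ (2 * k - b) * max \<sigma> m ^ (b - 1) = max \<sigma> m ^ (2 * k - 1)"
      using b0 bk by (simp flip: power_add)
    finally show "\<sigma> ^ (2 * k - b) * m ^ b \<le> max \<sigma> m ^ (2 * k - 1) * m" .
  qed (use t0 in simp)
  finally show ?thesis .
qed

lemma schatten_norm_error:
  assumes sub: "subgaussian \<mu> (\<lambda>x. x)" and k: "0 < k" and pq: "0 < p" "0 < q"
    and A: "A \<in> carrier_mat p q"
  defines "err \<equiv> \<lambda>\<omega>. \<bar>max (U_stat k (A + mat p q \<omega>)) 0 powr (1 / real (2 * k)) - schatten_norm (2 * k) A\<bar>"
  shows "integrable (iid_entries p q \<mu>) err"
    "(LINT \<omega>|iid_entries p q \<mu>. err \<omega>)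
       \<le> (24 * psi2_norm \<mu> (\<lambda>x. x) * real k) ^ (11 * k) * sqrt (sqrt (real (p * q)))"
proof -
  interpret P: prob_space "iid_entries p q \<mu>" by (rule prob_space_iid_entries)
  let ?P = "iid_entries p q \<mu>"
  let ?W = "\<lambda>B. chaos_part p q (($$) A) (2 * k) B"
  let ?\<B> = "Pow {..<2 * k} - {{}}"
  define \<psi> where "\<psi> = psi2_norm \<mu> (\<lambda>x. x)"
  define \<sigma> where "\<sigma> = schatten_norm (2 * k) A"
  define m where "m = sqrt (sqrt (real (p * q)))"
  define M where "M = max \<sigma> m"
  define Q where "Q = (8 * real k) ^ (8 * k) * (24 * \<psi> * real k) ^ (2 * k)"
  \<comment> \<open>The deviation of the statistic from \<open>\<sigma>^(2 k)\<close>.\<close>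
  define R where "R \<omega> = (\<Sum>B\<in>?\<B>. ?W B \<omega>)" for \<omega>
  have \<psi>: "1 \<le> \<psi>" and t: "psi2_admissible \<mu> (2 * \<psi>)"
    using psi2_norm_admissible[OF sub] by (simp_all add: \<psi>_def)
  have \<sigma>0: "0 \<le> \<sigma>" unfolding \<sigma>_def by (rule schatten_norm_power(1)[OF A k])
  have m: "0 < m" using pq by (simp add: m_def)
  have M: "0 < M" using m by (simp add: M_def)
  have U: "U_stat k (A + mat p q \<omega>) = \<sigma> ^ (2 * k) + R \<omega>" for \<omega>
    unfolding U_stat_chaos_expansion[OF A k] R_def \<sigma>_def
    by (subst sum.remove[of _ "{}"]) (auto simp: chaos_part_empty[OF A k])
  have R: "integrable ?P R"
    unfolding R_def by (intro Bochner_Integration.integrable_sum chaos_part_integrable(1)[OF t])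
  let ?g = "\<lambda>\<omega>. m + \<bar>R \<omega>\<bar> / M ^ (2 * k - 1)"
  have g: "integrable ?P ?g" using R by simp
  have err_le: "err \<omega> \<le> ?g \<omega>" for \<omega>
    using root_error_le[OF _ \<sigma>0 m, of "2 * k" "\<sigma> ^ (2 * k) + R \<omega>"] k
    by (simp add: err_def U \<sigma>_def[symmetric] M_def)
  have [measurable]: "R \<in> borel_measurable ?P" using R by (rule borel_measurable_integrable)
  show int: "integrable ?P err"
  proof (rule Bochner_Integration.integrable_bound[OF g])
    show "err \<in> borel_measurable ?P" unfolding err_def U by measurable
    show "AE \<omega> in ?P. norm (err \<omega>) \<le> norm (?g \<omega>)"
    proof (rule AE_I2)
      fix \<omega>
      have "0 \<le> err \<omega>" by (simp add: err_def)
      then show "norm (err \<omega>) \<le> norm (?g \<omega>)" using err_le[of \<omega>] by simp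
    qed
  qed
  have "(LINT \<omega>|?P. \<bar>R \<omega>\<bar>) \<le> (LINT \<omega>|?P. (\<Sum>B\<in>?\<B>. \<bar>?W B \<omega>\<bar>))"
  proof (rule integral_mono)
    show "integrable ?P (\<lambda>\<omega>. \<Sum>B\<in>?\<B>. \<bar>?W B \<omega>\<bar>)"
      by (intro Bochner_Integration.integrable_sum integrable_abs chaos_part_integrable(1)[OF t])
    show "\<bar>R \<omega>\<bar> \<le> (\<Sum>B\<in>?\<B>. \<bar>?W B \<omega>\<bar>)" for \<omega> unfolding R_def by (rule sum_abs)
  qed (use R in simp)
  also have "\<dots> = (\<Sum>B\<in>?\<B>. (LINT \<omega>|?P. \<bar>?W B \<omega>\<bar>))"
    by (intro Bochner_Integration.integral_sum integrable_abs chaos_part_integrable(1)[OF t])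
  also have "\<dots> \<le> (\<Sum>B\<in>?\<B>. Q * (M ^ (2 * k - 1) * m))"
  proof (rule sum_mono)
    fix B assume "B \<in> ?\<B>"
    then show "(LINT \<omega>|?P. \<bar>?W B \<omega>\<bar>) \<le> Q * (M ^ (2 * k - 1) * m)"
      using expectation_abs_chaos_part_le[OF t k pq A, of B]
      by (simp add: Q_def M_def m_def \<sigma>_def mult.assoc)
  qed
  also have "\<dots> \<le> 4 ^ k * (Q * (M ^ (2 * k - 1) * m))"
  proof -
    have "card ?\<B> \<le> card (Pow {..<2 * k})" by (intro card_mono) auto
    also have "\<dots> = 4 ^ k" by (simp add: card_Pow power_mult)
    finally have "real (card ?\<B>) \<le> 4 ^ k" by (metis of_nat_le_iff of_nat_numeral of_nat_power)
    moreover have "0 \<le> Q * (M ^ (2 * k - 1) * m)" using \<psi> m M by (simp add: Q_def)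
    ultimately show ?thesis by (simp add: mult_right_mono)
  qed
  finally have ER: "(LINT \<omega>|?P. \<bar>R \<omega>\<bar>) \<le> 4 ^ k * Q * m * M ^ (2 * k - 1)" by (simp add: mult_ac)
  have "(LINT \<omega>|?P. err \<omega>) \<le> (LINT \<omega>|?P. ?g \<omega>)" by (rule integral_mono[OF int g err_le])
  also have "\<dots> = m + (LINT \<omega>|?P. \<bar>R \<omega>\<bar>) / M ^ (2 * k - 1)"
    using R by (simp add: P.prob_space)
  also have "\<dots> \<le> m + 4 ^ k * Q * m" using ER M by (simp add: pos_divide_le_eq)
  also have "\<dots> = (1 + 4 ^ k * Q) * m" by (simp add: algebra_simps)
  also have "\<dots> \<le> (24 * \<psi> * real k) ^ (11 * k) * m"
  proof (intro mult_right_mono)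
    have k1: "1 \<le> real k" using k by simp
    have \<psi>k: "real k \<le> \<psi> * real k" using mult_right_mono[OF \<psi>, of "real k"] by simp
    have x1: "1 \<le> 24 * \<psi> * real k" "1 \<le> 8 * real k" using k1 \<psi>k by linarith+
    have x2: "8 \<le> 24 * \<psi> * real k" "8 * real k \<le> 24 * \<psi> * real k" using k1 \<psi>k by linarith+
    have "1 * 1 \<le> Q"
      unfolding Q_def by (intro mult_mono one_le_power x1) simp_all
    then have Q1: "1 \<le> Q" by simp
    have "1 + 4 ^ k * Q \<le> 2 * 4 ^ k * Q"
      using mult_mono[of 1 "4 ^ k" 1 Q] Q1 by (simp add: mult.commute)
    also have "\<dots> \<le> 2 ^ k * 4 ^ k * Q"
      using k Q1 by (intro mult_right_mono) (auto intro: self_le_power)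
    also have "2 ^ k * 4 ^ k = (8 :: real) ^ k" by (simp flip: power_mult_distrib)
    also have "8 ^ k * Q \<le> (24 * \<psi> * real k) ^ k * ((24 * \<psi> * real k) ^ (8 * k) * (24 * \<psi> * real k) ^ (2 * k))"
      unfolding Q_def by (intro mult_mono power_mono x2) (use \<psi> in auto)
    also have "\<dots> = (24 * \<psi> * real k) ^ (11 * k)" by (simp flip: power_add)
    finally show "1 + 4 ^ k * Q \<le> (24 * \<psi> * real k) ^ (11 * k)" .
  qed (use m in simp)
  finally show "(LINT \<omega>|?P. err \<omega>) \<le> (24 * psi2_norm \<mu> (\<lambda>x. x) * real k) ^ (11 * k) * sqrt (sqrt (real (p * q)))"
    by (simp only: \<psi>_def m_def)
qed

end

theorem corollary6p4:
  shows "\<exists>c c' :: real. 0 < c \<and> 0 < c' \<and>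
    (\<forall>(k::nat) (p::nat) (q::nat) (A :: real mat) (\<mu> :: real measure).
       0 < k \<longrightarrow> 1 \<le> q \<longrightarrow> q \<le> p \<longrightarrow> A \<in> carrier_mat p q \<longrightarrow>
       prob_space \<mu> \<longrightarrow> sets \<mu> = sets borel \<longrightarrow> subgaussian \<mu> (\<lambda>x. x) \<longrightarrow>
       prob_space.expectation \<mu> (\<lambda>x. x) = 0 \<longrightarrow> prob_space.variance \<mu> (\<lambda>x. x) = 1 \<longrightarrow>
       (let err = (\<lambda>\<omega>. \<bar>max (U_stat k (A + mat p q \<omega>)) 0 powr (1 / real (2 * k))
                        - schatten_norm (2 * k) A\<bar>)
        in integrable (iid_entries p q \<mu>) err \<and>
           prob_space.expectation (iid_entries p q \<mu>) err
             \<le> (c * psi2_norm \<mu> (\<lambda>x. x) * real k) powr (c' * real k)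
               * real (p * q) powr (1 / 4)))"
proof (rule exI[of _ 24], rule exI[of _ 11], intro conjI allI impI)
  fix k p q :: nat and A :: "real mat" and \<mu> :: "real measure"
  assume k: "0 < k" and q: "1 \<le> q" "q \<le> p" and A: "A \<in> carrier_mat p q"
    and \<mu>: "prob_space \<mu>" "sets \<mu> = sets borel" "subgaussian \<mu> (\<lambda>x. x)"
      "prob_space.expectation \<mu> (\<lambda>x. x) = 0" "prob_space.variance \<mu> (\<lambda>x. x) = 1"
  interpret standardized_law \<mu>
    using \<mu> by (intro standardized_law.intro standardized_law_axioms.intro) auto
  have pq: "0 < p" "0 < q" using q by auto
  have root: "sqrt (sqrt (real (p * q))) = real (p * q) powr (1 / 4)"
    by (simp add: powr_half_sqrt[symmetric] powr_powr)
  have "0 < 24 * psi2_norm \<mu> (\<lambda>x. x) * real k" using psi2_norm_admissible(1)[OF \<mu>(3)] k by simp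
  then have pow: "(24 * psi2_norm \<mu> (\<lambda>x. x) * real k) ^ (11 * k)
      = (24 * psi2_norm \<mu> (\<lambda>x. x) * real k) powr (11 * real k)"
    by (subst powr_realpow[symmetric]) auto
  show "let err = (\<lambda>\<omega>. \<bar>max (U_stat k (A + mat p q \<omega>)) 0 powr (1 / real (2 * k)) - schatten_norm (2 * k) A\<bar>)
        in integrable (iid_entries p q \<mu>) err \<and>
           prob_space.expectation (iid_entries p q \<mu>) err
             \<le> (24 * psi2_norm \<mu> (\<lambda>x. x) * real k) powr (11 * real k) * real (p * q) powr (1 / 4)"
    unfolding Let_def
    using schatten_norm_error[OF \<mu>(3) k pq A] unfolding pow root by blast
qed simp_all

end
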